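(* Let $f\colon X\to Y$ be a smooth complete embedding of a Riemannian orbifold $(X,g)$ into another Riemannian orbifold $(Y,h)$ (orbifolds are effective). Then $f$ is harmonic if and only if the induced (foliated) mapping $$L(f)\colon (L(X),\mathcal{F}_X,g_L)\to (L(Y),\mathcal{F}_Y,h_L)$$ is transversely harmonic, where $L(X),L(Y)$ are the linear frame bundles, $\mathcal{F}_X,\mathcal{F}_Y$ are the foliations by the fibres of $L(X)\to X$ and $L(Y)\to Y$, and $g_L,h_L$ are the natural lifts of $g$ and $h$.
   Context: **Orbifolds and complete maps.** An effective $n$-dimensional orbifold $X$ is a paracompact Hausdorff space with an equivalence class of atlases of charts $(\tilde U,\Gamma,\phi)$, where $\tilde U\subset\mathbb{R}^n$ is open and connected, $\Gamma$ is a finite group of diffeomorphisms of $\tilde U$, and $\phi\colon\tilde U\to X$ is $\Gamma$-invariant and induces a homeomorphism of $\tilde U/\Gamma$ onto an open subset of $X$. Charts are locally compatible via smooth embeddings between charts commuting with the maps $\phi$. Around each point $x$ there is a chart $(\tilde U_x,\Gamma_x)$ with $0\in\tilde U_x$ mapped to $x$ and fixed by $\Gamma_x$. A smooth complete orbifold map $f\colon X\to Y$ consists of a continuous map $f$ of underlying spaces together with, for each $x\in X$, a homomorphism $\Theta_{f,x}\colon\Gamma_x\to\Gamma_{f(x)}$ and a smooth $\Theta_{f,x}$-equivariant lift $\tilde f_x\colon\tilde U_x\to\tilde V_{f(x)}$ of $f$ to charts at $x$ and $f(x)$; the lifts are considered as germs. It is an embedding if $f$ is a homeomorphism onto its image and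 the lifts $\tilde f_x$ can be taken to be smooth embeddings (the dimension of $Y$ may be larger than that of $X$). **Riemannian orbifolds and harmonicity.** A Riemannian metric on an orbifold is a compatible family of $\Gamma$-invariant Riemannian metrics on the sets $\tilde U$ of an atlas. The Levi-Civita connections of the charts form the Levi-Civita connection of the orbifold. The tension field of a smooth complete map $f\colon (X,g)\to(Y,h)$ is $\tau(f)=\operatorname{trace}(\mathbf{D}\,df)$, where $\mathbf{D}$ is the connection induced by the two Levi-Civita connections on the bundle $T^*X\otimes f^{-1}TY$. In charts it is the usual tension field of the lifts $\tilde f_x$. The map $f$ is harmonic if $\tau(f)=0$. **Frame bundles.** The linear frame bundle $L(X)$ is obtained by gluing the quotients $L(\tilde U)/\Gamma$, where $L(\tilde U)\cong\tilde U\times GL(n)$ is the linear frame bundle of $\tilde U$ and $\gamma\in\Gamma$ acts by sending a frame $p$ to $d\gamma\circ p$. This action is free and $L(X)$ is a smooth manifold. $\mathcal{F}_X$ is the foliation of $L(X)$ by the (connected components of the) fibres of $L(X)\to X$; its leaves have finite holonomy. The natural lift $g_L$ of $g$ is the Riemannian metric on $L(X)$ given on $L(\tilde U)$ by $\pi^*g+\sum_{i,j}\omega^i_j\otimes\omega^i_j$, where $\pi\colon L(\tilde U)\to\tilde U$ is the projection and $\omega=(\omega^i_j)$ is the Levi-Civita connection form of $g$. It is bundle-like for $\mathcal{F}_X$, and the transverse metric it induces on the charts $\tilde U$ is $g$. The same definitions apply to $(Y,h)$. **The induced map.** $L(f)\colon L(X)\to L(Y)$ denotes the foliated map induced by $f$: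 a smooth map covering $f$, sending leaves of $\mathcal{F}_X$ into leaves of $\mathcal{F}_Y$, whose induced maps between the local transverse manifolds (the charts) are the lifts $\tilde f_x$. When $f$ is an orbifold local diffeomorphism it is locally given by $p\mapsto d\tilde f_x\circ p$; for an embedding of positive codimension the theorem refers to $L(f)$ as the induced foliated map without a further construction. **Transverse harmonicity.** Let $\mathcal{F}$ be a foliation on $M$ with a bundle-like metric $g$: $\mathcal{F}$ is locally defined by Riemannian submersions $p\colon U\to\bar U$ onto local transverse manifolds with metrics $\bar g$ invariant under holonomy. $T\mathcal{F}^\perp$ is the orthogonal complement of the bundle $T\mathcal{F}$ of vectors tangent to leaves. Its foliated local sections are those projectable by the submersions $p$. For foliated local sections $X,Y$ of $T\mathcal{F}^\perp$ put $D_XY=(\nabla_XY)^\perp$, where $\nabla$ is the Levi-Civita connection of $g$; it projects to the Levi-Civita connection of $\bar g$. For a smooth foliated map $F\colon(M_1,\mathcal{F}_1,g_1)\to(M_2,\mathcal{F}_2,g_2)$ let $i_1\colon T\mathcal{F}_1^\perp\to TM_1$ be the inclusion and $\Pi_2\colon TM_2\to T\mathcal{F}_2^\perp$ the orthogonal projection. The operators $D$ induce a covariant derivative $D$ on foliated sections of $(T\mathcal{F}_1^\perp)^*\otimes F^{-1}T\mathcal{F}_2^\perp$. On $F^{-1}T\mathcal{F}_2^\perp$ it is the pull-back derivative: for a local submersion $p_2$ defining $\mathcal{F}_2$, identify this bundle through $dp_2$ with the pull-back by $p_2\circ F$ of the tangent bundle of the local transverse manifold, and pull back the Levi-Civita connection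 of $\bar g_2$. Put $$\tau_b(F)=\operatorname{trace}D(\Pi_2\,dF\,i_1)=\sum_a\big(D_{E_a}(\Pi_2\,dF\,E_a)-\Pi_2\,dF(D_{E_a}E_a)\big)$$ for local orthonormal frames $(E_a)$ of $T\mathcal{F}_1^\perp$ consisting of foliated sections. The map $F$ is transversely (transversally) harmonic if $\tau_b(F)=0$. *)

theory Defs
  imports "HOL-Analysis.Analysis" "HOL-Algebra.Bij"
begin

section \<open>Smooth maps between open subsets of Euclidean spaces\<close>

primrec times_differentiable_on ::
    "nat \<Rightarrow> 'a::real_normed_vector set \<Rightarrow> ('a \<Rightarrow> 'b::real_normed_vector) \<Rightarrow> bool" where
  "times_differentiable_on 0 S f \<longleftrightarrow> continuous_on S f"
| "times_differentiable_on (Suc k) S f \<longleftrightarrow>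
     (\<forall>x\<in>S. f differentiable (at x)) \<and>
     (\<forall>v. times_differentiable_on k S (\<lambda>x. frechet_derivative f (at x) v))"

text \<open>Only used for open \<open>S\<close>; values of \<open>f\<close> outside \<open>S\<close> are then irrelevant.\<close>

definition smooth_on :: "'a::real_normed_vector set \<Rightarrow> ('a \<Rightarrow> 'b::real_normed_vector) \<Rightarrow> bool" where
  "smooth_on S f \<longleftrightarrow> (\<forall>k. times_differentiable_on k S f)"

definition smooth_embedding_on :: "'a::euclidean_space set \<Rightarrow> ('a \<Rightarrow> 'b::euclidean_space) \<Rightarrow> bool" where
  "smooth_embedding_on S f \<longleftrightarrow>
     smooth_on S f \<and> (\<forall>x\<in>S. inj (frechet_derivative f (at x))) \<and>
     (\<exists>k. homeomorphism S (f ` S) f k)"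


section \<open>Riemannian metrics in coordinates\<close>

type_synonym 'e metric = "'e \<Rightarrow> 'e \<Rightarrow> 'e \<Rightarrow> real"

definition riemannian_metric_on :: "'e::euclidean_space set \<Rightarrow> 'e metric \<Rightarrow> bool" where
  "riemannian_metric_on U g \<longleftrightarrow>
     (\<forall>x\<in>U. bilinear (g x) \<and> (\<forall>v w. g x v w = g x w v) \<and> (\<forall>v. v \<noteq> 0 \<longrightarrow> 0 < g x v v)) \<and>
     (\<forall>v w. smooth_on U (\<lambda>x. g x v w))"

text \<open>
  The Christoffel map of the Levi-Civita connection at \<open>x\<close>: the value at \<open>x\<close> of the covariant
  derivative of the constant field \<open>w\<close> in direction \<open>v\<close>. Symmetry expresses vanishing torsion,
  the last condition compatibility with the metric.
\<close>

definition christoffel :: "'e::euclidean_space metric \<Rightarrow> 'e \<Rightarrow> 'e \<Rightarrow> 'e \<Rightarrow> 'e" where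
  "christoffel g x = (THE C. bilinear C \<and> (\<forall>v w. C v w = C w v) \<and>
     (\<forall>u v w. frechet_derivative (\<lambda>y. g y v w) (at x) u = g x (C u v) w + g x v (C u w)))"

definition levi_civita :: "'e::euclidean_space metric \<Rightarrow> ('e \<Rightarrow> 'e) \<Rightarrow> ('e \<Rightarrow> 'e) \<Rightarrow> 'e \<Rightarrow> 'e" where
  "levi_civita g V W x = frechet_derivative W (at x) (V x) + christoffel g x (V x) (W x)"

text \<open>
  Covariant derivative at \<open>x\<close> in direction \<open>v\<close> of a section \<open>s\<close> of the pull-back along \<open>F\<close> of
  the tangent bundle of a domain with metric \<open>h\<close>.
\<close>

definition pullback_derivative ::
    "'b::euclidean_space metric \<Rightarrow> ('a::euclidean_space \<Rightarrow> 'b) \<Rightarrow> ('a \<Rightarrow> 'b) \<Rightarrow> 'a \<Rightarrow> 'a \<Rightarrow> 'b" where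
  "pullback_derivative h F s x v =
     frechet_derivative s (at x) v + christoffel h (F x) (frechet_derivative F (at x) v) (s x)"

definition orthonormal_family ::
    "('e::euclidean_space \<Rightarrow> 'e \<Rightarrow> real) \<Rightarrow> ('b::euclidean_space \<Rightarrow> 'e) \<Rightarrow> bool" where
  "orthonormal_family m e \<longleftrightarrow> (\<forall>a\<in>Basis. \<forall>b\<in>Basis. m (e a) (e b) = (if a = b then 1 else 0))"

definition metric_trace ::
    "('e::euclidean_space \<Rightarrow> 'e \<Rightarrow> real) \<Rightarrow> ('e \<Rightarrow> 'e \<Rightarrow> 'c::euclidean_space) \<Rightarrow> 'c" where
  "metric_trace m B = (THE t. \<forall>e :: 'e \<Rightarrow> 'e.
     orthonormal_family m e \<longrightarrow> t = (\<Sum>a\<in>Basis. B (e a) (e a)))"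

text \<open>
  \<open>(D dF)(v, w)\<close> for the connection on \<open>T\<^sup>*X \<otimes> F\<^sup>-\<^sup>1TY\<close> induced by the two Levi-Civita
  connections, computed with the constant field \<open>w\<close>.
\<close>

definition derivative_of_differential ::
    "'a::euclidean_space metric \<Rightarrow> 'b::euclidean_space metric \<Rightarrow> ('a \<Rightarrow> 'b) \<Rightarrow> 'a \<Rightarrow> 'a \<Rightarrow> 'a \<Rightarrow> 'b" where
  "derivative_of_differential g h F x v w =
     pullback_derivative h F (\<lambda>y. frechet_derivative F (at y) w) x v
     - frechet_derivative F (at x) (levi_civita g (\<lambda>_. v) (\<lambda>_. w) x)"

definition tension_field ::
    "'a::euclidean_space metric \<Rightarrow> 'b::euclidean_space metric \<Rightarrow> ('a \<Rightarrow> 'b) \<Rightarrow> 'a \<Rightarrow> 'b" where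
  "tension_field g h F x = metric_trace (g x) (derivative_of_differential g h F x)"


section \<open>Effective orbifolds\<close>

text \<open>
  A chart consists of a domain, a group of diffeomorphisms of the domain and a map to the orbifold.
  As in \<^term>\<open>BijGroup\<close>, group elements are extensional functions, so that they are determined by
  their values on the domain.
\<close>

record ('e, 'x) orb_chart =
  odom :: "'e set"
  ogrp :: "('e \<Rightarrow> 'e) set"
  omap :: "'e \<Rightarrow> 'x"

definition chart_group :: "('e, 'x) orb_chart \<Rightarrow> ('e \<Rightarrow> 'e) monoid" where
  "chart_group c = (BijGroup (odom c))\<lparr>carrier := ogrp c\<rparr>"

text \<open>
  The last three conditions say that \<open>omap c\<close> is invariant under the group and induces a
  homeomorphism of the orbit space onto an open subset of \<open>X\<close>.
\<close>

definition orbifold_chart :: "'x topology \<Rightarrow> ('e::euclidean_space, 'x) orb_chart \<Rightarrow> bool" where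
  "orbifold_chart X c \<longleftrightarrow>
     open (odom c) \<and> connected (odom c) \<and>
     finite (ogrp c) \<and> subgroup (ogrp c) (BijGroup (odom c)) \<and>
     (\<forall>\<gamma>\<in>ogrp c. smooth_on (odom c) \<gamma>) \<and>
     openin X (omap c ` odom c) \<and>
     quotient_map (top_of_set (odom c)) (subtopology X (omap c ` odom c)) (omap c) \<and>
     (\<forall>u\<in>odom c. \<forall>v\<in>odom c. omap c u = omap c v \<longleftrightarrow> (\<exists>\<gamma>\<in>ogrp c. v = \<gamma> u))"

definition chart_embedding ::
    "('e::euclidean_space, 'x) orb_chart \<Rightarrow> ('e, 'x) orb_chart \<Rightarrow> ('e \<Rightarrow> 'e) \<Rightarrow> bool" where
  "chart_embedding c c' l \<longleftrightarrow>
     smooth_embedding_on (odom c) l \<and> l ` odom c \<subseteq> odom c' \<and>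
     (\<forall>u\<in>odom c. omap c' (l u) = omap c u)"

definition orbifold_atlas :: "'x topology \<Rightarrow> ('e::euclidean_space, 'x) orb_chart set \<Rightarrow> bool" where
  "orbifold_atlas X A \<longleftrightarrow>
     (\<forall>c\<in>A. orbifold_chart X c) \<and>
     topspace X = (\<Union>c\<in>A. omap c ` odom c) \<and>
     (\<forall>c\<in>A. \<forall>c'\<in>A. \<forall>x \<in> omap c ` odom c \<inter> omap c' ` odom c'.
        \<exists>d\<in>A. x \<in> omap d ` odom d \<and> (\<exists>l. chart_embedding d c l) \<and> (\<exists>l. chart_embedding d c' l))"

definition paracompact_space :: "'x topology \<Rightarrow> bool" where
  "paracompact_space X \<longleftrightarrow>
     (\<forall>\<U>. (\<forall>U\<in>\<U>. openin X U) \<and> \<Union>\<U> = topspace X \<longrightarrow>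
        (\<exists>\<V>. (\<forall>V\<in>\<V>. openin X V \<and> (\<exists>U\<in>\<U>. V \<subseteq> U)) \<and> \<Union>\<V> = topspace X \<and> locally_finite_in X \<V>))"

text \<open>An equivalence class of atlases is represented by the maximal atlas it contains.\<close>

definition orbifold :: "'x topology \<Rightarrow> ('e::euclidean_space, 'x) orb_chart set \<Rightarrow> bool" where
  "orbifold X A \<longleftrightarrow>
     Hausdorff_space X \<and> paracompact_space X \<and> orbifold_atlas X A \<and>
     (\<forall>A'. orbifold_atlas X A' \<and> A \<subseteq> A' \<longrightarrow> A' = A)"

text \<open>
  A metric assigns to every chart a metric on its domain. Giving it on the maximal atlas loses no
  generality: a compatible family on one atlas has a unique compatible extension.
\<close>

definition orbifold_metric ::
    "('e::euclidean_space, 'x) orb_chart set \<Rightarrow> (('e, 'x) orb_chart \<Rightarrow> 'e metric) \<Rightarrow> bool" where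
  "orbifold_metric A g \<longleftrightarrow>
     (\<forall>c\<in>A. riemannian_metric_on (odom c) (g c)) \<and>
     (\<forall>c\<in>A. \<forall>\<gamma>\<in>ogrp c. \<forall>u\<in>odom c. \<forall>v w.
        g c (\<gamma> u) (frechet_derivative \<gamma> (at u) v) (frechet_derivative \<gamma> (at u) w) = g c u v w) \<and>
     (\<forall>c\<in>A. \<forall>c'\<in>A. \<forall>l. chart_embedding c c' l \<longrightarrow> (\<forall>u\<in>odom c. \<forall>v w.
        g c' (l u) (frechet_derivative l (at u) v) (frechet_derivative l (at u) w) = g c u v w))"

definition riemannian_orbifold ::
    "'x topology \<Rightarrow> ('e::euclidean_space, 'x) orb_chart set \<Rightarrow> (('e, 'x) orb_chart \<Rightarrow> 'e metric) \<Rightarrow> bool" where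
  "riemannian_orbifold X A g \<longleftrightarrow> orbifold X A \<and> orbifold_metric A g"


section \<open>Complete orbifold maps and harmonicity\<close>

definition chart_centered_at :: "('e::euclidean_space, 'x) orb_chart \<Rightarrow> 'x \<Rightarrow> bool" where
  "chart_centered_at c x \<longleftrightarrow> 0 \<in> odom c \<and> omap c 0 = x \<and> (\<forall>\<gamma>\<in>ogrp c. \<gamma> 0 = 0)"

text \<open>
  A complete map carries, for every point \<open>x\<close>, a chart \<open>src x\<close> at \<open>x\<close>, a chart \<open>tgt x\<close> at the
  image of \<open>x\<close>, a homomorphism of the local groups and a lift. The record holds a representative
  of the germ of the lift; the notions below depend only on the germ.
\<close>

record ('a, 'x, 'b, 'y) complete_map =
  base :: "'x \<Rightarrow> 'y"
  src :: "'x \<Rightarrow> ('a, 'x) orb_chart"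
  tgt :: "'x \<Rightarrow> ('b, 'y) orb_chart"
  theta :: "'x \<Rightarrow> ('a \<Rightarrow> 'a) \<Rightarrow> ('b \<Rightarrow> 'b)"
  lift :: "'x \<Rightarrow> 'a \<Rightarrow> 'b"

definition smooth_complete_map ::
    "'x topology \<Rightarrow> ('a::euclidean_space, 'x) orb_chart set \<Rightarrow>
     'y topology \<Rightarrow> ('b::euclidean_space, 'y) orb_chart set \<Rightarrow> ('a, 'x, 'b, 'y) complete_map \<Rightarrow> bool" where
  "smooth_complete_map X A Y B f \<longleftrightarrow>
     continuous_map X Y (base f) \<and>
     (\<forall>x\<in>topspace X.
        src f x \<in> A \<and> chart_centered_at (src f x) x \<and>
        tgt f x \<in> B \<and> chart_centered_at (tgt f x) (base f x) \<and>
        theta f x \<in> hom (chart_group (src f x)) (chart_group (tgt f x)) \<and>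
        smooth_on (odom (src f x)) (lift f x) \<and>
        lift f x ` odom (src f x) \<subseteq> odom (tgt f x) \<and>
        (\<forall>u\<in>odom (src f x). omap (tgt f x) (lift f x u) = base f (omap (src f x) u)) \<and>
        (\<forall>\<gamma>\<in>ogrp (src f x). \<forall>u\<in>odom (src f x). lift f x (\<gamma> u) = theta f x \<gamma> (lift f x u)))"

definition complete_embedding ::
    "'x topology \<Rightarrow> ('a::euclidean_space, 'x) orb_chart set \<Rightarrow>
     'y topology \<Rightarrow> ('b::euclidean_space, 'y) orb_chart set \<Rightarrow> ('a, 'x, 'b, 'y) complete_map \<Rightarrow> bool" where
  "complete_embedding X A Y B f \<longleftrightarrow>
     smooth_complete_map X A Y B f \<and> embedding_map X Y (base f) \<and>
     (\<forall>x\<in>topspace X. \<exists>W. open W \<and> 0 \<in> W \<and> W \<subseteq> odom (src f x) \<and> smooth_embedding_on W (lift f x))"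

definition harmonic_map ::
    "'x topology \<Rightarrow> (('a::euclidean_space, 'x) orb_chart \<Rightarrow> 'a metric) \<Rightarrow>
     (('b::euclidean_space, 'y) orb_chart \<Rightarrow> 'b metric) \<Rightarrow>
     ('a, 'x, 'b, 'y) complete_map \<Rightarrow> bool" where
  "harmonic_map X g h f \<longleftrightarrow>
     (\<forall>x\<in>topspace X. \<forall>\<^sub>F u in nhds 0. tension_field (g (src f x)) (h (tgt f x)) (lift f x) u = 0)"


section \<open>Foliated Riemannian manifolds and transverse harmonicity\<close>

text \<open>
  A foliated chart is a parametrization \<open>fpar\<close> of an open part of the manifold by the open set
  \<open>fdom\<close>, together with the submersion \<open>fsub\<close> onto a local transverse manifold that defines the
  foliation and the coordinate expression \<open>fmet\<close> of the metric.
\<close>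

record ('e, 'b, 'm) fol_chart =
  fdom :: "'e set"
  fpar :: "'e \<Rightarrow> 'm"
  fsub :: "'e \<Rightarrow> 'b"
  fmet :: "'e metric"

record ('e, 'b, 'm) fol_manifold =
  fpoints :: "'m set"
  fcharts :: "('e, 'b, 'm) fol_chart set"
  fleaves :: "'m set set"

definition vertical :: "('e::euclidean_space, 'b::euclidean_space, 'm) fol_chart \<Rightarrow> 'e \<Rightarrow> 'e set" where
  "vertical c u = {Z. frechet_derivative (fsub c) (at u) Z = 0}"

definition horizontal :: "('e::euclidean_space, 'b::euclidean_space, 'm) fol_chart \<Rightarrow> 'e \<Rightarrow> 'e set" where
  "horizontal c u = {V. \<forall>Z\<in>vertical c u. fmet c u V Z = 0}"

definition horizontal_part ::
    "('e::euclidean_space, 'b::euclidean_space, 'm) fol_chart \<Rightarrow> 'e \<Rightarrow> 'e \<Rightarrow> 'e" where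
  "horizontal_part c u V = (THE H. H \<in> horizontal c u \<and> V - H \<in> vertical c u)"

definition horizontal_lift ::
    "('e::euclidean_space, 'b::euclidean_space, 'm) fol_chart \<Rightarrow> 'e \<Rightarrow> 'b \<Rightarrow> 'e" where
  "horizontal_lift c u v = (THE H. H \<in> horizontal c u \<and> frechet_derivative (fsub c) (at u) H = v)"

text \<open>The metric for which \<open>fsub\<close> is a Riemannian submersion.\<close>

definition transverse_metric :: "('e::euclidean_space, 'b::euclidean_space, 'm) fol_chart \<Rightarrow> 'b metric" where
  "transverse_metric c b v w = (THE r. \<forall>u\<in>fdom c. fsub c u = b \<longrightarrow>
     fmet c u (horizontal_lift c u v) (horizontal_lift c u w) = r)"

definition transverse_derivative ::
    "('e::euclidean_space, 'b::euclidean_space, 'm) fol_chart \<Rightarrow> ('e \<Rightarrow> 'e) \<Rightarrow> ('e \<Rightarrow> 'e) \<Rightarrow> 'e \<Rightarrow> 'e" where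
  "transverse_derivative c V W u = horizontal_part c u (levi_civita (fmet c) V W u)"

text \<open>
  For sections along \<open>G\<close> of the normal bundle of the foliation, the derivative is taken after
  identifying horizontal vectors with tangent vectors of the local transverse manifold through the
  differential of the submersion.
\<close>

definition transverse_pullback_derivative ::
    "('e::euclidean_space, 'b::euclidean_space, 'm) fol_chart \<Rightarrow>
     ('a::euclidean_space \<Rightarrow> 'e) \<Rightarrow> ('a \<Rightarrow> 'e) \<Rightarrow> 'a \<Rightarrow> 'a \<Rightarrow> 'e" where
  "transverse_pullback_derivative c G s u v =
     horizontal_lift c (G u)
       (pullback_derivative (transverse_metric c) (\<lambda>y. fsub c (G y))
          (\<lambda>y. frechet_derivative (fsub c) (at (G y)) (s y)) u v)"

definition foliated_frame ::
    "('e::euclidean_space, 'b::euclidean_space, 'm) fol_chart \<Rightarrow> 'e set \<Rightarrow> ('b \<Rightarrow> 'e \<Rightarrow> 'e) \<Rightarrow> bool" where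
  "foliated_frame c N E \<longleftrightarrow>
     (\<forall>a\<in>Basis. smooth_on N (E a)) \<and>
     (\<forall>a\<in>Basis. \<forall>u\<in>N. E a u \<in> horizontal c u) \<and>
     (\<forall>a\<in>Basis. \<exists>e. \<forall>u\<in>N. frechet_derivative (fsub c) (at u) (E a u) = e (fsub c u)) \<and>
     (\<forall>u\<in>N. orthonormal_family (fmet c u) (\<lambda>a. E a u))"

definition transverse_tension ::
    "('e1::euclidean_space, 'b1::euclidean_space, 'm1) fol_chart \<Rightarrow>
     ('e2::euclidean_space, 'b2::euclidean_space, 'm2) fol_chart \<Rightarrow>
     ('e1 \<Rightarrow> 'e2) \<Rightarrow> ('b1 \<Rightarrow> 'e1 \<Rightarrow> 'e1) \<Rightarrow> 'e1 \<Rightarrow> 'e2" where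
  "transverse_tension c1 c2 G E u =
     (\<Sum>a\<in>Basis.
        transverse_pullback_derivative c2 G
          (\<lambda>y. horizontal_part c2 (G y) (frechet_derivative G (at y) (E a y))) u (E a u)
        - horizontal_part c2 (G u)
            (frechet_derivative G (at u) (transverse_derivative c1 (E a) (E a) u)))"

definition coordinate_expression ::
    "('m1 \<Rightarrow> 'm2) \<Rightarrow> ('e1::euclidean_space, 'b1, 'm1) fol_chart \<Rightarrow>
     ('e2::euclidean_space, 'b2, 'm2) fol_chart \<Rightarrow> 'e1 set \<Rightarrow> ('e1 \<Rightarrow> 'e2) \<Rightarrow> bool" where
  "coordinate_expression F c1 c2 N G \<longleftrightarrow>
     open N \<and> N \<subseteq> fdom c1 \<and> smooth_on N G \<and> G ` N \<subseteq> fdom c2 \<and>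
     (\<forall>u\<in>N. fpar c2 (G u) = F (fpar c1 u))"

definition smooth_foliated_map ::
    "('e1::euclidean_space, 'b1, 'm1) fol_manifold \<Rightarrow> ('e2::euclidean_space, 'b2, 'm2) fol_manifold \<Rightarrow>
     ('m1 \<Rightarrow> 'm2) \<Rightarrow> bool" where
  "smooth_foliated_map M1 M2 F \<longleftrightarrow>
     F ` fpoints M1 \<subseteq> fpoints M2 \<and>
     (\<forall>q\<in>fpoints M1. \<exists>c1\<in>fcharts M1. \<exists>c2\<in>fcharts M2. \<exists>N G.
        coordinate_expression F c1 c2 N G \<and> q \<in> fpar c1 ` N) \<and>
     (\<forall>L1\<in>fleaves M1. \<exists>L2\<in>fleaves M2. F ` L1 \<subseteq> L2)"

definition transversely_harmonic ::
    "('e1::euclidean_space, 'b1::euclidean_space, 'm1) fol_manifold \<Rightarrow>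
     ('e2::euclidean_space, 'b2::euclidean_space, 'm2) fol_manifold \<Rightarrow> ('m1 \<Rightarrow> 'm2) \<Rightarrow> bool" where
  "transversely_harmonic M1 M2 F \<longleftrightarrow>
     (\<forall>c1\<in>fcharts M1. \<forall>c2\<in>fcharts M2. \<forall>N G E.
        coordinate_expression F c1 c2 N G \<and> foliated_frame c1 N E \<longrightarrow>
        (\<forall>u\<in>N. transverse_tension c1 c2 G E u = 0))"


section \<open>The linear frame bundle of a Riemannian orbifold\<close>

text \<open>
  The frame at \<open>u\<close> whose \<open>j\<close>-th vector is the \<open>j\<close>-th column of \<open>P\<close> is the pair \<open>(u, P)\<close>.
\<close>

type_synonym 'n frame_coords = "(real^'n) \<times> (real^'n^'n)"

definition chart_frames :: "(real^'n, 'x) orb_chart \<Rightarrow> 'n frame_coords set" where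
  "chart_frames c = {(u, P). u \<in> odom c \<and> invertible P}"

text \<open>
  The quotients of the sets of frames of the charts are glued along all chart embeddings; the
  elements of the chart groups are among these, as embeddings of a chart into itself.
\<close>

definition frame_gluing ::
    "(real^'n, 'x) orb_chart set \<Rightarrow> ((real^'n, 'x) orb_chart \<times> 'n frame_coords) rel" where
  "frame_gluing A =
     {((c, (u, P)), (c', (l u, matrix (frechet_derivative l (at u)) ** P))) | c c' l u P.
        c \<in> A \<and> c' \<in> A \<and> chart_embedding c c' l \<and> (u, P) \<in> chart_frames c}"

definition frame_equiv ::
    "(real^'n, 'x) orb_chart set \<Rightarrow> ((real^'n, 'x) orb_chart \<times> 'n frame_coords) rel" where
  "frame_equiv A = (frame_gluing A \<union> (frame_gluing A)\<inverse>)\<^sup>* \<inter> Sigma A chart_frames \<times> Sigma A chart_frames"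

type_synonym ('n, 'x) orb_frame = "((real^'n, 'x) orb_chart \<times> 'n frame_coords) set"

definition linear_frames :: "(real^'n, 'x) orb_chart set \<Rightarrow> ('n, 'x) orb_frame set" where
  "linear_frames A = Sigma A chart_frames // frame_equiv A"

definition frame_class ::
    "(real^'n, 'x) orb_chart set \<Rightarrow> (real^'n, 'x) orb_chart \<Rightarrow> 'n frame_coords \<Rightarrow>
     ('n, 'x) orb_frame" where
  "frame_class A c p = frame_equiv A `` {(c, p)}"

definition frame_proj :: "('n, 'x) orb_frame \<Rightarrow> 'x" where
  "frame_proj q = (THE x. \<forall>(c, (u, P))\<in>q. omap c u = x)"

text \<open>
  The value of the Levi-Civita connection form at the frame \<open>(u, P)\<close> on the tangent vector
  \<open>(v, Q)\<close>: the covariant derivatives of the frame vectors, expressed in the frame \<open>P\<close>.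
\<close>

definition connection_form ::
    "(real^'n) metric \<Rightarrow> 'n frame_coords \<Rightarrow> 'n frame_coords \<Rightarrow> real^'n^'n" where
  "connection_form g = (\<lambda>(u, P) (v, Q). matrix_inv P ** (Q + matrix (christoffel g u v) ** P))"

definition frame_metric :: "(real^'n) metric \<Rightarrow> 'n frame_coords metric" where
  "frame_metric g p Z Z' = g (fst p) (fst Z) (fst Z') +
     (\<Sum>i\<in>UNIV. \<Sum>j\<in>UNIV. connection_form g p Z $ i $ j * connection_form g p Z' $ i $ j)"

text \<open>
  As the group of an orbifold chart acts freely on the frames over its domain, the open sets \<open>V\<close>
  on which \<^term>\<open>frame_class A c\<close> is injective cover these frames and give charts of the manifold.
\<close>

definition frame_charts ::
    "(real^'n, 'x) orb_chart set \<Rightarrow> ((real^'n, 'x) orb_chart \<Rightarrow> (real^'n) metric) \<Rightarrow>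
     ('n frame_coords, real^'n, ('n, 'x) orb_frame) fol_chart set" where
  "frame_charts A g =
     {\<lparr>fdom = V, fpar = frame_class A c, fsub = fst, fmet = frame_metric (g c)\<rparr> | c V.
        c \<in> A \<and> open V \<and> V \<subseteq> chart_frames c \<and> inj_on (frame_class A c) V}"

definition frame_topology ::
    "(real^'n, 'x) orb_chart set \<Rightarrow> ('n, 'x) orb_frame topology" where
  "frame_topology A = topology (\<lambda>S. S \<subseteq> linear_frames A \<and>
     (\<forall>c\<in>A. open {p \<in> chart_frames c. frame_class A c p \<in> S}))"

definition frame_bundle ::
    "'x topology \<Rightarrow> (real^'n, 'x) orb_chart set \<Rightarrow> ((real^'n, 'x) orb_chart \<Rightarrow> (real^'n) metric) \<Rightarrow>
     ('n frame_coords, real^'n, ('n, 'x) orb_frame) fol_manifold" where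
  "frame_bundle X A g =
     \<lparr>fpoints = linear_frames A,
      fcharts = frame_charts A g,
      fleaves = (\<Union>x\<in>topspace X. connected_components_of
        (subtopology (frame_topology A) {q \<in> linear_frames A. frame_proj q = x}))\<rparr>"

text \<open>
  A foliated map between the frame bundles induced by \<open>f\<close>: it covers \<open>f\<close>, and near every frame
  at the centre of \<open>src f x\<close> it is represented by a map \<open>G\<close> of frames whose induced map between
  the local transverse manifolds is the lift of \<open>f\<close> at \<open>x\<close>. These conditions do not determine
  the map uniquely. If \<open>f\<close> is a local diffeomorphism, sending a frame \<open>p\<close> to the composition of
  the differential of the lift with \<open>p\<close> is one such map; in positive codimension there is no
  canonical choice.
\<close>

definition induced_frame_map ::
    "'x topology \<Rightarrow> (real^'n, 'x) orb_chart set \<Rightarrow> ((real^'n, 'x) orb_chart \<Rightarrow> (real^'n) metric) \<Rightarrow>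
     'y topology \<Rightarrow> (real^'m, 'y) orb_chart set \<Rightarrow> ((real^'m, 'y) orb_chart \<Rightarrow> (real^'m) metric) \<Rightarrow>
     (real^'n, 'x, real^'m, 'y) complete_map \<Rightarrow>
     (('n, 'x) orb_frame \<Rightarrow> ('m, 'y) orb_frame) \<Rightarrow> bool" where
  "induced_frame_map X A g Y B h f F \<longleftrightarrow>
     smooth_foliated_map (frame_bundle X A g) (frame_bundle Y B h) F \<and>
     (\<forall>q\<in>linear_frames A. frame_proj (F q) = base f (frame_proj q)) \<and>
     (\<forall>x\<in>topspace X. \<forall>P. invertible P \<longrightarrow>
        (\<exists>N G. open N \<and> (0, P) \<in> N \<and> N \<subseteq> chart_frames (src f x) \<and>
           smooth_on N G \<and> G ` N \<subseteq> chart_frames (tgt f x) \<and>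
           (\<forall>p\<in>N. frame_class B (tgt f x) (G p) = F (frame_class A (src f x) p)) \<and>
           (\<forall>p\<in>N. fst (G p) = lift f x (fst p))))"

end

theory Submission
  imports Defs
begin

text \<open>
  The projections of the frame bundles onto the orbifold charts are Riemannian submersions, so by
  O'Neill's formula the transverse tension of \<open>Lf\<close> at a frame is the horizontal lift of the
  tension of the map \<open>\<phi>\<close> that \<open>Lf\<close> induces between the charts; such a map exists locally
  because the fibres of a chart are finite. It remains to compare \<open>\<phi>\<close> with the chosen lifts of
  \<open>f\<close>. After isometric changes of charts both are lifts of the same map, hence agree up to a group
  element on a neighbourhood of each point of an open dense set. Tension fields are natural under
  isometries and continuous, so one vanishes if the other does. For the converse the lifts of \<open>f\<close>
  themselves are induced maps, and one needs that frames are locally separated by the gluing: a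
  group element fixing a frame is the identity near it.
\<close>

section \<open>Calculus of smooth maps\<close>

text \<open>Christoffel maps, traces, horizontal lifts and transverse metrics are definite
  descriptions, so each needs an existence and uniqueness proof before it can be computed with.
  Smoothness then comes from smooth Gram-Schmidt frames, in which these objects are explicit sums.
  The obstacle in comparing lifts is that tension involves second derivatives: agreement at a point
  up to a group element says nothing about a neighbourhood. Of finitely many group elements, one
  works on an open set having the point in its closure; the tension vanishes there, and continuity
  carries this to the point. The two notions are also quantified differently. Harmonicity constrains
  only germs of lifts at chart centres, transverse harmonicity all coordinate expressions. For a
  frame over an arbitrary point one therefore uses the lift centred at that very point and an
  isometric chart change taking the point to the centre. Conversely, coordinate expressions live on
  sets where the gluing is injective, and such sets have to be produced near a frame before the
  hypothesis applies.\<close>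

abbreviation fderiv :: "('a::real_normed_vector \<Rightarrow> 'b::real_normed_vector) \<Rightarrow> 'a \<Rightarrow> 'a \<Rightarrow> 'b" where
  "fderiv f x \<equiv> frechet_derivative f (at x)"

lemma fderiv_eq: "(f has_derivative f') (at x) \<Longrightarrow> fderiv f x = f'"
  using frechet_derivative_at by metis

lemma has_fderiv: "f differentiable at x \<Longrightarrow> (f has_derivative fderiv f x) (at x)"
  using frechet_derivative_works by blast

lemma fderiv_cong:
  assumes "open S" "x \<in> S" "\<And>y. y \<in> S \<Longrightarrow> f y = g y" "f differentiable at x"
  shows "fderiv f x = fderiv g x" "g differentiable at x"
proof -
  show "fderiv f x = fderiv g x"
    using frechet_derivative_transform_within_open[OF assms(4,1,2,3)] by blast
  have "(g has_derivative fderiv f x) (at x)"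
    using has_derivative_transform_within_open[OF has_fderiv[OF assms(4)] assms(1-3)] by blast
  then show "g differentiable at x" by (rule differentiableI)
qed

section \<open>Closure properties of finite differentiability order\<close>

lemma times_differentiable_on_cong:
  assumes "open S" "\<And>x. x \<in> S \<Longrightarrow> f x = g x" "times_differentiable_on k S f"
  shows "times_differentiable_on k S g"
  using assms(2,3)
proof (induction k arbitrary: f g)
  case 0
  then show ?case by (simp cong: continuous_on_cong)
next
  case (Suc k)
  have "fderiv f x = fderiv g x \<and> g differentiable at x" if "x \<in> S" for x
    using fderiv_cong[OF \<open>open S\<close> that, of f g] Suc.prems that by auto
  then show ?case
    using Suc.prems(2) Suc.IH[of "\<lambda>x. fderiv f x v" "\<lambda>x. fderiv g x v" for v] by auto
qed

text \<open>The definition refers to the chosen \<open>frechet_derivative\<close>; this rule lets an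
  induction supply any explicit formula for the derivative. Openness makes the derivative depend
  only on values in \<open>S\<close>.\<close>

lemma times_differentiable_onI:
  assumes "\<And>x. x \<in> S \<Longrightarrow> (f has_derivative f' x) (at x)"
    and "\<And>v. times_differentiable_on k S (\<lambda>x. f' x v)" and "open S"
  shows "times_differentiable_on (Suc k) S f"
proof -
  have "times_differentiable_on k S (\<lambda>x. fderiv f x v)" for v
    by (rule times_differentiable_on_cong[OF assms(3) _ assms(2)[of v]]) (simp add: fderiv_eq[OF assms(1)])
  then show ?thesis using assms(1) by (auto intro: differentiableI)
qed

lemma times_differentiable_on_Suc_imp:
  "times_differentiable_on (Suc k) S f \<Longrightarrow> times_differentiable_on k S f"
proof (induction k arbitrary: f)
  case 0
  then show ?case
    by (auto intro!: continuous_at_imp_continuous_on differentiable_imp_continuous_within)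
next
  case (Suc k)
  then show ?case using times_differentiable_on.simps(2) by blast
qed

lemma times_differentiable_on_subset:
  "times_differentiable_on k S f \<Longrightarrow> T \<subseteq> S \<Longrightarrow> times_differentiable_on k T f"
  by (induction k arbitrary: f) (auto intro: continuous_on_subset)

lemma times_differentiable_on_const: "times_differentiable_on k S (\<lambda>x. c)"
  by (induction k arbitrary: c) auto

lemma times_differentiable_on_linear:
  assumes "bounded_linear L" shows "times_differentiable_on k S L"
proof (cases k)
  case 0
  then show ?thesis using assms by (simp add: linear_continuous_on)
next
  case (Suc j)
  have "(L has_derivative L) (at x)" for x
    using assms by (rule bounded_linear_imp_has_derivative)
  then show ?thesis
    unfolding Suc using fderiv_eq[of L L] times_differentiable_on_const by (auto intro: differentiableI)
qed

lemma times_differentiable_on_add: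
  assumes "open S" "times_differentiable_on k S f" "times_differentiable_on k S g"
  shows "times_differentiable_on k S (\<lambda>x. f x + g x)"
  using assms(2,3)
proof (induction k arbitrary: f g)
  case 0
  then show ?case by (auto intro: continuous_intros)
next
  case (Suc k)
  show ?case
  proof (rule times_differentiable_onI[OF _ _ \<open>open S\<close>])
    show "((\<lambda>x. f x + g x) has_derivative (\<lambda>v. fderiv f x v + fderiv g x v)) (at x)" if "x \<in> S" for x
      using Suc.prems that by (auto intro!: has_derivative_add has_fderiv)
    show "times_differentiable_on k S (\<lambda>x. fderiv f x v + fderiv g x v)" for v
      using Suc.prems by (auto intro: Suc.IH)
  qed
qed

lemma times_differentiable_on_bilinear:
  assumes "bounded_bilinear B" "open S" "times_differentiable_on k S f" "times_differentiable_on k S g"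
  shows "times_differentiable_on k S (\<lambda>x. B (f x) (g x))"
  using assms(3,4)
proof (induction k arbitrary: f g)
  case 0
  then show ?case by (auto intro: bounded_bilinear.continuous_on[OF assms(1)])
next
  case (Suc k)
  show ?case
  proof (rule times_differentiable_onI[OF _ _ \<open>open S\<close>])
    show "((\<lambda>x. B (f x) (g x)) has_derivative (\<lambda>v. B (f x) (fderiv g x v) + B (fderiv f x v) (g x))) (at x)"
      if "x \<in> S" for x
      using Suc.prems that by (auto intro!: bounded_bilinear.FDERIV[OF assms(1)] has_fderiv)
    show "times_differentiable_on k S (\<lambda>x. B (f x) (fderiv g x v) + B (fderiv f x v) (g x))" for v
      by (intro times_differentiable_on_add \<open>open S\<close> Suc.IH times_differentiable_on_Suc_imp[OF Suc.prems(1)]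
          times_differentiable_on_Suc_imp[OF Suc.prems(2)]) (use Suc.prems in auto)
  qed
qed

lemma times_differentiable_on_sum:
  assumes "open S" "\<And>i. i \<in> I \<Longrightarrow> times_differentiable_on k S (f i)"
  shows "times_differentiable_on k S (\<lambda>x. \<Sum>i\<in>I. f i x)"
  using assms(2)
  by (induction I rule: infinite_finite_induct)
     (auto intro: times_differentiable_on_const times_differentiable_on_add[OF \<open>open S\<close>])

lemma linear_Basis_expand:
  fixes L :: "'a::euclidean_space \<Rightarrow> 'b::real_vector"
  assumes "linear L" shows "L v = (\<Sum>b\<in>Basis. (v \<bullet> b) *\<^sub>R L b)"
proof -
  have "L v = L (\<Sum>b\<in>Basis. (v \<bullet> b) *\<^sub>R b)" by (simp add: euclidean_representation)
  then show ?thesis using assms by (simp add: linear_sum linear_cmul)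
qed

text \<open>The chain rule differentiates \<open>g\<close> in the varying direction
  \<open>fderiv f x v\<close>. Expanding that direction in the basis leaves derivatives of
  \<open>g\<close> in constant directions, composed with \<open>f\<close>, and to these the
  induction hypothesis applies.\<close>

lemma times_differentiable_on_compose:
  fixes g :: "'b::euclidean_space \<Rightarrow> 'c::real_normed_vector"
  assumes "open S" "open T" "f ` S \<subseteq> T" "times_differentiable_on k S f" "times_differentiable_on k T g"
  shows "times_differentiable_on k S (\<lambda>x. g (f x))"
  using assms(4,5)
proof (induction k arbitrary: g)
  case 0
  then show ?case using assms(3) by (auto intro: continuous_on_compose2)
next
  case (Suc k)
  have diff: "f differentiable at x" "g differentiable at (f x)" if "x \<in> S" for x
    using Suc.prems that assms(3) by auto
  show ?case
  proof (rule times_differentiable_onI[OF _ _ \<open>open S\<close>])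
    show "((\<lambda>x. g (f x)) has_derivative (\<lambda>v. \<Sum>b\<in>Basis. (fderiv f x v \<bullet> b) *\<^sub>R fderiv g (f x) b)) (at x)"
      if "x \<in> S" for x
      using diff_chain_at[OF has_fderiv[OF diff(1)[OF that]] has_fderiv[OF diff(2)[OF that]]]
      by (simp add: o_def linear_Basis_expand[OF linear_frechet_derivative[OF diff(2)[OF that]], symmetric])
    show "times_differentiable_on k S (\<lambda>x. \<Sum>b\<in>Basis. (fderiv f x v \<bullet> b) *\<^sub>R fderiv g (f x) b)" for v
    proof (intro times_differentiable_on_sum times_differentiable_on_bilinear[OF bounded_bilinear_scaleR]
        times_differentiable_on_bilinear[OF bounded_bilinear_inner] times_differentiable_on_const \<open>open S\<close>)
      show "times_differentiable_on k S (\<lambda>x. fderiv f x v)" using Suc.prems by simp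
      show "times_differentiable_on k S (\<lambda>x. fderiv g (f x) b)" for b
        using Suc.prems times_differentiable_on_Suc_imp[OF Suc.prems(1)] by (auto intro: Suc.IH)
    qed
  qed
qed

section \<open>Smooth maps\<close>

lemma smooth_on_cong: "open S \<Longrightarrow> smooth_on S f \<Longrightarrow> (\<And>x. x \<in> S \<Longrightarrow> f x = g x) \<Longrightarrow> smooth_on S g"
  unfolding smooth_on_def by (auto intro: times_differentiable_on_cong)

lemma smooth_on_subset: "smooth_on S f \<Longrightarrow> T \<subseteq> S \<Longrightarrow> smooth_on T f"
  unfolding smooth_on_def by (auto intro: times_differentiable_on_subset)

lemma smooth_on_const [intro!]: "smooth_on S (\<lambda>x. c)"
  unfolding smooth_on_def by (auto intro: times_differentiable_on_const)

lemma smooth_on_linear: "bounded_linear L \<Longrightarrow> smooth_on S L"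
  unfolding smooth_on_def by (auto intro: times_differentiable_on_linear)

lemma smooth_on_id [intro!]: "smooth_on S (\<lambda>x. x)"
  by (rule smooth_on_linear) (rule bounded_linear_ident)

lemma smooth_on_add: "open S \<Longrightarrow> smooth_on S f \<Longrightarrow> smooth_on S g \<Longrightarrow> smooth_on S (\<lambda>x. f x + g x)"
  unfolding smooth_on_def by (auto intro: times_differentiable_on_add)

lemma smooth_on_sum:
  "open S \<Longrightarrow> (\<And>i. i \<in> I \<Longrightarrow> smooth_on S (f i)) \<Longrightarrow> smooth_on S (\<lambda>x. \<Sum>i\<in>I. f i x)"
  unfolding smooth_on_def by (auto intro: times_differentiable_on_sum)

lemma smooth_on_bilinear:
  "bounded_bilinear B \<Longrightarrow> open S \<Longrightarrow> smooth_on S f \<Longrightarrow> smooth_on S g \<Longrightarrow> smooth_on S (\<lambda>x. B (f x) (g x))"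
  unfolding smooth_on_def by (auto intro: times_differentiable_on_bilinear)

lemmas smooth_on_scaleR = smooth_on_bilinear[OF bounded_bilinear_scaleR]
lemmas smooth_on_inner = smooth_on_bilinear[OF bounded_bilinear_inner]
lemmas smooth_on_mult = smooth_on_bilinear[OF bounded_bilinear_mult]

lemma smooth_on_diff:
  assumes "open S" "smooth_on S f" "smooth_on S g" shows "smooth_on S (\<lambda>x. f x - g x)"
  using smooth_on_add[OF assms(1,2) smooth_on_scaleR[OF assms(1) smooth_on_const[of S "-1"] assms(3)]]
  by simp

lemma smooth_on_compose:
  fixes g :: "'b::euclidean_space \<Rightarrow> 'c::real_normed_vector"
  assumes "open S" "open T" "f ` S \<subseteq> T" "smooth_on S f" "smooth_on T g"
  shows "smooth_on S (\<lambda>x. g (f x))"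
  using assms unfolding smooth_on_def by (metis times_differentiable_on_compose)

lemma smooth_on_fst:
  fixes f :: "'a::real_normed_vector \<Rightarrow> 'b::euclidean_space \<times> 'c::euclidean_space"
  shows "open S \<Longrightarrow> smooth_on S f \<Longrightarrow> smooth_on S (\<lambda>x. fst (f x))"
  by (rule smooth_on_compose[OF _ open_UNIV]) (auto intro: smooth_on_linear bounded_linear_fst)

lemma smooth_on_snd:
  fixes f :: "'a::real_normed_vector \<Rightarrow> 'b::euclidean_space \<times> 'c::euclidean_space"
  shows "open S \<Longrightarrow> smooth_on S f \<Longrightarrow> smooth_on S (\<lambda>x. snd (f x))"
  by (rule smooth_on_compose[OF _ open_UNIV]) (auto intro: smooth_on_linear bounded_linear_snd)

lemma smooth_on_Pair:
  fixes f :: "'a::real_normed_vector \<Rightarrow> 'b::euclidean_space" and g :: "'a \<Rightarrow> 'c::euclidean_space"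
  assumes "open S" "smooth_on S f" "smooth_on S g"
  shows "smooth_on S (\<lambda>x. (f x, g x))"
proof -
  have "smooth_on S (\<lambda>x. (f x, 0) + (0::'b, g x))"
  proof (rule smooth_on_add[OF assms(1)])
    show "smooth_on S (\<lambda>x. (f x, 0::'c))"
      by (rule smooth_on_compose[OF assms(1) open_UNIV _ assms(2)])
         (auto intro!: smooth_on_linear bounded_linear_Pair bounded_linear_ident bounded_linear_zero)
    show "smooth_on S (\<lambda>x. (0::'b, g x))"
      by (rule smooth_on_compose[OF assms(1) open_UNIV _ assms(3)])
         (auto intro!: smooth_on_linear bounded_linear_Pair bounded_linear_ident bounded_linear_zero)
  qed
  then show ?thesis by simp
qed

lemma smooth_on_differentiable: "smooth_on S f \<Longrightarrow> x \<in> S \<Longrightarrow> f differentiable at x"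
  unfolding smooth_on_def using times_differentiable_on.simps(2)[of 0 S f] by blast

lemma smooth_on_has_derivative: "smooth_on S f \<Longrightarrow> x \<in> S \<Longrightarrow> (f has_derivative fderiv f x) (at x)"
  using smooth_on_differentiable has_fderiv by blast

lemma smooth_on_linear_fderiv: "smooth_on S f \<Longrightarrow> x \<in> S \<Longrightarrow> linear (fderiv f x)"
  using smooth_on_differentiable linear_frechet_derivative by blast

lemma smooth_on_continuous: "smooth_on S f \<Longrightarrow> continuous_on S f"
  unfolding smooth_on_def using times_differentiable_on.simps(1) by blast

lemma smooth_on_fderiv_const: "smooth_on S f \<Longrightarrow> smooth_on S (\<lambda>x. fderiv f x v)"
  unfolding smooth_on_def using times_differentiable_on.simps(2) by blast

lemma smooth_on_fderiv:
  fixes f :: "'a::euclidean_space \<Rightarrow> 'b::real_normed_vector"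
  assumes "open S" "smooth_on S f" "smooth_on S V"
  shows "smooth_on S (\<lambda>x. fderiv f x (V x))"
proof (rule smooth_on_cong[OF assms(1)])
  show "smooth_on S (\<lambda>x. \<Sum>b\<in>Basis. (V x \<bullet> b) *\<^sub>R fderiv f x b)"
    by (intro smooth_on_sum smooth_on_scaleR smooth_on_inner smooth_on_const smooth_on_fderiv_const assms)
qed (simp add: linear_Basis_expand[OF smooth_on_linear_fderiv[OF assms(2)], symmetric])

text \<open>Induction on the order works because the derivative of \<open>1 / sqrt (f x)\<close> is
  \<open>-1/2\<close> times its own cube times the derivative of \<open>f\<close>, a polynomial in
  the function itself. This supplies the normalization in the Gram-Schmidt process.\<close>

lemma smooth_on_rsqrt:
  fixes f :: "'a::real_normed_vector \<Rightarrow> real"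
  assumes "open S" "smooth_on S f" "\<And>x. x \<in> S \<Longrightarrow> f x > 0"
  shows "smooth_on S (\<lambda>x. 1 / sqrt (f x))"
proof -
  have "times_differentiable_on k S (\<lambda>x. 1 / sqrt (f x))" for k
  proof (induction k)
    case 0
    then show ?case
      using smooth_on_continuous[OF assms(2)] less_imp_neq[OF assms(3)]
      by (auto intro!: continuous_on_divide continuous_on_const continuous_on_real_sqrt)
  next
    case (Suc k)
    show ?case
    proof (rule times_differentiable_onI[OF _ _ assms(1)])
      fix x assume x: "x \<in> S"
      have "f x > 0" using assms(3) x by blast
      have "((\<lambda>x. inverse (sqrt (f x))) has_derivative
          (\<lambda>v. - (inverse (sqrt (f x)) * (fderiv f x v * (inverse (sqrt (f x)) / 2)) * inverse (sqrt (f x))))) (at x)"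
        using \<open>f x > 0\<close>
        by (intro Deriv.has_derivative_inverse has_derivative_real_sqrt smooth_on_has_derivative[OF assms(2) x]) auto
      then show "((\<lambda>x. 1 / sqrt (f x)) has_derivative
          (\<lambda>v. (-1/2) * (((1 / sqrt (f x)) * ((1 / sqrt (f x)) * (1 / sqrt (f x)))) * fderiv f x v))) (at x)"
        unfolding divide_inverse mult_1_left by (rule has_derivative_eq_rhs) (simp add: fun_eq_iff)
    next
      show "times_differentiable_on k S
          (\<lambda>x. (-1/2) * (((1 / sqrt (f x)) * ((1 / sqrt (f x)) * (1 / sqrt (f x)))) * fderiv f x v))" for v
        by (intro times_differentiable_on_bilinear[OF bounded_bilinear_mult] times_differentiable_on_const Suc assms(1))
           (use smooth_on_fderiv_const[OF assms(2), of v] in \<open>simp add: smooth_on_def\<close>)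
    qed
  qed
  then show ?thesis by (simp add: smooth_on_def)
qed

section \<open>Bilinear maps depending on a parameter\<close>

lemma bilinear_Basis_expand:
  fixes B :: "'a::euclidean_space \<Rightarrow> 'b::euclidean_space \<Rightarrow> 'c::real_vector"
  assumes "bilinear B"
  shows "B v w = (\<Sum>a\<in>Basis. \<Sum>b\<in>Basis. ((v \<bullet> a) * (w \<bullet> b)) *\<^sub>R B a b)"
proof -
  have l: "linear (\<lambda>v. B v w)" for w using assms by (simp add: bilinear_def)
  have r: "linear (\<lambda>w. B v w)" for v using assms by (simp add: bilinear_def)
  show ?thesis
    by (subst linear_Basis_expand[OF l], subst linear_Basis_expand[OF r])
       (simp add: scaleR_sum_right)
qed

lemma smooth_on_bilinear_family:
  fixes m :: "'p::real_normed_vector \<Rightarrow> 'a::euclidean_space \<Rightarrow> 'b::euclidean_space \<Rightarrow> 'c::real_normed_vector"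
  assumes "open S" "\<And>x. x \<in> S \<Longrightarrow> bilinear (m x)" "\<And>v w. smooth_on S (\<lambda>x. m x v w)"
    and "smooth_on S V" "smooth_on S W"
  shows "smooth_on S (\<lambda>x. m x (V x) (W x))"
proof (rule smooth_on_cong[OF assms(1)])
  show "smooth_on S (\<lambda>x. \<Sum>a\<in>Basis. \<Sum>b\<in>Basis. ((V x \<bullet> a) * (W x \<bullet> b)) *\<^sub>R m x a b)"
    by (intro smooth_on_sum smooth_on_scaleR smooth_on_mult smooth_on_inner smooth_on_const assms)
qed (simp add: bilinear_Basis_expand[OF assms(2), symmetric])

text \<open>Product rule with three varying factors; the form is differentiated with its arguments
  frozen at \<open>x\<close>. Differentiability of \<open>m\<close> is assumed for fixed arguments
  only, so everything is expanded in bases.\<close>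

lemma has_derivative_bilinear_family:
  fixes m :: "'p::real_normed_vector \<Rightarrow> 'a::euclidean_space \<Rightarrow> 'b::euclidean_space \<Rightarrow> 'c::real_normed_vector"
  assumes "open S" "x \<in> S" and bil: "\<And>y. y \<in> S \<Longrightarrow> bilinear (m y)"
    and m: "\<And>v w. (\<lambda>y. m y v w) differentiable at x"
    and V: "(V has_derivative V') (at x)" and W: "(W has_derivative W') (at x)"
  shows "((\<lambda>y. m y (V y) (W y)) has_derivative
    (\<lambda>u. fderiv (\<lambda>y. m y (V x) (W x)) x u + m x (V' u) (W x) + m x (V x) (W' u))) (at x)"
proof -
  let ?s = "\<lambda>y. \<Sum>a\<in>Basis. \<Sum>b\<in>Basis. ((V y \<bullet> a) * (W y \<bullet> b)) *\<^sub>R m y a b"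
  let ?D = "\<lambda>u. \<Sum>a\<in>Basis. \<Sum>b\<in>Basis. ((V x \<bullet> a) * (W x \<bullet> b)) *\<^sub>R fderiv (\<lambda>y. m y a b) x u +
      (((V' u \<bullet> a) * (W x \<bullet> b)) *\<^sub>R m x a b + ((V x \<bullet> a) * (W' u \<bullet> b)) *\<^sub>R m x a b)"
  have "(?s has_derivative ?D) (at x)"
  proof (intro has_derivative_sum)
    fix a b
    have "((\<lambda>y. (V y \<bullet> a) * (W y \<bullet> b)) has_derivative
        (\<lambda>u. (V x \<bullet> a) * (W' u \<bullet> b) + (V' u \<bullet> a) * (W x \<bullet> b))) (at x)"
      by (intro has_derivative_mult has_derivative_inner_left V W)
    from has_derivative_scaleR[OF this has_fderiv[OF m]]
    show "((\<lambda>y. ((V y \<bullet> a) * (W y \<bullet> b)) *\<^sub>R m y a b) has_derivative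
        (\<lambda>u. ((V x \<bullet> a) * (W x \<bullet> b)) *\<^sub>R fderiv (\<lambda>y. m y a b) x u +
          (((V' u \<bullet> a) * (W x \<bullet> b)) *\<^sub>R m x a b + ((V x \<bullet> a) * (W' u \<bullet> b)) *\<^sub>R m x a b))) (at x)"
      by (rule has_derivative_eq_rhs) (simp add: fun_eq_iff scaleR_add_left add.commute)
  qed
  then have 1: "((\<lambda>y. m y (V y) (W y)) has_derivative ?D) (at x)"
    by (rule has_derivative_transform_within_open[OF _ assms(1,2)]) (simp add: bilinear_Basis_expand[OF bil, symmetric])
  have "((\<lambda>y. \<Sum>a\<in>Basis. \<Sum>b\<in>Basis. ((V x \<bullet> a) * (W x \<bullet> b)) *\<^sub>R m y a b) has_derivative
      (\<lambda>u. \<Sum>a\<in>Basis. \<Sum>b\<in>Basis. ((V x \<bullet> a) * (W x \<bullet> b)) *\<^sub>R fderiv (\<lambda>y. m y a b) x u)) (at x)"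
    by (intro has_derivative_sum has_derivative_scaleR_right has_fderiv m)
  then have "((\<lambda>y. m y (V x) (W x)) has_derivative
      (\<lambda>u. \<Sum>a\<in>Basis. \<Sum>b\<in>Basis. ((V x \<bullet> a) * (W x \<bullet> b)) *\<^sub>R fderiv (\<lambda>y. m y a b) x u)) (at x)"
    by (rule has_derivative_transform_within_open[OF _ assms(1,2)]) (simp add: bilinear_Basis_expand[OF bil, symmetric])
  then have 2: "fderiv (\<lambda>y. m y (V x) (W x)) x =
      (\<lambda>u. \<Sum>a\<in>Basis. \<Sum>b\<in>Basis. ((V x \<bullet> a) * (W x \<bullet> b)) *\<^sub>R fderiv (\<lambda>y. m y a b) x u)"
    by (rule fderiv_eq)
  have 3: "m x (V' u) (W x) = (\<Sum>a\<in>Basis. \<Sum>b\<in>Basis. ((V' u \<bullet> a) * (W x \<bullet> b)) *\<^sub>R m x a b)"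
      "m x (V x) (W' u) = (\<Sum>a\<in>Basis. \<Sum>b\<in>Basis. ((V x \<bullet> a) * (W' u \<bullet> b)) *\<^sub>R m x a b)" for u
    by (rule bilinear_Basis_expand[OF bil[OF \<open>x \<in> S\<close>]])+
  show ?thesis
    by (rule has_derivative_eq_rhs[OF 1]) (simp only: 2 3 sum.distrib add.assoc)
qed

section \<open>Inner products, frames and the Levi-Civita connection\<close>

definition inner_form :: "('e::real_vector \<Rightarrow> 'e \<Rightarrow> real) \<Rightarrow> bool" where
  "inner_form m \<longleftrightarrow> bilinear m \<and> (\<forall>v w. m v w = m w v) \<and> (\<forall>v. v \<noteq> 0 \<longrightarrow> 0 < m v v)"

lemma inner_formD:
  assumes "inner_form m"
  shows "bilinear m" "m v w = m w v" "v \<noteq> 0 \<Longrightarrow> 0 < m v v"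
  using assms by (auto simp: inner_form_def)

lemma inner_form_linear:
  assumes "inner_form m" shows "linear (m v)" "linear (\<lambda>v. m v w)"
  using assms by (auto simp: inner_form_def bilinear_def)

lemma inner_form_eqI:
  assumes "inner_form m" "\<And>w. m v w = m v' w" shows "v = v'"
proof (rule ccontr)
  assume "v \<noteq> v'"
  then have "0 < m (v - v') (v - v')" using assms(1) by (simp add: inner_form_def)
  also have "m (v - v') (v - v') = m v (v - v') - m v' (v - v')"
    using linear_diff[OF inner_form_linear(2)[OF assms(1)]] .
  finally show False using assms(2) by simp
qed

lemma orthonormal_family_coeff:
  fixes e :: "'b::euclidean_space \<Rightarrow> 'e::euclidean_space"
  assumes "inner_form m" "orthonormal_family m e" "a \<in> Basis"
  shows "m (\<Sum>b\<in>Basis. c b *\<^sub>R e b) (e a) = c a"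
proof -
  have "m (\<Sum>b\<in>Basis. c b *\<^sub>R e b) (e a) = (\<Sum>b\<in>Basis. c b * m (e b) (e a))"
    by (simp add: linear_sum[OF inner_form_linear(2)[OF assms(1)]] linear_cmul[OF inner_form_linear(2)[OF assms(1)]])
  also have "\<dots> = (\<Sum>b\<in>Basis. if b = a then c b else 0)"
    using assms(2,3) by (intro sum.cong) (auto simp: orthonormal_family_def)
  finally show ?thesis using assms(3) by simp
qed

text \<open>The family is indexed by \<open>Basis\<close>, so it has as many members as the
  dimension. The synthesis map \<open>T\<close> is injective because pairing with the
  \<open>e a\<close> recovers coordinates, hence it is onto.\<close>

lemma orthonormal_family_expand:
  fixes e :: "'e::euclidean_space \<Rightarrow> 'e"
  assumes "inner_form m" "orthonormal_family m e"
  shows "(\<Sum>a\<in>Basis. m v (e a) *\<^sub>R e a) = v"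
proof -
  define T where "T x = (\<Sum>a\<in>Basis. (x \<bullet> a) *\<^sub>R e a)" for x
  have lin: "linear T"
    by (auto intro!: linearI simp: T_def inner_add_left scaleR_add_left sum.distrib scaleR_sum_right)
  have coeff: "m (T x) (e a) = x \<bullet> a" if "a \<in> Basis" for x a
    unfolding T_def by (rule orthonormal_family_coeff[OF assms that])
  have "inj T" by (rule injI) (metis coeff euclidean_eqI)
  then obtain x where x: "T x = v"
    using linear_injective_imp_surjective[OF lin] by (metis surjD)
  have "(\<Sum>a\<in>Basis. m v (e a) *\<^sub>R e a) = (\<Sum>a\<in>Basis. (x \<bullet> a) *\<^sub>R e a)"
    by (intro sum.cong) (auto simp: coeff x[symmetric])
  then show ?thesis using x T_def by simp
qed

text \<open>Riesz representation in an orthonormal basis; it turns the Koszul expression into a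
  vector.\<close>

lemma inner_form_representation:
  fixes e :: "'e::euclidean_space \<Rightarrow> 'e" and L :: "'e \<Rightarrow> real"
  assumes "inner_form m" "orthonormal_family m e" "linear L"
  shows "m (\<Sum>a\<in>Basis. L (e a) *\<^sub>R e a) w = L w"
proof -
  have "m (\<Sum>a\<in>Basis. L (e a) *\<^sub>R e a) w = (\<Sum>a\<in>Basis. L (e a) * m w (e a))"
    using inner_formD(2)[OF assms(1), of w]
    by (simp add: linear_sum[OF inner_form_linear(2)[OF assms(1)]] linear_cmul[OF inner_form_linear(2)[OF assms(1)]])
  also have "\<dots> = L (\<Sum>a\<in>Basis. m w (e a) *\<^sub>R e a)"
    using assms(3) by (simp add: linear_sum linear_cmul mult.commute)
  finally show ?thesis using orthonormal_family_expand[OF assms(1,2)] by simp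
qed

text \<open>One basis vector is added at a time. The claim about spans serves the induction: a new
  basis vector lies outside the span of the old ones, so subtracting its projection never gives zero
  and normalizing stays smooth.\<close>

lemma gram_schmidt:
  fixes m :: "'p::real_normed_vector \<Rightarrow> 'e::euclidean_space \<Rightarrow> 'e \<Rightarrow> real"
  assumes "open S" and m: "\<And>x. x \<in> S \<Longrightarrow> inner_form (m x)" "\<And>v w. smooth_on S (\<lambda>x. m x v w)"
    and "finite B" "B \<subseteq> Basis"
  shows "\<exists>e. (\<forall>b\<in>B. smooth_on S (e b)) \<and>
    (\<forall>x\<in>S. (\<forall>a\<in>B. \<forall>b\<in>B. m x (e a x) (e b x) = (if a = b then 1 else 0)) \<and> (\<forall>b\<in>B. e b x \<in> span B))"
  using assms(4,5)
proof (induction B)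
  case empty
  then show ?case by simp
next
  case (insert c B)
  have "B \<subseteq> Basis" using insert.prems by simp
  from insert.IH[OF this] obtain e where "(\<forall>b\<in>B. smooth_on S (e b)) \<and> (\<forall>x\<in>S.
      (\<forall>a\<in>B. \<forall>b\<in>B. m x (e a x) (e b x) = (if a = b then 1 else 0)) \<and> (\<forall>b\<in>B. e b x \<in> span B))"
    by (rule exE)
  then have sm: "\<And>b. b \<in> B \<Longrightarrow> smooth_on S (e b)"
    and on: "\<And>x a b. x \<in> S \<Longrightarrow> a \<in> B \<Longrightarrow> b \<in> B \<Longrightarrow> m x (e a x) (e b x) = (if a = b then 1 else 0)"
    and sp: "\<And>x b. x \<in> S \<Longrightarrow> b \<in> B \<Longrightarrow> e b x \<in> span B"
    by blast+
  have bil: "bilinear (m x)" if "x \<in> S" for x using m(1)[OF that] by (simp add: inner_form_def)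
  define w where "w x = c - (\<Sum>b\<in>B. m x c (e b x) *\<^sub>R e b x)" for x
  have w_sm: "smooth_on S w"
    unfolding w_def
    by (intro smooth_on_diff smooth_on_sum smooth_on_scaleR smooth_on_const assms(1)
        smooth_on_bilinear_family[of _ m, OF assms(1) bil m(2)] sm)
  have "c \<notin> span B"
    using insert.hyps insert.prems independent_mono[OF independent_Basis insert.prems]
    by (simp add: independent_insert)
  moreover have "(\<Sum>b\<in>B. m x c (e b x) *\<^sub>R e b x) \<in> span B" if "x \<in> S" for x
    using sp[OF that] by (intro span_sum span_scale)
  ultimately have "w x \<noteq> 0" if "x \<in> S" for x
    using that unfolding w_def by (metis eq_iff_diff_eq_0)
  then have nz: "0 < m x (w x) (w x)" if "x \<in> S" for x
    using inner_formD(3)[OF m(1)[OF that], of "w x"] that by blast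
  have orth: "m x (w x) (e a x) = 0" if "x \<in> S" "a \<in> B" for x a
  proof -
    have "m x (w x) (e a x) = m x c (e a x) - (\<Sum>b\<in>B. m x c (e b x) * m x (e b x) (e a x))"
      by (simp add: w_def linear_diff[OF inner_form_linear(2)[OF m(1)[OF that(1)]]]
          linear_sum[OF inner_form_linear(2)[OF m(1)[OF that(1)]]]
          linear_cmul[OF inner_form_linear(2)[OF m(1)[OF that(1)]]])
    also have "(\<Sum>b\<in>B. m x c (e b x) * m x (e b x) (e a x)) = (\<Sum>b\<in>B. if b = a then m x c (e b x) else 0)"
      using on that by (intro sum.cong) auto
    finally show ?thesis using that(2) insert.hyps(1) by simp
  qed
  define e' where "e' = e(c := \<lambda>x. (1 / sqrt (m x (w x) (w x))) *\<^sub>R w x)"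
  have smul: "m x (r *\<^sub>R v) u = r * m x v u" "m x u (r *\<^sub>R v) = r * m x u v" if "x \<in> S" for x r u v
    using bilinear_lmul[OF bil[OF that]] bilinear_rmul[OF bil[OF that]] by auto
  have "smooth_on S (e' b)" if "b \<in> insert c B" for b
  proof (cases "b = c")
    case True
    have "smooth_on S (\<lambda>x. m x (w x) (w x))"
      by (rule smooth_on_bilinear_family[of _ m, OF assms(1) bil m(2) w_sm w_sm])
    then show ?thesis
      unfolding e'_def True using nz by (auto intro!: smooth_on_scaleR smooth_on_rsqrt assms(1) w_sm)
  qed (use that sm in \<open>auto simp: e'_def\<close>)
  moreover have "m x (e' a x) (e' b x) = (if a = b then 1 else 0)"
    if "x \<in> S" "a \<in> insert c B" "b \<in> insert c B" for x a b
  proof -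
    have "m x (e d x) (w x) = 0" if "d \<in> B" for d
      using orth[OF \<open>x \<in> S\<close> that] inner_formD(2)[OF m(1)[OF \<open>x \<in> S\<close>], of "e d x"] by simp
    then have cross: "m x (e' d x) (e' c x) = 0" "m x (e' c x) (e' d x) = 0" "d \<noteq> c" "c \<noteq> d" if "d \<in> B" for d
      using that insert.hyps(2) orth[OF \<open>x \<in> S\<close> that] smul[OF \<open>x \<in> S\<close>] by (auto simp: e'_def)
    have old: "m x (e' d x) (e' d' x) = (if d = d' then 1 else 0)" if "d \<in> B" "d' \<in> B" for d d'
      using on[OF \<open>x \<in> S\<close> that] that insert.hyps(2) by (auto simp: e'_def)
    have "m x (e' c x) (e' c x) = m x (w x) (w x) / (sqrt (m x (w x) (w x)) * sqrt (m x (w x) (w x)))"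
      using smul[OF \<open>x \<in> S\<close>] by (simp add: e'_def)
    then have "m x (e' c x) (e' c x) = 1"
      using nz[OF \<open>x \<in> S\<close>] by simp
    then show ?thesis
      using that(2,3) cross old by (elim insertE) simp_all
  qed
  moreover have "e' b x \<in> span (insert c B)" if "x \<in> S" "b \<in> insert c B" for x b
  proof -
    have "e d x \<in> span (insert c B)" if "d \<in> B" for d
      using sp[OF \<open>x \<in> S\<close> that] span_mono[of B "insert c B"] by blast
    then have "w x \<in> span (insert c B)"
      unfolding w_def by (intro span_diff span_sum span_scale) (auto intro: span_base)
    then show ?thesis
      using sp[OF \<open>x \<in> S\<close>] that span_mono[of B "insert c B"] by (auto simp: e'_def intro: span_scale)
  qed
  ultimately show ?case by (intro exI[of _ e']) simp
qed

lemma smooth_orthonormal_frame: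
  fixes m :: "'p::real_normed_vector \<Rightarrow> 'e::euclidean_space \<Rightarrow> 'e \<Rightarrow> real"
  assumes "open S" "\<And>x. x \<in> S \<Longrightarrow> inner_form (m x)" "\<And>v w. smooth_on S (\<lambda>x. m x v w)"
  obtains e :: "'e \<Rightarrow> 'p \<Rightarrow> 'e" where "\<And>b. b \<in> Basis \<Longrightarrow> smooth_on S (e b)"
    "\<And>x. x \<in> S \<Longrightarrow> orthonormal_family (m x) (\<lambda>b. e b x)"
proof -
  obtain e :: "'e \<Rightarrow> 'p \<Rightarrow> 'e" where e: "(\<forall>b\<in>Basis. smooth_on S (e b)) \<and> (\<forall>x\<in>S.
      (\<forall>a\<in>Basis. \<forall>b\<in>Basis. m x (e a x) (e b x) = (if a = b then 1 else 0)) \<and> (\<forall>b\<in>Basis. e b x \<in> span Basis))"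
    using gram_schmidt[of S m Basis, OF assms finite_Basis subset_refl] by blast
  show thesis by (rule that[of e]) (use e in \<open>simp_all add: orthonormal_family_def\<close>)
qed

lemma orthonormal_family_exists:
  fixes m :: "'e::euclidean_space \<Rightarrow> 'e \<Rightarrow> real"
  assumes "inner_form m"
  obtains e :: "'e \<Rightarrow> 'e" where "orthonormal_family m e"
  by (rule smooth_orthonormal_frame[of "UNIV :: real set" "\<lambda>_. m"]) (use assms in auto)

text \<open>The coefficients relating two orthonormal families satisfy orthogonality relations,
  which collapse the triple sum. Hence the definite description in \<open>metric_trace\<close>
  denotes the usual trace.\<close>

lemma metric_trace_eq:
  fixes m :: "'e::euclidean_space \<Rightarrow> 'e \<Rightarrow> real" and e :: "'e \<Rightarrow> 'e" and B :: "'e \<Rightarrow> 'e \<Rightarrow> 'c::euclidean_space"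
  assumes "inner_form m" "bilinear B" "orthonormal_family m e"
  shows "metric_trace m B = (\<Sum>a\<in>Basis. B (e a) (e a))"
  unfolding metric_trace_def
proof (rule the_equality)
  have "(\<Sum>a\<in>Basis. B (e a) (e a)) = (\<Sum>a\<in>Basis. B (e' a) (e' a))" if e': "orthonormal_family m e'" for e' :: "'e \<Rightarrow> 'e"
  proof -
    have l: "linear (\<lambda>v. B v w)" and r: "linear (B w)" for w using assms(2) by (auto simp: bilinear_def)
    have "(\<Sum>a\<in>Basis. B (e' a) (e' a)) =
        (\<Sum>a\<in>Basis. B (\<Sum>b\<in>Basis. m (e' a) (e b) *\<^sub>R e b) (\<Sum>c\<in>Basis. m (e' a) (e c) *\<^sub>R e c))"
      by (simp only: orthonormal_family_expand[OF assms(1,3)])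
    also have "\<dots> = (\<Sum>a\<in>Basis. \<Sum>c\<in>Basis. \<Sum>b\<in>Basis. (m (e' a) (e c) * m (e' a) (e b)) *\<^sub>R B (e b) (e c))"
      by (simp add: linear_sum[OF l] linear_sum[OF r] linear_cmul[OF l] linear_cmul[OF r] scaleR_sum_right)
    also have "\<dots> = (\<Sum>c\<in>Basis. \<Sum>b\<in>Basis. \<Sum>a\<in>Basis. (m (e' a) (e c) * m (e' a) (e b)) *\<^sub>R B (e b) (e c))"
      by (subst sum.swap, rule sum.cong[OF refl], rule sum.swap)
    also have "\<dots> = (\<Sum>c\<in>Basis. \<Sum>b\<in>Basis. m (e c) (e b) *\<^sub>R B (e b) (e c))"
    proof (intro sum.cong refl)
      fix c b
      have "(\<Sum>a\<in>Basis. m (e' a) (e c) * m (e' a) (e b)) = (\<Sum>a\<in>Basis. m (e c) (e' a) * m (e' a) (e b))"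
        using inner_formD(2)[OF assms(1)] by (intro sum.cong refl) metis
      also have "\<dots> = m (\<Sum>a\<in>Basis. m (e c) (e' a) *\<^sub>R e' a) (e b)"
        by (simp add: linear_sum[OF inner_form_linear(2)[OF assms(1)]] linear_cmul[OF inner_form_linear(2)[OF assms(1)]])
      finally have "(\<Sum>a\<in>Basis. m (e' a) (e c) * m (e' a) (e b)) = m (e c) (e b)"
        by (simp only: orthonormal_family_expand[OF assms(1) e'])
      then show "(\<Sum>a\<in>Basis. (m (e' a) (e c) * m (e' a) (e b)) *\<^sub>R B (e b) (e c)) = m (e c) (e b) *\<^sub>R B (e b) (e c)"
        by (simp add: scaleR_sum_left[symmetric])
    qed
    also have "\<dots> = (\<Sum>c\<in>Basis. \<Sum>b\<in>Basis. if c = b then B (e b) (e c) else 0)"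
      using assms(3) by (intro sum.cong) (auto simp: orthonormal_family_def)
    finally show ?thesis by simp
  qed
  then show "\<forall>e' :: 'e \<Rightarrow> 'e. orthonormal_family m e' \<longrightarrow> (\<Sum>a\<in>Basis. B (e a) (e a)) = (\<Sum>a\<in>Basis. B (e' a) (e' a))"
    by blast
qed (use assms(3) in blast)

section \<open>The Levi-Civita connection from the Koszul formula\<close>

definition differentiable_metric_on :: "'e::euclidean_space set \<Rightarrow> 'e metric \<Rightarrow> bool" where
  "differentiable_metric_on S g \<longleftrightarrow> open S \<and>
     (\<forall>x\<in>S. inner_form (g x) \<and> (\<forall>v w. (\<lambda>y. g y v w) differentiable at x))"

lemma riemannian_metric_inner_form: "riemannian_metric_on U g \<Longrightarrow> x \<in> U \<Longrightarrow> inner_form (g x)"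
  by (simp add: riemannian_metric_on_def inner_form_def)

lemma riemannian_metric_bilinear: "riemannian_metric_on U g \<Longrightarrow> x \<in> U \<Longrightarrow> bilinear (g x)"
  by (simp add: riemannian_metric_on_def)

lemma riemannian_metric_smooth: "riemannian_metric_on U g \<Longrightarrow> smooth_on U (\<lambda>x. g x v w)"
  by (simp add: riemannian_metric_on_def)

lemma riemannian_metric_on_subset:
  "riemannian_metric_on U g \<Longrightarrow> V \<subseteq> U \<Longrightarrow> riemannian_metric_on V g"
  unfolding riemannian_metric_on_def using smooth_on_subset by (metis subsetD)

lemma riemannian_imp_differentiable_metric:
  assumes "open U" "riemannian_metric_on U g" shows "differentiable_metric_on U g"
  unfolding differentiable_metric_on_def
  using assms(1) riemannian_metric_inner_form[OF assms(2)]
    smooth_on_differentiable[OF riemannian_metric_smooth[OF assms(2)]] by blast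

text \<open>The Koszul formula for constant fields, whose brackets vanish: the value that
  \<open>g x\<close> must take on the covariant derivative of \<open>v\<close> along
  \<open>u\<close>, paired with \<open>w\<close>.\<close>

definition koszul :: "'e::euclidean_space metric \<Rightarrow> 'e \<Rightarrow> 'e \<Rightarrow> 'e \<Rightarrow> 'e \<Rightarrow> real" where
  "koszul g x u v w = (fderiv (\<lambda>y. g y v w) x u + fderiv (\<lambda>y. g y u w) x v - fderiv (\<lambda>y. g y u v) x w) / 2"

context
  fixes S :: "'e::euclidean_space set" and g :: "'e metric" and x :: 'e
  assumes metric: "differentiable_metric_on S g" and x: "x \<in> S"
begin

lemma metric_at: "open S" "inner_form (g x)" "(\<lambda>y. g y v w) differentiable at x"
  using metric x by (auto simp: differentiable_metric_on_def)

lemma metric_derivative_linear: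
  "linear (fderiv (\<lambda>y. g y v w) x)"
  "linear (\<lambda>v. fderiv (\<lambda>y. g y v w) x u)"
  "linear (\<lambda>w. fderiv (\<lambda>y. g y v w) x u)"
  "fderiv (\<lambda>y. g y v w) x u = fderiv (\<lambda>y. g y w v) x u"
proof -
  have inner: "inner_form (g y)" if "y \<in> S" for y
    using metric that by (simp add: differentiable_metric_on_def)
  note lin = linear_add[OF inner_form_linear(1)[OF inner]] linear_cmul[OF inner_form_linear(1)[OF inner]]
    linear_add[OF inner_form_linear(2)[OF inner]] linear_cmul[OF inner_form_linear(2)[OF inner]]
  show "linear (fderiv (\<lambda>y. g y v w) x)" by (rule linear_frechet_derivative[OF metric_at(3)])
  have add: "fderiv F x u = fderiv G x u + fderiv H x u"
    if "\<And>y. y \<in> S \<Longrightarrow> G y + H y = F y" "G differentiable at x" "H differentiable at x"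
    for F G H :: "'e \<Rightarrow> real"
  proof -
    have "(F has_derivative (\<lambda>u. fderiv G x u + fderiv H x u)) (at x)"
      by (rule has_derivative_transform_within_open[OF has_derivative_add[OF has_fderiv has_fderiv] metric_at(1) x])
         (use that in auto)
    then show ?thesis using fderiv_eq by metis
  qed
  have cmul: "fderiv F x u = r * fderiv G x u"
    if "\<And>y. y \<in> S \<Longrightarrow> r * G y = F y" "G differentiable at x" for F G :: "'e \<Rightarrow> real" and r
  proof -
    have "(F has_derivative (\<lambda>u. r * fderiv G x u)) (at x)"
      by (rule has_derivative_transform_within_open[OF has_derivative_mult_right[OF has_fderiv] metric_at(1) x])
         (use that in auto)
    then show ?thesis using fderiv_eq by metis
  qed
  show "linear (\<lambda>v. fderiv (\<lambda>y. g y v w) x u)"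
    by (intro linearI) (auto intro!: add cmul metric_at(3) simp: lin)
  show "linear (\<lambda>w. fderiv (\<lambda>y. g y v w) x u)"
    by (intro linearI) (auto intro!: add cmul metric_at(3) simp: lin)
  show "fderiv (\<lambda>y. g y v w) x u = fderiv (\<lambda>y. g y w v) x u"
    using fderiv_cong(1)[OF metric_at(1) x _ metric_at(3), of v w "\<lambda>y. g y w v"] inner_formD(2)[OF inner]
    by metis
qed

lemma koszul_linear:
  "linear (\<lambda>u. koszul g x u v w)" "linear (\<lambda>v. koszul g x u v w)" "linear (koszul g x u v)"
  unfolding koszul_def
  by (intro linearI;
      simp add: linear_add[OF metric_derivative_linear(1)] linear_add[OF metric_derivative_linear(2)]
        linear_add[OF metric_derivative_linear(3)] linear_cmul[OF metric_derivative_linear(1)]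
        linear_cmul[OF metric_derivative_linear(2)] linear_cmul[OF metric_derivative_linear(3)] field_simps)+

text \<open>Uniqueness half of the fundamental theorem: in the signed sum of the three compatibility
  equations, symmetry of \<open>C\<close> cancels all terms but one.\<close>

lemma metric_connection_koszul:
  assumes "\<And>v w. C v w = C w v"
    and "\<And>u v w. fderiv (\<lambda>y. g y v w) x u = g x (C u v) w + g x v (C u w)"
  shows "g x (C u v) w = koszul g x u v w"
  unfolding koszul_def assms(2) using assms(1)[of v u] assms(1)[of w u] assms(1)[of w v]
    inner_formD(2)[OF metric_at(2)] by (simp add: field_simps)

text \<open>Nondegeneracy of the metric turns equal Koszul values into equal maps. Later this
  recognizes a transported connection as the Levi-Civita connection.\<close>

lemma christoffel_eqI:
  assumes "bilinear C" "\<And>v w. C v w = C w v"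
    and "\<And>u v w. fderiv (\<lambda>y. g y v w) x u = g x (C u v) w + g x v (C u w)"
  shows "christoffel g x = C"
  unfolding christoffel_def
proof (rule the_equality)
  fix C' assume C': "bilinear C' \<and> (\<forall>v w. C' v w = C' w v) \<and>
     (\<forall>u v w. fderiv (\<lambda>y. g y v w) x u = g x (C' u v) w + g x v (C' u w))"
  have "C' u v = C u v" for u v
  proof (rule inner_form_eqI[OF metric_at(2)])
    show "g x (C' u v) w = g x (C u v) w" for w
      using metric_connection_koszul[of C] metric_connection_koszul[of C'] assms(2,3) C' by metis
  qed
  then show "C' = C" by blast
qed (use assms in blast)

text \<open>Existence half: the vector dual to the Koszul functional, written in an orthonormal
  family. The explicit sum also gives smooth dependence on the point.\<close>

lemma christoffel_of_frame:
  fixes e :: "'e \<Rightarrow> 'e"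
  assumes e: "orthonormal_family (g x) e"
  shows "christoffel g x u v = (\<Sum>a\<in>Basis. koszul g x u v (e a) *\<^sub>R e a)"
    and "bilinear (christoffel g x)"
    and "christoffel g x v w = christoffel g x w v"
    and "fderiv (\<lambda>y. g y v w) x u = g x (christoffel g x u v) w + g x v (christoffel g x u w)"
proof -
  define C where "C u v = (\<Sum>a\<in>Basis. koszul g x u v (e a) *\<^sub>R e a)" for u v
  have gC: "g x (C u v) w = koszul g x u v w" for u v w
    unfolding C_def by (rule inner_form_representation[OF metric_at(2) e koszul_linear(3)])
  have bil: "bilinear C"
    unfolding bilinear_def C_def
    by (auto intro!: linearI simp: linear_add[OF koszul_linear(1)] linear_add[OF koszul_linear(2)]
        linear_cmul[OF koszul_linear(1)] linear_cmul[OF koszul_linear(2)]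
        scaleR_add_left sum.distrib scaleR_sum_right)
  have sym: "C v w = C w v" for v w
    unfolding C_def koszul_def using metric_derivative_linear(4)[of v w] by (simp add: add.commute)
  have compat: "fderiv (\<lambda>y. g y v w) x u = g x (C u v) w + g x v (C u w)" for u v w
    using inner_formD(2)[OF metric_at(2), of v "C u w"] metric_derivative_linear(4)[of v w u]
    by (simp add: gC koszul_def field_simps)
  have "christoffel g x = C" using christoffel_eqI[OF bil sym compat] .
  then show "christoffel g x u v = (\<Sum>a\<in>Basis. koszul g x u v (e a) *\<^sub>R e a)"
    and "bilinear (christoffel g x)" and "christoffel g x v w = christoffel g x w v"
    and "fderiv (\<lambda>y. g y v w) x u = g x (christoffel g x u v) w + g x v (christoffel g x u w)"
    using bil sym compat by (auto simp: C_def)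
qed

lemma christoffel_bilinear: "bilinear (christoffel g x)"
  and christoffel_sym: "christoffel g x v w = christoffel g x w v"
  and christoffel_metric:
    "fderiv (\<lambda>y. g y v w) x u = g x (christoffel g x u v) w + g x v (christoffel g x u w)"
  using orthonormal_family_exists[OF metric_at(2)] christoffel_of_frame(2-4) by metis+

text \<open>Compatibility is built into \<open>christoffel\<close> for constant fields only; the
  product rule extends it to varying ones, with \<open>V' u + christoffel g x u (V x)\<close> as
  covariant derivative.\<close>

lemma metric_product_rule:
  assumes V: "(V has_derivative V') (at x)" and W: "(W has_derivative W') (at x)"
  shows "((\<lambda>y. g y (V y) (W y)) has_derivative
    (\<lambda>u. g x (V' u + christoffel g x u (V x)) (W x) + g x (V x) (W' u + christoffel g x u (W x)))) (at x)"
proof -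
  have "bilinear (g y)" if "y \<in> S" for y
    using metric that by (simp add: differentiable_metric_on_def inner_form_def)
  then show ?thesis
    by (rule has_derivative_eq_rhs[OF has_derivative_bilinear_family[where m = g, OF metric_at(1) x _ metric_at(3) V W]])
       (assumption, rule ext, simp add: christoffel_metric bilinear_ladd[OF inner_formD(1)[OF metric_at(2)]]
         bilinear_radd[OF inner_formD(1)[OF metric_at(2)]])
qed

lemma christoffel_cong:
  assumes "\<And>y. y \<in> S \<Longrightarrow> g y = g' y"
  shows "christoffel g x = christoffel g' x"
proof -
  have "fderiv (\<lambda>y. g y v w) x = fderiv (\<lambda>y. g' y v w) x" for v w
    by (rule fderiv_cong(1)[OF metric_at(1) x _ metric_at(3)]) (simp add: assms)
  then show ?thesis by (simp add: christoffel_def assms[OF x])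
qed

end

lemma christoffel_smooth:
  fixes U :: "'e::euclidean_space set"
  assumes "open U" "riemannian_metric_on U g" "smooth_on U V" "smooth_on U W"
  shows "smooth_on U (\<lambda>x. christoffel g x (V x) (W x))"
proof -
  note metric = riemannian_imp_differentiable_metric[OF assms(1,2)]
  have const: "smooth_on U (\<lambda>x. christoffel g x v w)" for v w
  proof -
    obtain e :: "'e \<Rightarrow> 'e \<Rightarrow> 'e" where e: "\<And>b. b \<in> Basis \<Longrightarrow> smooth_on U (e b)"
      and on: "\<And>x. x \<in> U \<Longrightarrow> orthonormal_family (g x) (\<lambda>b. e b x)"
      by (rule smooth_orthonormal_frame[of U g, OF assms(1) riemannian_metric_inner_form[OF assms(2)]
            riemannian_metric_smooth[OF assms(2)]]) (assumption, rule that)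
    \<comment> \<open>\<open>koszul\<close> differentiates the metric with constant arguments, so
      its frame argument is first expanded in the standard basis.\<close>
    have "smooth_on U (\<lambda>x. \<Sum>a\<in>Basis. (\<Sum>b\<in>Basis. (e a x \<bullet> b) *\<^sub>R koszul g x v w b) *\<^sub>R e a x)"
      unfolding koszul_def divide_inverse
      by (intro smooth_on_sum smooth_on_scaleR smooth_on_inner smooth_on_mult smooth_on_add smooth_on_diff
          smooth_on_fderiv_const smooth_on_const e assms(1) riemannian_metric_smooth[OF assms(2)])
    then show ?thesis
    proof (rule smooth_on_cong[OF assms(1)])
      fix x assume x: "x \<in> U"
      show "(\<Sum>a\<in>Basis. (\<Sum>b\<in>Basis. (e a x \<bullet> b) *\<^sub>R koszul g x v w b) *\<^sub>R e a x) = christoffel g x v w"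
        unfolding christoffel_of_frame(1)[OF metric x on[OF x]]
        by (simp only: linear_Basis_expand[OF koszul_linear(3)[OF metric x], symmetric])
    qed
  qed
  show ?thesis
    by (rule smooth_on_bilinear_family[where m = "christoffel g", OF assms(1) christoffel_bilinear[OF metric] const assms(3,4)])
qed

lemma christoffel_smooth_compose:
  fixes U :: "'e::euclidean_space set" and k :: "'p::real_normed_vector \<Rightarrow> 'e"
  assumes "open S" "open U" "riemannian_metric_on U g" "k ` S \<subseteq> U" "smooth_on S k" "smooth_on S V" "smooth_on S W"
  shows "smooth_on S (\<lambda>x. christoffel g (k x) (V x) (W x))"
proof (rule smooth_on_bilinear_family[where m = "\<lambda>x. christoffel g (k x)", OF assms(1) _ _ assms(6,7)])
  show "bilinear (christoffel g (k x))" if "x \<in> S" for x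
    using assms(4) that by (intro christoffel_bilinear[OF riemannian_imp_differentiable_metric[OF assms(2,3)]]) blast
  show "smooth_on S (\<lambda>x. christoffel g (k x) v w)" for v w
    by (rule smooth_on_compose[OF assms(1,2,4,5) christoffel_smooth[OF assms(2,3)]]) auto
qed

section \<open>The tension field and isometries\<close>

lemma has_real_derivative_along_line:
  fixes f :: "'a::real_normed_vector \<Rightarrow> real"
  assumes "(f has_derivative f') (at (p + s *\<^sub>R v))"
  shows "((\<lambda>s. f (p + s *\<^sub>R v)) has_real_derivative f' v) (at s)"
proof -
  have "((\<lambda>s. p + s *\<^sub>R v) has_derivative (\<lambda>h. h *\<^sub>R v)) (at s)"
    by (auto intro!: derivative_eq_intros)
  from has_derivative_compose[OF this assms]
  have "((\<lambda>s. f (p + s *\<^sub>R v)) has_derivative (\<lambda>h. f' (h *\<^sub>R v))) (at s)" .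
  moreover have "f' (h *\<^sub>R v) = f' v * h" for h
    using linear_cmul[OF has_derivative_linear[OF assms]] by simp
  ultimately show ?thesis by (simp add: has_field_derivative_def)
qed

text \<open>The mean value theorem is applied in direction \<open>v\<close> to the difference of two
  translates of \<open>f\<close>, then in direction \<open>w\<close> to the resulting derivative.
  The norm bound keeps the parallelogram inside the ball.\<close>

lemma second_difference_mean_value:
  fixes f :: "'a::real_normed_vector \<Rightarrow> real"
  assumes f: "smooth_on S f" and ball: "ball x r \<subseteq> S" and t: "0 < t" "t * (norm v + norm w) < r"
  obtains \<xi> \<eta> where "0 < \<xi>" "\<xi> < t" "0 < \<eta>" "\<eta> < t"
    "f (x + t *\<^sub>R v + t *\<^sub>R w) - f (x + t *\<^sub>R v) - f (x + t *\<^sub>R w) + f x =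
      t * t * fderiv (\<lambda>y. fderiv f y v) (x + \<xi> *\<^sub>R v + \<eta> *\<^sub>R w) w"
proof -
  have mem: "x + s *\<^sub>R v + u *\<^sub>R w \<in> S" if "0 \<le> s" "s \<le> t" "0 \<le> u" "u \<le> t" for s u
  proof -
    have "norm (s *\<^sub>R v + u *\<^sub>R w) \<le> s * norm v + u * norm w"
      using norm_triangle_ineq[of "s *\<^sub>R v" "u *\<^sub>R w"] that by simp
    also have "\<dots> \<le> t * norm v + t * norm w"
      using that by (intro add_mono mult_right_mono) auto
    finally have "norm (s *\<^sub>R v + u *\<^sub>R w) < r" using t(2) by (simp add: distrib_left)
    moreover have "dist x (x + s *\<^sub>R v + u *\<^sub>R w) = norm (s *\<^sub>R v + u *\<^sub>R w)"
      by (simp add: dist_norm norm_minus_commute add_ac)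
    ultimately show ?thesis using ball by auto
  qed
  have 1: "((\<lambda>s. f ((x + t *\<^sub>R w) + s *\<^sub>R v) - f (x + s *\<^sub>R v)) has_real_derivative
      fderiv f ((x + t *\<^sub>R w) + s *\<^sub>R v) v - fderiv f (x + s *\<^sub>R v) v) (at s)" if "0 \<le> s" "s \<le> t" for s
    using mem[of s t] mem[of s 0] that t(1)
    by (intro DERIV_diff has_real_derivative_along_line smooth_on_has_derivative[OF f])
       (auto simp: add_ac)
  obtain \<xi> where \<xi>: "0 < \<xi>" "\<xi> < t" and e1:
    "(f ((x + t *\<^sub>R w) + t *\<^sub>R v) - f (x + t *\<^sub>R v)) - (f ((x + t *\<^sub>R w) + 0 *\<^sub>R v) - f (x + 0 *\<^sub>R v)) =
      (t - 0) * (fderiv f ((x + t *\<^sub>R w) + \<xi> *\<^sub>R v) v - fderiv f (x + \<xi> *\<^sub>R v) v)"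
    using MVT2[OF t(1) 1] by blast
  have 2: "((\<lambda>u. fderiv f ((x + \<xi> *\<^sub>R v) + u *\<^sub>R w) v) has_real_derivative
      fderiv (\<lambda>y. fderiv f y v) ((x + \<xi> *\<^sub>R v) + u *\<^sub>R w) w) (at u)" if "0 \<le> u" "u \<le> t" for u
    using mem[of \<xi> u] that \<xi>
    by (intro has_real_derivative_along_line[of "\<lambda>y. fderiv f y v"]
        smooth_on_has_derivative[OF smooth_on_fderiv_const[OF f]]) auto
  obtain \<eta> where \<eta>: "0 < \<eta>" "\<eta> < t" and e2:
    "fderiv f ((x + \<xi> *\<^sub>R v) + t *\<^sub>R w) v - fderiv f ((x + \<xi> *\<^sub>R v) + 0 *\<^sub>R w) v =
      (t - 0) * fderiv (\<lambda>y. fderiv f y v) ((x + \<xi> *\<^sub>R v) + \<eta> *\<^sub>R w) w"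
    using MVT2[OF t(1) 2] by blast
  show thesis
    by (rule that[OF \<xi> \<eta>]) (use e1 e2 in \<open>simp add: add_ac\<close>)
qed

lemma continuous_on_dist_bound:
  fixes F :: "'a::metric_space \<Rightarrow> 'b::metric_space"
  assumes "open S" "x \<in> S" "continuous_on S F" "0 < d"
  obtains r where "0 < r" "ball x r \<subseteq> S" "\<And>y. y \<in> ball x r \<Longrightarrow> dist (F y) (F x) < d"
proof -
  obtain r1 where r1: "0 < r1" "ball x r1 \<subseteq> S" using assms(1,2) openE by blast
  have "continuous (at x) F" using assms by (simp add: continuous_on_eq_continuous_at)
  then obtain r2 where r2: "0 < r2" "\<And>y. dist y x < r2 \<Longrightarrow> dist (F y) (F x) < d"
    using assms(4) unfolding continuous_at_eps_delta by blast
  show thesis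
    by (rule that[of "min r1 r2"]) (use r1 r2 in \<open>auto simp: dist_commute subset_iff\<close>)
qed

text \<open>The second difference is symmetric in \<open>v\<close> and \<open>w\<close>, so its two
  mean value forms make the mixed derivatives take equal values at points near \<open>x\<close>. If
  they differed at \<open>x\<close>, continuity with half their distance as tolerance would exclude
  this.\<close>

lemma second_derivative_symmetric_real:
  fixes f :: "'a::real_normed_vector \<Rightarrow> real"
  assumes "open S" "x \<in> S" and f: "smooth_on S f"
  shows "fderiv (\<lambda>y. fderiv f y v) x w = fderiv (\<lambda>y. fderiv f y w) x v"
proof (rule ccontr)
  define H1 where "H1 y = fderiv (\<lambda>y. fderiv f y v) y w" for y
  define H2 where "H2 y = fderiv (\<lambda>y. fderiv f y w) y v" for y
  assume "\<not> ?thesis"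
  then have "0 < dist (H1 x) (H2 x) / 2" by (simp add: H1_def H2_def)
  moreover have "continuous_on S H1" "continuous_on S H2"
    unfolding H1_def H2_def by (intro smooth_on_continuous smooth_on_fderiv_const f)+
  ultimately obtain r1 r2 where
    r1: "0 < r1" "ball x r1 \<subseteq> S" "\<And>y. y \<in> ball x r1 \<Longrightarrow> dist (H1 y) (H1 x) < dist (H1 x) (H2 x) / 2" and
    r2: "0 < r2" "ball x r2 \<subseteq> S" "\<And>y. y \<in> ball x r2 \<Longrightarrow> dist (H2 y) (H2 x) < dist (H1 x) (H2 x) / 2"
    using continuous_on_dist_bound[OF assms(1,2)] by metis
  define r where "r = min r1 r2"
  have r: "0 < r" "ball x r \<subseteq> S" using r1 r2 by (auto simp: r_def)
  \<comment> \<open>The summand 1 makes \<open>N\<close> positive and the bound strict: with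
    \<open>t * N = r\<close>, the product \<open>t * (norm v + norm w)\<close> is
    \<open>r - t\<close>.\<close>
  define N where "N = norm v + norm w + 1"
  define t where "t = r / N"
  have "0 < N" unfolding N_def by (simp add: add_nonneg_pos)
  then have t: "0 < t" "t * N = r" using r by (auto simp: t_def)
  have tn: "t * (norm v + norm w) < r" "t * (norm w + norm v) < r"
    using t by (auto simp: N_def distrib_left)
  have ball: "x + s *\<^sub>R v + u *\<^sub>R w \<in> ball x r" if "0 < s" "s < t" "0 < u" "u < t" for s u
  proof -
    have "norm (s *\<^sub>R v + u *\<^sub>R w) \<le> s * norm v + u * norm w"
      using norm_triangle_ineq[of "s *\<^sub>R v" "u *\<^sub>R w"] that by simp
    also have "\<dots> \<le> t * norm v + t * norm w"
      using that by (intro add_mono mult_right_mono) auto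
    finally have "norm (s *\<^sub>R v + u *\<^sub>R w) < r" using tn by (simp add: distrib_left)
    moreover have "dist x (x + s *\<^sub>R v + u *\<^sub>R w) = norm (s *\<^sub>R v + u *\<^sub>R w)"
      by (simp add: dist_norm norm_minus_commute add_ac)
    ultimately show ?thesis by simp
  qed
  obtain s u where su: "0 < s" "s < t" "0 < u" "u < t"
    "f (x + t *\<^sub>R v + t *\<^sub>R w) - f (x + t *\<^sub>R v) - f (x + t *\<^sub>R w) + f x = t * t * H1 (x + s *\<^sub>R v + u *\<^sub>R w)"
    unfolding H1_def by (rule second_difference_mean_value[OF f r(2) t(1) tn(1)])
  obtain s' u' where su': "0 < s'" "s' < t" "0 < u'" "u' < t"
    "f (x + t *\<^sub>R w + t *\<^sub>R v) - f (x + t *\<^sub>R w) - f (x + t *\<^sub>R v) + f x = t * t * H2 (x + s' *\<^sub>R w + u' *\<^sub>R v)"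
    unfolding H2_def by (rule second_difference_mean_value[OF f r(2) t(1) tn(2)])
  have comm: "x + a *\<^sub>R w + b *\<^sub>R v = x + b *\<^sub>R v + a *\<^sub>R w" for a b by (simp add: add_ac)
  have "t * t * H1 (x + s *\<^sub>R v + u *\<^sub>R w) = t * t * H2 (x + u' *\<^sub>R v + s' *\<^sub>R w)"
    using su(5) su'(5) unfolding comm by linarith
  then have "H1 (x + s *\<^sub>R v + u *\<^sub>R w) = H2 (x + u' *\<^sub>R v + s' *\<^sub>R w)" using t by simp
  moreover have "dist (H1 (x + s *\<^sub>R v + u *\<^sub>R w)) (H1 x) < dist (H1 x) (H2 x) / 2"
    using ball[OF su(1-4)] r1(3) by (simp add: r_def)
  moreover have "dist (H2 (x + u' *\<^sub>R v + s' *\<^sub>R w)) (H2 x) < dist (H1 x) (H2 x) / 2"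
    using ball[OF su'(3,4,1,2)] r2(3) by (simp add: r_def)
  ultimately show False
    using dist_triangle_half_l[of "H1 x" "H1 (x + s *\<^sub>R v + u *\<^sub>R w)" "dist (H1 x) (H2 x)" "H2 x"]
    by (simp add: dist_commute)
qed

lemma second_derivative_symmetric:
  fixes f :: "'a::real_normed_vector \<Rightarrow> 'b::euclidean_space"
  assumes "open S" "x \<in> S" and f: "smooth_on S f"
  shows "fderiv (\<lambda>y. fderiv f y v) x w = fderiv (\<lambda>y. fderiv f y w) x v"
proof (rule euclidean_eqI)
  fix b :: 'b
  have inner: "fderiv (\<lambda>y. F y \<bullet> b) x u = fderiv F x u \<bullet> b" if "F differentiable at x" for F :: "'a \<Rightarrow> 'b" and u x
    using fderiv_eq[OF has_derivative_inner_left[OF has_fderiv[OF that], of b]] by simp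
  have D2: "fderiv (\<lambda>y. fderiv (\<lambda>z. f z \<bullet> b) y u) x u' = fderiv (\<lambda>y. fderiv f y u) x u' \<bullet> b" for u u'
  proof -
    have "fderiv (\<lambda>y. fderiv (\<lambda>z. f z \<bullet> b) y u) x = fderiv (\<lambda>y. fderiv f y u \<bullet> b) x"
      by (rule fderiv_cong(1)[OF assms(1,2), symmetric])
         (auto simp: inner smooth_on_differentiable[OF f]
           intro!: differentiable_inner differentiable_const smooth_on_differentiable[OF smooth_on_fderiv_const[OF f] assms(2)])
    then show ?thesis
      using inner[OF smooth_on_differentiable[OF smooth_on_fderiv_const[OF f] assms(2)]] by simp
  qed
  have "smooth_on S (\<lambda>z. f z \<bullet> b)" by (intro smooth_on_inner assms smooth_on_const)
  from second_derivative_symmetric_real[OF assms(1,2) this, of v w]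
  show "fderiv (\<lambda>y. fderiv f y v) x w \<bullet> b = fderiv (\<lambda>y. fderiv f y w) x v \<bullet> b"
    by (simp add: D2)
qed

text \<open>A linear family becomes bilinear with an extra scalar factor, here frozen at 1.\<close>

lemma has_derivative_linear_family:
  fixes L :: "'p::real_normed_vector \<Rightarrow> 'a::euclidean_space \<Rightarrow> 'c::real_normed_vector"
  assumes "open S" "x \<in> S" and lin: "\<And>y. y \<in> S \<Longrightarrow> linear (L y)"
    and L: "\<And>v. (\<lambda>y. L y v) differentiable at x" and V: "(V has_derivative V') (at x)"
  shows "((\<lambda>y. L y (V y)) has_derivative (\<lambda>u. fderiv (\<lambda>y. L y (V x)) x u + L x (V' u))) (at x)"
proof -
  have "((\<lambda>y. 1 *\<^sub>R L y (V y)) has_derivative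
      (\<lambda>u. fderiv (\<lambda>y. 1 *\<^sub>R L y (V x)) x u + 0 *\<^sub>R L x (V x) + 1 *\<^sub>R L x (V' u))) (at x)"
  proof (rule has_derivative_bilinear_family[of S x "\<lambda>y (c::real) v. c *\<^sub>R L y v" "\<lambda>_. 1" "\<lambda>_. 0" V V'])
    show "bilinear (\<lambda>(c::real) v. c *\<^sub>R L y v)" if "y \<in> S" for y
      unfolding bilinear_def
      by (auto intro!: linearI simp: scaleR_add_left scaleR_add_right linear_add[OF lin[OF that]] linear_cmul[OF lin[OF that]])
  qed (use assms in \<open>auto intro: differentiable_scaleR differentiable_const\<close>)
  then show ?thesis by simp
qed

section \<open>The second fundamental form of a map\<close>

lemma fderiv_bilinear:
  assumes "open S" "x \<in> S" and F: "smooth_on S F"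
  shows "bilinear (\<lambda>v w. fderiv (\<lambda>y. fderiv F y w) x v)"
  unfolding bilinear_def
proof (intro conjI allI)
  note lin = smooth_on_linear_fderiv[OF F]
  note diff = has_fderiv[OF smooth_on_differentiable[OF smooth_on_fderiv_const[OF F] \<open>x \<in> S\<close>]]
  show "linear (\<lambda>w. fderiv (\<lambda>y. fderiv F y w) x v)" for v
  proof (rule linearI)
    show "fderiv (\<lambda>y. fderiv F y (a + b)) x v = fderiv (\<lambda>y. fderiv F y a) x v + fderiv (\<lambda>y. fderiv F y b) x v" for a b
    proof -
      have "((\<lambda>y. fderiv F y (a + b)) has_derivative
          (\<lambda>v. fderiv (\<lambda>y. fderiv F y a) x v + fderiv (\<lambda>y. fderiv F y b) x v)) (at x)"
        by (rule has_derivative_transform_within_open[OF has_derivative_add[OF diff diff] assms(1,2)])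
           (simp add: linear_add[OF lin])
      from fderiv_eq[OF this] show ?thesis by simp
    qed
    show "fderiv (\<lambda>y. fderiv F y (c *\<^sub>R a)) x v = c *\<^sub>R fderiv (\<lambda>y. fderiv F y a) x v" for a c
    proof -
      have "((\<lambda>y. fderiv F y (c *\<^sub>R a)) has_derivative (\<lambda>v. c *\<^sub>R fderiv (\<lambda>y. fderiv F y a) x v)) (at x)"
        by (rule has_derivative_transform_within_open[OF has_derivative_scaleR_right[OF diff] assms(1,2)])
           (simp add: linear_cmul[OF lin])
      from fderiv_eq[OF this] show ?thesis by simp
    qed
  qed
  show "linear (\<lambda>v. fderiv (\<lambda>y. fderiv F y w) x v)" for w
    using smooth_on_linear_fderiv[OF smooth_on_fderiv_const[OF F] \<open>x \<in> S\<close>] .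
qed

lemma derivative_of_differential_eq:
  "derivative_of_differential g h F x v w =
     fderiv (\<lambda>y. fderiv F y w) x v + christoffel h (F x) (fderiv F x v) (fderiv F x w)
     - fderiv F x (christoffel g x v w)"
  by (simp add: derivative_of_differential_def pullback_derivative_def levi_civita_def)

lemma derivative_of_differential_bilinear:
  assumes g: "differentiable_metric_on S g" and h: "differentiable_metric_on T h"
    and x: "x \<in> S" "F x \<in> T" and F: "smooth_on S F"
  shows "bilinear (derivative_of_differential g h F x)"
proof -
  have "open S" using g by (simp add: differentiable_metric_on_def)
  note bil = fderiv_bilinear[OF this x(1) F] christoffel_bilinear[OF g x(1)] christoffel_bilinear[OF h x(2)]
  note lin = smooth_on_linear_fderiv[OF F x(1)]
  show ?thesis
    unfolding bilinear_def derivative_of_differential_eq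
    by (auto intro!: linearI simp: linear_add[OF lin] linear_cmul[OF lin]
        bilinear_ladd[OF bil(1)] bilinear_radd[OF bil(1)] bilinear_lmul[OF bil(1)] bilinear_rmul[OF bil(1)]
        bilinear_ladd[OF bil(2)] bilinear_radd[OF bil(2)] bilinear_lmul[OF bil(2)] bilinear_rmul[OF bil(2)]
        bilinear_ladd[OF bil(3)] bilinear_radd[OF bil(3)] bilinear_lmul[OF bil(3)] bilinear_rmul[OF bil(3)]
        algebra_simps)
qed

lemma fderiv_compose:
  assumes "smooth_on S l" "smooth_on T F" "x \<in> S" "l x \<in> T"
  shows "fderiv (\<lambda>x. F (l x)) x v = fderiv F (l x) (fderiv l x v)"
  using fderiv_eq[OF has_derivative_compose[OF smooth_on_has_derivative[OF assms(1,3)]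
      smooth_on_has_derivative[OF assms(2,4)]]] by simp

text \<open>The chain rule for second fundamental forms. The metric \<open>h\<close> in the middle
  is arbitrary: its Christoffel terms occur with both signs and cancel.\<close>

lemma derivative_of_differential_compose:
  fixes l :: "'a::euclidean_space \<Rightarrow> 'b::euclidean_space" and F :: "'b \<Rightarrow> 'c::euclidean_space"
  assumes "open S" "open T" "l ` S \<subseteq> T" and l: "smooth_on S l" and F: "smooth_on T F" and x: "x \<in> S"
  shows "derivative_of_differential g k (\<lambda>x. F (l x)) x v w =
    derivative_of_differential h k F (l x) (fderiv l x v) (fderiv l x w)
    + fderiv F (l x) (derivative_of_differential g h l x v w)"
proof -
  have lx: "l y \<in> T" if "y \<in> S" for y using assms(3) that by blast
  note lin = smooth_on_linear_fderiv[OF F lx[OF x]]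
  have D: "fderiv (\<lambda>x. F (l x)) y u = fderiv F (l y) (fderiv l y u)" if "y \<in> S" for y u
    by (rule fderiv_compose[OF l F that lx[OF that]])
  have comp: "((\<lambda>y. fderiv F (l y) u) has_derivative (\<lambda>v. fderiv (\<lambda>z. fderiv F z u) (l x) (fderiv l x v))) (at x)" for u
    by (rule has_derivative_compose[OF smooth_on_has_derivative[OF l x]
          smooth_on_has_derivative[OF smooth_on_fderiv_const[OF F] lx[OF x]]])
  have "((\<lambda>y. fderiv F (l y) (fderiv l y w)) has_derivative
      (\<lambda>u. fderiv (\<lambda>y. fderiv F (l y) (fderiv l x w)) x u + fderiv F (l x) (fderiv (\<lambda>y. fderiv l y w) x u))) (at x)"
    by (rule has_derivative_linear_family[of S x "\<lambda>y. fderiv F (l y)"])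
       (use assms lx comp in \<open>auto intro: smooth_on_linear_fderiv[OF F] differentiableI
         smooth_on_has_derivative[OF smooth_on_fderiv_const[OF l]]\<close>)
  then have "((\<lambda>y. fderiv (\<lambda>x. F (l x)) y w) has_derivative
      (\<lambda>u. fderiv (\<lambda>y. fderiv F (l y) (fderiv l x w)) x u + fderiv F (l x) (fderiv (\<lambda>y. fderiv l y w) x u))) (at x)"
    by (rule has_derivative_transform_within_open[OF _ assms(1) x]) (simp add: D)
  from fderiv_eq[OF this] fderiv_eq[OF comp]
  have "fderiv (\<lambda>y. fderiv (\<lambda>x. F (l x)) y w) x v =
      fderiv (\<lambda>z. fderiv F z (fderiv l x w)) (l x) (fderiv l x v) + fderiv F (l x) (fderiv (\<lambda>y. fderiv l y w) x v)"
    by simp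
  then show ?thesis
    by (simp add: derivative_of_differential_eq D[OF x] linear_add[OF lin] linear_diff[OF lin])
qed

section \<open>Local isometries\<close>

definition isometric_on :: "'a::euclidean_space set \<Rightarrow> 'a metric \<Rightarrow> 'b::euclidean_space metric \<Rightarrow> ('a \<Rightarrow> 'b) \<Rightarrow> bool" where
  "isometric_on S g h l \<longleftrightarrow> (\<forall>x\<in>S. \<forall>v w. h (l x) (fderiv l x v) (fderiv l x w) = g x v w)"

lemma isometric_inj:
  assumes "inner_form m" "bilinear m'" "linear L" "\<And>v w. m' (L v) (L w) = m v w"
  shows "inj L"
proof (rule linear_injective_0[OF assms(3), THEN iffD2], intro allI impI)
  fix v assume "L v = 0"
  then have "m v v = 0" using assms(4)[of v v] bilinear_lzero[OF assms(2)] by simp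
  then show "v = 0" using inner_formD(3)[OF assms(1), of v] by force
qed

text \<open>In equal dimensions the Levi-Civita connection of \<open>h\<close> can be pulled back
  along \<open>l\<close>. The pull-back is symmetric and metric, so by uniqueness it is that of
  \<open>g\<close>, and this equality says exactly that the second fundamental form of
  \<open>l\<close> is zero.\<close>

lemma isometry_totally_geodesic:
  fixes l :: "'e::euclidean_space \<Rightarrow> 'e"
  assumes g: "differentiable_metric_on S g" and h: "differentiable_metric_on T h"
    and l: "smooth_on S l" "l ` S \<subseteq> T" "isometric_on S g h l" and x: "x \<in> S"
  shows "derivative_of_differential g h l x v w = 0"
proof -
  have "open S" using g by (simp add: differentiable_metric_on_def)
  have lx: "l y \<in> T" if "y \<in> S" for y using l(2) that by blast
  let ?D = "fderiv l x"
  let ?D2 = "\<lambda>u v. fderiv (\<lambda>y. fderiv l y v) x u"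
  have lin: "linear ?D" by (rule smooth_on_linear_fderiv[OF l(1) x])
  have iso: "h (l x) (?D v) (?D w) = g x v w" for v w
    using l(3) x by (simp add: isometric_on_def)
  have bil: "bilinear (h (l y))" if "y \<in> S" for y
    using h lx[OF that] by (simp add: differentiable_metric_on_def inner_form_def)
  have "inj ?D"
    by (rule isometric_inj[OF metric_at(2)[OF g x] bil[OF x] lin iso])
  then obtain i where i: "linear i" "\<And>u. i (?D u) = u" "\<And>u. ?D (i u) = u"
    using linear_injective_isomorphism[OF lin] by blast
  \<comment> \<open>The Christoffel map of the pulled-back connection, by the transformation law
    with the inverse differential \<open>i\<close>.\<close>
  define C where "C u v = i (?D2 u v + christoffel h (l x) (?D u) (?D v))" for u v
  have DC: "?D (C u v) = ?D2 u v + christoffel h (l x) (?D u) (?D v)" for u v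
    by (simp add: C_def i(3))
  note bil2 = fderiv_bilinear[OF \<open>open S\<close> x l(1)]
  note bilh = christoffel_bilinear[OF h lx[OF x]]
  have "christoffel g x = C"
  proof (rule christoffel_eqI[OF g x])
    show "bilinear C"
      unfolding bilinear_def C_def
      by (auto intro!: linearI simp: linear_add[OF lin] linear_cmul[OF lin] linear_add[OF i(1)] linear_cmul[OF i(1)]
          bilinear_ladd[OF bil2] bilinear_radd[OF bil2] bilinear_lmul[OF bil2] bilinear_rmul[OF bil2]
          bilinear_ladd[OF bilh] bilinear_radd[OF bilh] bilinear_lmul[OF bilh] bilinear_rmul[OF bilh]
          algebra_simps)
    \<comment> \<open>The transformation law contains the second derivative of \<open>l\<close>, so
      Schwarz's theorem is needed for vanishing torsion.\<close>
    show "C u v = C v u" for u v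
      unfolding C_def using second_derivative_symmetric[OF \<open>open S\<close> x l(1), of v u]
        christoffel_sym[OF h lx[OF x]] by simp
    fix u v w
    have comp: "((\<lambda>y. h (l y) a b) has_derivative (\<lambda>u. fderiv (\<lambda>z. h z a b) (l x) (?D u))) (at x)" for a b
      by (rule has_derivative_compose[OF smooth_on_has_derivative[OF l(1) x] has_fderiv[OF metric_at(3)[OF h lx[OF x]]]])
    have "((\<lambda>y. h (l y) (fderiv l y v) (fderiv l y w)) has_derivative
        (\<lambda>u. fderiv (\<lambda>y. h (l y) (?D v) (?D w)) x u + h (l x) (?D2 u v) (?D w) + h (l x) (?D v) (?D2 u w))) (at x)"
      by (rule has_derivative_bilinear_family[of S x "\<lambda>y. h (l y)", OF \<open>open S\<close> x bil])
         (use comp x in \<open>auto intro: differentiableI smooth_on_has_derivative[OF smooth_on_fderiv_const[OF l(1)]]\<close>)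
    then have "((\<lambda>y. g y v w) has_derivative
        (\<lambda>u. fderiv (\<lambda>y. h (l y) (?D v) (?D w)) x u + h (l x) (?D2 u v) (?D w) + h (l x) (?D v) (?D2 u w))) (at x)"
      by (rule has_derivative_transform_within_open[OF _ \<open>open S\<close> x])
         (use l(3) in \<open>simp add: isometric_on_def\<close>)
    then have "fderiv (\<lambda>y. g y v w) x u =
        fderiv (\<lambda>z. h z (?D v) (?D w)) (l x) (?D u) + h (l x) (?D2 u v) (?D w) + h (l x) (?D v) (?D2 u w)"
      using fderiv_eq[OF comp] by (simp add: fderiv_eq)
    also have "\<dots> = h (l x) (?D (C u v)) (?D w) + h (l x) (?D v) (?D (C u w))"
      by (simp add: DC christoffel_metric[OF h lx[OF x]] bilinear_ladd[OF bil[OF x]] bilinear_radd[OF bil[OF x]])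
    finally show "fderiv (\<lambda>y. g y v w) x u = g x (C u v) w + g x v (C u w)" by (simp only: iso)
  qed
  then show ?thesis by (simp add: derivative_of_differential_eq DC)
qed

lemma tension_field_eq:
  fixes F :: "'a::euclidean_space \<Rightarrow> 'b::euclidean_space" and e :: "'a \<Rightarrow> 'a"
  assumes "differentiable_metric_on S g" "differentiable_metric_on T h" "x \<in> S" "F x \<in> T" "smooth_on S F"
    and "orthonormal_family (g x) e"
  shows "tension_field g h F x = (\<Sum>a\<in>Basis. derivative_of_differential g h F x (e a) (e a))"
  unfolding tension_field_def
  by (rule metric_trace_eq[OF metric_at(2)[OF assms(1,3)] derivative_of_differential_bilinear[OF assms(1-5)] assms(6)])

lemma tension_field_cong:
  assumes "open S" "x \<in> S" "\<And>y. y \<in> S \<Longrightarrow> F y = F' y" and F: "smooth_on S F"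
  shows "tension_field g h F x = tension_field g h F' x"
proof -
  have D: "fderiv F y = fderiv F' y" if "y \<in> S" for y
    by (rule fderiv_cong(1)[OF assms(1) that assms(3) smooth_on_differentiable[OF F that]])
  have "fderiv (\<lambda>y. fderiv F y w) x = fderiv (\<lambda>y. fderiv F' y w) x" for w
    by (rule fderiv_cong(1)[OF assms(1,2) _ smooth_on_differentiable[OF smooth_on_fderiv_const[OF F] assms(2)]])
       (simp add: D)
  then show ?thesis
    unfolding tension_field_def derivative_of_differential_eq by (simp add: D assms)
qed

text \<open>The differential of \<open>l\<close> carries an orthonormal basis to an orthonormal
  basis, and the vanishing second fundamental form of \<open>l\<close> removes the correction term
  of the chain rule.\<close>

lemma tension_field_compose_isometry:
  fixes l :: "'a::euclidean_space \<Rightarrow> 'a" and F :: "'a \<Rightarrow> 'b::euclidean_space"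
  assumes g: "differentiable_metric_on S g" and h: "differentiable_metric_on T h" and k: "differentiable_metric_on R k"
    and l: "smooth_on S l" "l ` S \<subseteq> T" "isometric_on S g h l"
    and F: "smooth_on T F" "F ` T \<subseteq> R" and x: "x \<in> S"
  shows "tension_field g k (\<lambda>x. F (l x)) x = tension_field h k F (l x)"
proof -
  have op: "open S" "open T" using g h by (auto simp: differentiable_metric_on_def)
  have lx: "l x \<in> T" and Flx: "F (l x) \<in> R" using l(2) F(2) x by auto
  obtain e :: "'a \<Rightarrow> 'a" where e: "orthonormal_family (g x) e"
    using orthonormal_family_exists[OF metric_at(2)[OF g x]] by blast
  then have e': "orthonormal_family (h (l x)) (\<lambda>a. fderiv l x (e a))"
    using l(3) x by (simp add: orthonormal_family_def isometric_on_def)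
  have "smooth_on S (\<lambda>x. F (l x))" by (rule smooth_on_compose[OF op l(2,1) F(1)])
  from tension_field_eq[where F = "\<lambda>x. F (l x)", OF g k x Flx this e]
  have "tension_field g k (\<lambda>x. F (l x)) x =
      (\<Sum>a\<in>Basis. derivative_of_differential g k (\<lambda>x. F (l x)) x (e a) (e a))" .
  also have "\<dots> = (\<Sum>a\<in>Basis. derivative_of_differential h k F (l x) (fderiv l x (e a)) (fderiv l x (e a)))"
    by (simp add: derivative_of_differential_compose[OF op l(2,1) F(1) x, of g k _ _ h]
        isometry_totally_geodesic[OF g h l x] linear_0[OF smooth_on_linear_fderiv[OF F(1) lx]])
  also have "\<dots> = tension_field h k F (l x)"
    using tension_field_eq[OF h k lx Flx F(1) e'] by simp
  finally show ?thesis .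
qed

lemma tension_field_isometry_compose:
  fixes l :: "'b::euclidean_space \<Rightarrow> 'b" and F :: "'a::euclidean_space \<Rightarrow> 'b"
  assumes g: "differentiable_metric_on S g" and h: "differentiable_metric_on T h" and k: "differentiable_metric_on R k"
    and F: "smooth_on S F" "F ` S \<subseteq> T"
    and l: "smooth_on T l" "l ` T \<subseteq> R" "isometric_on T h k l" and x: "x \<in> S"
  shows "tension_field g k (\<lambda>x. l (F x)) x = fderiv l (F x) (tension_field g h F x)"
proof -
  have op: "open S" "open T" using g h by (auto simp: differentiable_metric_on_def)
  have Fx: "F x \<in> T" and lFx: "l (F x) \<in> R" using l(2) F(2) x by auto
  obtain e :: "'a \<Rightarrow> 'a" where e: "orthonormal_family (g x) e"
    using orthonormal_family_exists[OF metric_at(2)[OF g x]] by blast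
  have "smooth_on S (\<lambda>x. l (F x))" by (rule smooth_on_compose[OF op F(2,1) l(1)])
  from tension_field_eq[where F = "\<lambda>x. l (F x)", OF g k x lFx this e]
  have "tension_field g k (\<lambda>x. l (F x)) x =
      (\<Sum>a\<in>Basis. derivative_of_differential g k (\<lambda>x. l (F x)) x (e a) (e a))" .
  also have "\<dots> = (\<Sum>a\<in>Basis. fderiv l (F x) (derivative_of_differential g h F x (e a) (e a)))"
    by (simp add: derivative_of_differential_compose[OF op F(2,1) l(1) x, of g k _ _ h]
        isometry_totally_geodesic[OF h k l Fx])
  also have "\<dots> = fderiv l (F x) (tension_field g h F x)"
    using tension_field_eq[OF g h x Fx F(1) e] by (simp add: linear_sum[OF smooth_on_linear_fderiv[OF l(1) Fx]])
  finally show ?thesis .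
qed

text \<open>Wanted for continuity: vanishing of the tension has to pass from a set to its
  closure.\<close>

lemma smooth_on_tension_field:
  fixes F :: "'a::euclidean_space \<Rightarrow> 'b::euclidean_space"
  assumes "open S" "open T" and g: "riemannian_metric_on S g" and h: "riemannian_metric_on T h"
    and F: "smooth_on S F" "F ` S \<subseteq> T"
  shows "smooth_on S (tension_field g h F)"
proof -
  note g' = riemannian_imp_differentiable_metric[OF assms(1) g]
  note h' = riemannian_imp_differentiable_metric[OF assms(2) h]
  obtain e :: "'a \<Rightarrow> 'a \<Rightarrow> 'a" where e: "\<And>b. b \<in> Basis \<Longrightarrow> smooth_on S (e b)"
    and on: "\<And>x. x \<in> S \<Longrightarrow> orthonormal_family (g x) (\<lambda>b. e b x)"
    by (rule smooth_orthonormal_frame[of S g, OF assms(1) riemannian_metric_inner_form[OF g]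
          riemannian_metric_smooth[OF g]]) (assumption, rule that)
  have D2: "smooth_on S (\<lambda>x. fderiv (\<lambda>y. fderiv F y (W x)) x (V x))" if "smooth_on S V" "smooth_on S W" for V W
    by (rule smooth_on_bilinear_family[where m = "\<lambda>x v w. fderiv (\<lambda>y. fderiv F y w) x v",
          OF assms(1) fderiv_bilinear[OF assms(1) _ F(1)] _ that])
       (auto intro: smooth_on_fderiv_const F)
  have "smooth_on S (\<lambda>x. \<Sum>a\<in>Basis. derivative_of_differential g h F x (e a x) (e a x))"
    unfolding derivative_of_differential_eq
    by (intro smooth_on_sum smooth_on_diff smooth_on_add D2 e smooth_on_fderiv
        christoffel_smooth_compose[OF assms(1,2) h F(2,1)]
        christoffel_smooth[OF assms(1) g] assms(1) F(1))
  then show ?thesis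
  proof (rule smooth_on_cong[OF assms(1)])
    fix x assume x: "x \<in> S"
    then have "F x \<in> T" using F(2) by blast
    from tension_field_eq[OF g' h' x this F(1) on[OF x]]
    show "(\<Sum>a\<in>Basis. derivative_of_differential g h F x (e a x) (e a x)) = tension_field g h F x" by simp
  qed
qed

section \<open>Transitions between orbifold charts\<close>

lemma inner_form_pullback:
  assumes "linear (L :: 'a::euclidean_space \<Rightarrow> 'b::euclidean_space)" "inj L"
  shows "inner_form (\<lambda>v w. L v \<bullet> L w)"
proof -
  have "L v \<noteq> 0" if "v \<noteq> 0" for v
    using assms that linear_injective_0 by blast
  then show ?thesis
    unfolding inner_form_def bilinear_def
    by (auto intro!: linearI simp: linear_add[OF assms(1)] linear_cmul[OF assms(1)] inner_add_left inner_add_right inner_commute)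
qed

text \<open>Pull the Euclidean inner product back by \<open>L x\<close> and take a smooth
  orthonormal frame \<open>e\<close> for it. The images of \<open>e\<close> under \<open>L x\<close>
  are orthonormal in the usual sense, so the solution of the linear system is a sum with
  coefficients \<open>w \<bullet> L x (e a x)\<close>. No determinants are needed.\<close>

lemma smooth_on_linear_inverse:
  fixes L :: "'p::real_normed_vector \<Rightarrow> 'e::euclidean_space \<Rightarrow> 'e"
  assumes "open S" and L: "\<And>x. x \<in> S \<Longrightarrow> linear (L x)" "\<And>x. x \<in> S \<Longrightarrow> inj (L x)"
    and sm: "\<And>v. smooth_on S (\<lambda>x. L x v)" and k: "\<And>x. x \<in> S \<Longrightarrow> L x (k x) = w"
  shows "smooth_on S k"
proof -
  let ?m = "\<lambda>x v w. L x v \<bullet> L x w"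
  have inner: "inner_form (?m x)" if "x \<in> S" for x by (rule inner_form_pullback[OF L(1,2)[OF that]])
  obtain e :: "'e \<Rightarrow> 'p \<Rightarrow> 'e" where e: "\<And>b. b \<in> Basis \<Longrightarrow> smooth_on S (e b)"
    and on: "\<And>x. x \<in> S \<Longrightarrow> orthonormal_family (?m x) (\<lambda>b. e b x)"
    by (rule smooth_orthonormal_frame[of S ?m, OF assms(1) inner smooth_on_inner[OF assms(1) sm sm]])
       (assumption, rule that)
  have Le: "smooth_on S (\<lambda>x. L x (e a x))" if "a \<in> Basis" for a
  proof (rule smooth_on_cong[OF assms(1)])
    show "smooth_on S (\<lambda>x. \<Sum>b\<in>Basis. (e a x \<bullet> b) *\<^sub>R L x b)"
      by (intro smooth_on_sum smooth_on_scaleR smooth_on_inner smooth_on_const e that sm assms(1))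
  qed (simp only: linear_Basis_expand[OF L(1), symmetric])
  have "smooth_on S (\<lambda>x. \<Sum>a\<in>Basis. (w \<bullet> L x (e a x)) *\<^sub>R e a x)"
    by (intro smooth_on_sum smooth_on_scaleR smooth_on_inner smooth_on_const Le e assms(1))
  then show ?thesis
  proof (rule smooth_on_cong[OF assms(1)])
    fix x assume x: "x \<in> S"
    show "(\<Sum>a\<in>Basis. (w \<bullet> L x (e a x)) *\<^sub>R e a x) = k x"
      using orthonormal_family_expand[OF inner[OF x] on[OF x], of "k x"] by (simp add: k[OF x])
  qed
qed

text \<open>Invariance of domain gives the open image. The derivative of \<open>k\<close> at
  \<open>y\<close> is the inverse of the differential of \<open>l\<close> at \<open>k y\<close>, so
  each order of differentiability of \<open>k\<close> yields the next.\<close>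

lemma smooth_on_inverse:
  fixes l :: "'e::euclidean_space \<Rightarrow> 'e"
  assumes "open S" and l: "smooth_on S l" and inj: "\<And>x. x \<in> S \<Longrightarrow> inj (fderiv l x)"
    and k: "\<And>x. x \<in> S \<Longrightarrow> k (l x) = x"
  shows "open (l ` S)" "smooth_on (l ` S) k"
proof -
  have cont: "continuous_on S l" by (rule smooth_on_continuous[OF l])
  have "inj_on l S" by (rule inj_on_inverseI[of S k]) (rule k)
  then show op: "open (l ` S)" by (rule invariance_of_domain[OF cont assms(1)])
  \<comment> \<open>Inverse differentials as functions on the source, where their smoothness is
    known; composition with \<open>k\<close> moves them to the image.\<close>
  define \<Phi> where "\<Phi> w x = inv_into UNIV (fderiv l x) w" for w x
  note lin = smooth_on_linear_fderiv[OF l]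
  have inv: "fderiv l x (\<Phi> w x) = w" if "x \<in> S" for w x
    unfolding \<Phi>_def by (rule surj_f_inv_f[OF linear_injective_imp_surjective[OF lin[OF that] inj[OF that] refl]])
  have \<Phi>: "smooth_on S (\<Phi> w)" for w
    by (rule smooth_on_linear_inverse[OF assms(1) lin inj smooth_on_fderiv_const[OF l] inv])
  have deriv: "(k has_derivative (\<lambda>w. \<Phi> w (k y))) (at y)" if y: "y \<in> l ` S" for y
  proof -
    obtain x where x: "x \<in> S" "y = l x" using y by blast
    have "(k has_derivative (\<lambda>w. \<Phi> w x)) (at (l x))"
      by (rule has_derivative_inverse_strong[OF assms(1) x(1) cont k smooth_on_has_derivative[OF l x(1)]])
         (auto simp: fun_eq_iff inv[OF x(1)])
    then show ?thesis by (simp add: x(2) k[OF x(1)])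
  qed
  have "times_differentiable_on n (l ` S) k" for n
  proof (induction n)
    case 0
    show ?case
      by (simp, intro continuous_at_imp_continuous_on ballI has_derivative_continuous[OF deriv])
  next
    case (Suc n)
    have comp: "times_differentiable_on n (l ` S) (\<lambda>y. \<Phi> w (k y))" for w
      by (rule times_differentiable_on_compose[OF op assms(1) _ Suc])
         (use k \<Phi> in \<open>auto simp: smooth_on_def\<close>)
    show ?case by (rule times_differentiable_onI[OF deriv comp op])
  qed
  then show "smooth_on (l ` S) k" by (simp add: smooth_on_def)
qed

section \<open>Coincidence with one of finitely many maps\<close>

lemma open_disagreement:
  fixes F G :: "'a::topological_space \<Rightarrow> 'b::t2_space"
  assumes "open S" "continuous_on S F" "continuous_on S G"
  shows "open {y \<in> S. F y \<noteq> G y}"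
proof -
  have "continuous_on S (\<lambda>y. (F y, G y))" by (intro continuous_on_Pair assms)
  from continuous_open_preimage[OF this assms(1) open_diagonal_complement]
  moreover have "S \<inter> (\<lambda>y. (F y, G y)) -` {(x, y) | x y. x \<noteq> y} = {y \<in> S. F y \<noteq> G y}" by auto
  ultimately show ?thesis by simp
qed

text \<open>A finite Baire argument: if \<open>F\<close> is not \<open>G i\<close> on all of
  \<open>S\<close>, pass to the open set where they differ; there \<open>i\<close> is no longer a
  candidate.\<close>

lemma finite_coincidence:
  fixes F :: "'a::topological_space \<Rightarrow> 'b::t2_space"
  assumes "finite I" "open S" "S \<noteq> {}" "continuous_on S F" "\<And>i. i \<in> I \<Longrightarrow> continuous_on S (G i)"
    and "\<And>y. y \<in> S \<Longrightarrow> \<exists>i\<in>I. F y = G i y"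
  shows "\<exists>i\<in>I. \<exists>S'. open S' \<and> S' \<noteq> {} \<and> S' \<subseteq> S \<and> (\<forall>y\<in>S'. F y = G i y)"
  using assms
proof (induction I arbitrary: S)
  case empty
  then show ?case by blast
next
  case (insert i I)
  let ?C = "{y \<in> S. F y \<noteq> G i y}"
  show ?case
  proof (cases "?C = {}")
    case True
    then show ?thesis using insert.prems(1,2) by blast
  next
    case False
    have "\<exists>j\<in>I. \<exists>S'. open S' \<and> S' \<noteq> {} \<and> S' \<subseteq> ?C \<and> (\<forall>y\<in>S'. F y = G j y)"
    proof (rule insert.IH[OF _ False])
      show "open ?C" by (rule open_disagreement[OF insert.prems(1,3,4)]) simp
      show "continuous_on ?C F" by (rule continuous_on_subset[OF insert.prems(3)]) blast
      show "continuous_on ?C (G j)" if "j \<in> I" for j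
        by (rule continuous_on_subset[OF insert.prems(4)]) (use that in auto)
      show "\<exists>j\<in>I. F y = G j y" if "y \<in> ?C" for y using insert.prems(5)[of y] that by auto
    qed
    then show ?thesis by blast
  qed
qed

text \<open>If \<open>u\<close> were in none of the closures of the open coincidence sets, removing
  these finitely many closed sets would leave a nonempty open set, on which
  \<open>finite_coincidence\<close> finds yet another coincidence.\<close>

lemma finite_coincidence_closure:
  fixes F :: "'a::topological_space \<Rightarrow> 'b::t2_space"
  assumes "finite I" "open S" "u \<in> S" "continuous_on S F" "\<And>i. i \<in> I \<Longrightarrow> continuous_on S (G i)"
    and "\<And>y. y \<in> S \<Longrightarrow> \<exists>i\<in>I. F y = G i y"
  shows "\<exists>i\<in>I. u \<in> closure (interior {y \<in> S. F y = G i y})"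
proof (rule ccontr)
  define E where "E i = interior {y \<in> S. F y = G i y}" for i
  assume "\<not> ?thesis"
  then have u: "u \<in> S - (\<Union>i\<in>I. closure (E i))" using assms(3) by (simp add: E_def)
  have "open (S - (\<Union>i\<in>I. closure (E i)))" by (intro open_Diff assms(2) closed_UN assms(1)) auto
  then have "\<exists>i\<in>I. \<exists>S'. open S' \<and> S' \<noteq> {} \<and> S' \<subseteq> S - (\<Union>i\<in>I. closure (E i)) \<and> (\<forall>y\<in>S'. F y = G i y)"
    by (rule finite_coincidence[OF assms(1)])
       (use u assms(6) in \<open>auto intro: continuous_on_subset[OF assms(4)] continuous_on_subset[OF assms(5)]\<close>)
  then obtain i S' where S': "i \<in> I" "open S'" "S' \<noteq> {}" "S' \<subseteq> S - (\<Union>i\<in>I. closure (E i))" "\<forall>y\<in>S'. F y = G i y"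
    by blast
  then have "S' \<subseteq> E i" unfolding E_def by (intro interior_maximal) auto
  then show False using S' closure_subset[of "E i"] by blast
qed

lemma agree_on_closure:
  fixes F G :: "'a::topological_space \<Rightarrow> 'b::t2_space"
  assumes "open S" "continuous_on S F" "continuous_on S G" "u \<in> S" "u \<in> closure E"
    and "\<And>y. y \<in> E \<Longrightarrow> y \<in> S \<Longrightarrow> F y = G y"
  shows "F u = G u"
proof (rule ccontr)
  assume "F u \<noteq> G u"
  then have "u \<in> {y \<in> S. F y \<noteq> G y} \<inter> closure E" using assms(4,5) by simp
  then have "{y \<in> S. F y \<noteq> G y} \<inter> E \<noteq> {}"
    using open_Int_closure_eq_empty[OF open_disagreement[OF assms(1-3)]] by blast
  then show False using assms(6) by blast
qed

section \<open>Local groups of orbifold charts\<close>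

lemma orbifold_chart_orbit:
  assumes "orbifold_chart X c" "u \<in> odom c" "v \<in> odom c"
  shows "omap c u = omap c v \<longleftrightarrow> (\<exists>\<gamma>\<in>ogrp c. v = \<gamma> u)"
  using assms by (simp add: orbifold_chart_def)

lemma chart_group_elem:
  assumes c: "orbifold_chart X c" and \<gamma>: "\<gamma> \<in> ogrp c"
  shows "\<gamma> ` odom c = odom c" "inj_on \<gamma> (odom c)" "\<gamma> \<in> extensional (odom c)" "smooth_on (odom c) \<gamma>"
    "\<And>u. u \<in> odom c \<Longrightarrow> omap c (\<gamma> u) = omap c u"
    "\<exists>\<delta>\<in>ogrp c. \<forall>u\<in>odom c. \<delta> (\<gamma> u) = u \<and> \<gamma> (\<delta> u) = u"
    "\<And>\<delta>. \<delta> \<in> ogrp c \<Longrightarrow> compose (odom c) \<gamma> \<delta> \<in> ogrp c"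
proof -
  have sub: "subgroup (ogrp c) (BijGroup (odom c))" using c by (simp add: orbifold_chart_def)
  have Bij: "\<delta> \<in> Bij (odom c)" if "\<delta> \<in> ogrp c" for \<delta>
    using subgroup.mem_carrier[OF sub that] by (simp add: BijGroup_def)
  show img: "\<gamma> ` odom c = odom c" and inj: "inj_on \<gamma> (odom c)" and "\<gamma> \<in> extensional (odom c)"
    using Bij[OF \<gamma>] by (auto simp: Bij_def bij_betw_def)
  show "smooth_on (odom c) \<gamma>" using c \<gamma> by (simp add: orbifold_chart_def)
  show "omap c (\<gamma> u) = omap c u" if "u \<in> odom c" for u
  proof -
    have "\<gamma> u \<in> odom c" using img that by blast
    then show ?thesis using orbifold_chart_orbit[OF c that] \<gamma> by metis
  qed
  have "inv\<^bsub>BijGroup (odom c)\<^esub> \<gamma> \<in> ogrp c" by (rule subgroup.m_inv_closed[OF sub \<gamma>])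
  then have "(\<lambda>x\<in>odom c. inv_into (odom c) \<gamma> x) \<in> ogrp c" by (simp add: inv_BijGroup[OF Bij[OF \<gamma>]])
  moreover have "\<forall>u\<in>odom c. (\<lambda>x\<in>odom c. inv_into (odom c) \<gamma> x) (\<gamma> u) = u \<and>
      \<gamma> ((\<lambda>x\<in>odom c. inv_into (odom c) \<gamma> x) u) = u"
    using img inj by (auto simp: f_inv_into_f)
  ultimately show "\<exists>\<delta>\<in>ogrp c. \<forall>u\<in>odom c. \<delta> (\<gamma> u) = u \<and> \<gamma> (\<delta> u) = u" by blast
  show "compose (odom c) \<gamma> \<delta> \<in> ogrp c" if "\<delta> \<in> ogrp c" for \<delta>
    using subgroup.m_closed[OF sub \<gamma> that] Bij[OF \<gamma>] Bij[OF that] by (simp add: BijGroup_def)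
qed

text \<open>
  Any two lifts of the same map into an orbifold differ by group elements, but possibly by different
  ones on different parts of the domain. One of them works on an open set accumulating at a
  given point, which suffices to compare continuous data such as derivatives there.
\<close>

lemma lifts_differ_by_group:
  assumes c: "orbifold_chart X c" and "open S" "u \<in> S"
    and F: "continuous_on S F" "F ` S \<subseteq> odom c" and G: "continuous_on S G" "G ` S \<subseteq> odom c"
    and eq: "\<And>y. y \<in> S \<Longrightarrow> omap c (F y) = omap c (G y)"
  shows "\<exists>\<gamma>\<in>ogrp c. u \<in> closure (interior {y \<in> S. F y = \<gamma> (G y)})"
proof (rule finite_coincidence_closure[where G = "\<lambda>\<gamma> y. \<gamma> (G y)", OF _ assms(2,3) F(1)])
  show "finite (ogrp c)" using c by (simp add: orbifold_chart_def)
  show "continuous_on S (\<lambda>y. \<gamma> (G y))" if "\<gamma> \<in> ogrp c" for \<gamma>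
    using continuous_on_compose2[OF smooth_on_continuous[OF chart_group_elem(4)[OF c that]] G] .
  show "\<exists>\<gamma>\<in>ogrp c. F y = \<gamma> (G y)" if "y \<in> S" for y
  proof -
    have "G y \<in> odom c" "F y \<in> odom c" using F(2) G(2) that by auto
    then show ?thesis using orbifold_chart_orbit[OF c] eq[OF that] by metis
  qed
qed

text \<open>Chart embeddings are defined on whole chart domains and cannot be inverted. Partial
  isometries covering the identity of the orbifold, kept together with a smooth inverse, are closed
  under inversion and composition.\<close>

definition chart_transition ::
  "(('e::euclidean_space, 'x) orb_chart \<Rightarrow> 'e metric) \<Rightarrow> ('e, 'x) orb_chart \<Rightarrow> ('e, 'x) orb_chart \<Rightarrow>
    'e set \<Rightarrow> ('e \<Rightarrow> 'e) \<Rightarrow> ('e \<Rightarrow> 'e) \<Rightarrow> bool" where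
  "chart_transition g c c' S \<psi> \<kappa> \<longleftrightarrow> open S \<and> S \<subseteq> odom c \<and> smooth_on S \<psi> \<and>
    open (\<psi> ` S) \<and> \<psi> ` S \<subseteq> odom c' \<and> smooth_on (\<psi> ` S) \<kappa> \<and>
    (\<forall>y\<in>S. \<kappa> (\<psi> y) = y \<and> omap c' (\<psi> y) = omap c y) \<and> isometric_on S (g c) (g c') \<psi>"

lemma chart_transitionD:
  assumes "chart_transition g c c' S \<psi> \<kappa>"
  shows "open S" "S \<subseteq> odom c" "smooth_on S \<psi>" "open (\<psi> ` S)" "\<psi> ` S \<subseteq> odom c'" "smooth_on (\<psi> ` S) \<kappa>"
    "\<And>y. y \<in> S \<Longrightarrow> \<kappa> (\<psi> y) = y" "\<And>y. y \<in> S \<Longrightarrow> omap c' (\<psi> y) = omap c y"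
    "isometric_on S (g c) (g c') \<psi>"
  using assms by (auto simp: chart_transition_def)

lemma chart_transition_fderiv_inverse:
  assumes T: "chart_transition g c c' S \<psi> \<kappa>" and y: "y \<in> S"
  shows "fderiv \<kappa> (\<psi> y) (fderiv \<psi> y v) = v" "fderiv \<psi> y (fderiv \<kappa> (\<psi> y) v) = v"
proof -
  note T' = chart_transitionD[OF T]
  have "fderiv (\<lambda>x. \<kappa> (\<psi> x)) y = fderiv (\<lambda>x. x) y"
    by (rule fderiv_cong(1)[OF T'(1) y, symmetric]) (use T'(7) in auto)
  then show "fderiv \<kappa> (\<psi> y) (fderiv \<psi> y v) = v"
    using fderiv_compose[OF T'(3,6) y] y by simp
  have "fderiv (\<lambda>x. \<psi> (\<kappa> x)) (\<psi> y) = fderiv (\<lambda>x. x) (\<psi> y)"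
    by (rule fderiv_cong(1)[OF T'(4), symmetric]) (use T'(7) y in auto)
  then show "fderiv \<psi> y (fderiv \<kappa> (\<psi> y) v) = v"
    using fderiv_compose[OF T'(6,3), of "\<psi> y"] y T'(7)[OF y] by simp
qed

lemma chart_transition_sym:
  assumes T: "chart_transition g c c' S \<psi> \<kappa>"
  shows "chart_transition g c' c (\<psi> ` S) \<kappa> \<psi>"
proof -
  note T' = chart_transitionD[OF T]
  have img: "\<kappa> ` \<psi> ` S = S" using T'(7) by force
  have "isometric_on (\<psi> ` S) (g c') (g c) \<kappa>"
    unfolding isometric_on_def
  proof (intro ballI allI)
    fix z v w assume "z \<in> \<psi> ` S"
    then obtain y where y: "y \<in> S" "z = \<psi> y" by blast
    have "g c' (\<psi> y) (fderiv \<psi> y (fderiv \<kappa> z v)) (fderiv \<psi> y (fderiv \<kappa> z w)) = g c y (fderiv \<kappa> z v) (fderiv \<kappa> z w)"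
      using T'(9) y(1) by (simp add: isometric_on_def)
    then show "g c (\<kappa> z) (fderiv \<kappa> z v) (fderiv \<kappa> z w) = g c' z v w"
      using chart_transition_fderiv_inverse(2)[OF T y(1)] T'(7)[OF y(1)] y(2) by simp
  qed
  then show ?thesis unfolding chart_transition_def using T' by (auto simp: img)
qed

lemma chart_transition_compose:
  assumes T1: "chart_transition g c c' S \<psi> \<kappa>" and T2: "chart_transition g c' c'' S' \<psi>' \<kappa>'"
  shows "chart_transition g c c'' (S \<inter> \<psi> -` S') (\<lambda>y. \<psi>' (\<psi> y)) (\<lambda>y. \<kappa> (\<kappa>' y))"
proof -
  note T1' = chart_transitionD[OF T1] and T2' = chart_transitionD[OF T2]
  let ?S = "S \<inter> \<psi> -` S'"
  have op: "open ?S"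
    by (rule continuous_open_preimage[OF smooth_on_continuous[OF T1'(3)] T1'(1) T2'(1)])
  have img: "(\<lambda>y. \<psi>' (\<psi> y)) ` ?S = \<psi>' ` S' \<inter> \<kappa>' -` (\<psi> ` S)"
    using T2'(7) by force
  have op': "open ((\<lambda>y. \<psi>' (\<psi> y)) ` ?S)"
    unfolding img by (rule continuous_open_preimage[OF smooth_on_continuous[OF T2'(6)] T2'(4) T1'(4)])
  have "smooth_on ?S (\<lambda>y. \<psi>' (\<psi> y))"
    by (rule smooth_on_compose[OF op T2'(1) _ smooth_on_subset[OF T1'(3)] T2'(3)]) auto
  moreover have "smooth_on ((\<lambda>y. \<psi>' (\<psi> y)) ` ?S) (\<lambda>y. \<kappa> (\<kappa>' y))"
    by (rule smooth_on_compose[OF op' T1'(4) _ smooth_on_subset[OF T2'(6)] T1'(6)]) (auto simp: img)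
  moreover have "isometric_on ?S (g c) (g c'') (\<lambda>y. \<psi>' (\<psi> y))"
    using T1'(9) T2'(9) by (auto simp: isometric_on_def fderiv_compose[OF T1'(3) T2'(3)])
  ultimately show ?thesis
    unfolding chart_transition_def using op op' T1' T2' by auto
qed

lemma chart_transition_id:
  assumes "open (odom c)" shows "chart_transition g c c (odom c) (\<lambda>y. y) (\<lambda>y. y)"
  using assms by (auto simp: chart_transition_def isometric_on_def)

lemma orbifold_chartD: "riemannian_orbifold X A g \<Longrightarrow> c \<in> A \<Longrightarrow> orbifold_chart X c"
  and orbifold_open_odom: "riemannian_orbifold X A g \<Longrightarrow> c \<in> A \<Longrightarrow> open (odom c)"
  and orbifold_metricD: "riemannian_orbifold X A g \<Longrightarrow> c \<in> A \<Longrightarrow> riemannian_metric_on (odom c) (g c)"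
  by (auto simp: riemannian_orbifold_def orbifold_def orbifold_atlas_def orbifold_metric_def orbifold_chart_def)

text \<open>Smoothness of the inverse comes from the injective differential in equal dimensions, the
  isometry from compatibility of the metrics along embeddings.\<close>

lemma chart_embedding_transition:
  assumes X: "riemannian_orbifold X A g" and c: "c \<in> A" "c' \<in> A" and l: "chart_embedding c c' l"
  shows "\<exists>k. chart_transition g c c' (odom c) l k"
proof -
  have emb: "smooth_on (odom c) l" "\<And>x. x \<in> odom c \<Longrightarrow> inj (fderiv l x)"
    "l ` odom c \<subseteq> odom c'" "\<And>u. u \<in> odom c \<Longrightarrow> omap c' (l u) = omap c u"
    using l by (auto simp: chart_embedding_def smooth_embedding_on_def)
  obtain k where "\<forall>x\<in>odom c. k (l x) = x"
    using l by (auto simp: chart_embedding_def smooth_embedding_on_def homeomorphism_def)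
  then have k: "\<And>x. x \<in> odom c \<Longrightarrow> k (l x) = x" by blast
  have "isometric_on (odom c) (g c) (g c') l"
    using X c l by (simp add: riemannian_orbifold_def orbifold_metric_def isometric_on_def)
  then show ?thesis
    unfolding chart_transition_def
    using smooth_on_inverse[OF orbifold_open_odom[OF X c(1)] emb(1,2) k] orbifold_open_odom[OF X c(1)] emb k
    by blast
qed

lemma group_elem_transition:
  assumes X: "riemannian_orbifold X A g" and c: "c \<in> A" and \<gamma>: "\<gamma> \<in> ogrp c"
  shows "\<exists>\<delta>. chart_transition g c c (odom c) \<gamma> \<delta>"
proof -
  note E = chart_group_elem[OF orbifold_chartD[OF X c]]
  obtain \<delta> where \<delta>: "\<delta> \<in> ogrp c" "\<forall>u\<in>odom c. \<delta> (\<gamma> u) = u \<and> \<gamma> (\<delta> u) = u" using E(6)[OF \<gamma>] by blast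
  have "isometric_on (odom c) (g c) (g c) \<gamma>"
    using X c \<gamma> by (simp add: riemannian_orbifold_def orbifold_metric_def isometric_on_def)
  then have "chart_transition g c c (odom c) \<gamma> \<delta>"
    unfolding chart_transition_def using orbifold_open_odom[OF X c] E[OF \<gamma>] E(4)[OF \<delta>(1)] \<delta>(2) by auto
  then show ?thesis by blast
qed

text \<open>The atlas supplies a third chart embedded in both, but the embeddings need not hit
  \<open>u\<close> and \<open>u'\<close>; group elements of the two charts correct this.\<close>

lemma chart_transition_between:
  assumes X: "riemannian_orbifold X A g" and c: "c \<in> A" "c' \<in> A"
    and u: "u \<in> odom c" "u' \<in> odom c'" "omap c u = omap c' u'"
  shows "\<exists>S \<psi> \<kappa>. chart_transition g c c' S \<psi> \<kappa> \<and> u \<in> S \<and> \<psi> u = u'"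
proof -
  have "omap c u \<in> omap c ` odom c \<inter> omap c' ` odom c'" using u by (metis IntI imageI)
  then obtain d l l' where d: "d \<in> A" "omap c u \<in> omap d ` odom d"
    and l: "chart_embedding d c l" "chart_embedding d c' l'"
    using X c unfolding riemannian_orbifold_def orbifold_def orbifold_atlas_def by meson
  obtain w where w: "w \<in> odom d" "omap d w = omap c u" using d(2) by auto
  obtain k k' where k: "chart_transition g d c (odom d) l k" "chart_transition g d c' (odom d) l' k'"
    using chart_embedding_transition[OF X d(1) c(1) l(1)] chart_embedding_transition[OF X d(1) c(2) l(2)] by blast
  have *: "\<exists>S \<psi> \<kappa>. chart_transition g d b S \<psi> \<kappa> \<and> w \<in> S \<and> \<psi> w = v"
    if T: "chart_transition g d b (odom d) m m'" and b: "b \<in> A" and v: "v \<in> odom b" "omap b v = omap d w" for b m m' v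
  proof -
    have mw: "m w \<in> odom b" "omap b (m w) = omap b v"
      using chart_transitionD(5,8)[OF T] w(1) v by auto
    then obtain \<gamma> where \<gamma>: "\<gamma> \<in> ogrp b" "v = \<gamma> (m w)"
      using orbifold_chart_orbit[OF orbifold_chartD[OF X b] mw(1) v(1)] by blast
    obtain \<delta> where "chart_transition g b b (odom b) \<gamma> \<delta>" using group_elem_transition[OF X b \<gamma>(1)] by blast
    from chart_transition_compose[OF T this] show ?thesis using mw(1) w(1) \<gamma>(2) by blast
  qed
  obtain S \<psi> \<kappa> S' \<psi>' \<kappa>' where T: "chart_transition g d c S \<psi> \<kappa>" "w \<in> S" "\<psi> w = u"
    and T': "chart_transition g d c' S' \<psi>' \<kappa>'" "w \<in> S'" "\<psi>' w = u'"
    using *[OF k(1) c(1) u(1)] *[OF k(2) c(2) u(2)] w(2) u(3) by fastforce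
  have "u \<in> \<psi> ` S \<inter> \<kappa> -` S'" "\<psi>' (\<kappa> u) = u'"
    using T T' chart_transitionD(7)[OF T(1) T(2)] by auto
  then show ?thesis using chart_transition_compose[OF chart_transition_sym[OF T(1)] T'(1)] by blast
qed

section \<open>Gluing of frames\<close>

lemma compose_fderiv:
  fixes \<gamma> \<delta> :: "'e::euclidean_space \<Rightarrow> 'e"
  assumes "open S" "\<gamma> ` S \<subseteq> S" "smooth_on S \<gamma>" "smooth_on S \<delta>" "u \<in> S"
  shows "fderiv (compose S \<delta> \<gamma>) u v = fderiv \<delta> (\<gamma> u) (fderiv \<gamma> u v)"
proof -
  have \<gamma>u: "\<gamma> u \<in> S" using assms(2,5) by blast
  have "(\<lambda>x. \<delta> (\<gamma> x)) differentiable at u"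
    by (rule smooth_on_differentiable[OF smooth_on_compose[OF assms(1,1,2,3,4)] assms(5)])
  from fderiv_cong(1)[OF assms(1,5) _ this, of "compose S \<delta> \<gamma>"]
  have "fderiv (compose S \<delta> \<gamma>) u = fderiv (\<lambda>x. \<delta> (\<gamma> x)) u" by (simp add: compose_def)
  then show ?thesis using fderiv_compose[OF assms(3,4,5) \<gamma>u] by simp
qed

lemma locally_injective:
  fixes F :: "'a::euclidean_space \<Rightarrow> 'b::euclidean_space"
  assumes "open S" "a \<in> S" and F: "smooth_on S F" and L: "bounded_linear L" "\<And>v. L (fderiv F a v) = v"
  obtains r where "0 < r" "ball a r \<subseteq> S" "inj_on F (ball a r)"
proof (rule has_derivative_locally_injective[OF assms(2,1) L(1)])
  show "L \<circ> fderiv F a = id" by (simp add: fun_eq_iff L(2))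
  show "(F has_derivative fderiv F x) (at x)" if "x \<in> S" for x
    by (rule smooth_on_has_derivative[OF F that])
  fix e :: real assume "0 < e"
  \<comment> \<open>A sum over the basis that dominates the operator norm of the change of the
    differential; it is visibly continuous and zero at \<open>a\<close>.\<close>
  define N where "N x = (\<Sum>b\<in>Basis. norm (fderiv F x b - fderiv F a b))" for x
  have "continuous_on S N"
    unfolding N_def by (intro continuous_intros smooth_on_continuous smooth_on_fderiv_const F)
  then obtain r where r: "0 < r" "ball a r \<subseteq> S" "\<And>y. y \<in> ball a r \<Longrightarrow> dist (N y) (N a) < e"
    using continuous_on_dist_bound[OF assms(1,2) _ \<open>0 < e\<close>] by blast
  have "onorm (\<lambda>v. fderiv F x v - fderiv F a v) < e" if "dist a x < r" for x
  proof -
    have "x \<in> S" using r(2) that by auto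
    then have "bounded_linear (\<lambda>v. fderiv F x v - fderiv F a v)"
      by (intro bounded_linear_sub has_derivative_bounded_linear[OF smooth_on_has_derivative[OF F]] assms(2))
    from onorm_componentwise[OF this] have "onorm (\<lambda>v. fderiv F x v - fderiv F a v) \<le> N x" by (simp add: N_def)
    also have "N x < e" using r(3)[of x] that by (simp add: N_def dist_real_def)
    finally show ?thesis .
  qed
  then show "\<exists>d>0. \<forall>x. dist a x < d \<longrightarrow> onorm (\<lambda>v. fderiv F x v - fderiv F a v) < e"
    using r(1) by blast
qed (rule that)

text \<open>
  The sum of the group elements with the same 1-jet at the fixed point is locally injective and
  invariant under composition with each of them.
\<close>

lemma chart_group_rigid:
  fixes c :: "('e::euclidean_space, 'x) orb_chart"
  assumes c: "orbifold_chart X c" and \<gamma>: "\<gamma> \<in> ogrp c" and u: "u \<in> odom c"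
    and fixed: "\<gamma> u = u" "\<And>v. fderiv \<gamma> u v = v"
  shows "\<exists>S. open S \<and> u \<in> S \<and> S \<subseteq> odom c \<and> (\<forall>y\<in>S. \<gamma> y = y)"
proof -
  define H where "H = {\<delta> \<in> ogrp c. \<delta> u = u \<and> (\<forall>v. fderiv \<delta> u v = v)}"
  note E = chart_group_elem[OF c]
  have op: "open (odom c)" and fin: "finite H" using c by (auto simp: orbifold_chart_def H_def)
  have "\<gamma> \<in> H" using \<gamma> fixed by (simp add: H_def)
  then have card: "card H > 0" using fin card_gt_0_iff by blast
  have \<gamma>S: "\<gamma> ` odom c \<subseteq> odom c" using E(1)[OF \<gamma>] by simp
  have comp: "compose (odom c) \<delta> \<gamma> \<in> H" if "\<delta> \<in> H" for \<delta>
    using that \<gamma> u fixed E(7)[of \<delta> \<gamma>] E(4) compose_fderiv[OF op \<gamma>S E(4)[OF \<gamma>] E(4) u, of \<delta>]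
    by (simp add: H_def compose_def)
  have inj: "inj_on (\<lambda>\<delta>. compose (odom c) \<delta> \<gamma>) H"
  proof (rule inj_onI)
    fix \<delta> \<delta>' assume \<delta>: "\<delta> \<in> H" "\<delta>' \<in> H" and eq: "compose (odom c) \<delta> \<gamma> = compose (odom c) \<delta>' \<gamma>"
    show "\<delta> = \<delta>'"
    proof (rule extensionalityI)
      show "\<delta> \<in> extensional (odom c)" "\<delta>' \<in> extensional (odom c)" using \<delta> E(3) by (auto simp: H_def)
      fix y assume "y \<in> odom c"
      then obtain z where "z \<in> odom c" "y = \<gamma> z" using E(1)[OF \<gamma>] by blast
      then show "\<delta> y = \<delta>' y" using fun_cong[OF eq, of z] by (simp add: compose_def)
    qed
  qed
  \<comment> \<open>Right translation by \<open>\<gamma>\<close> is an injection of a finite set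
    into itself, hence a permutation; this makes the sum invariant.\<close>
  have "(\<lambda>\<delta>. compose (odom c) \<delta> \<gamma>) ` H = H"
    by (rule card_subset_eq[OF fin]) (use comp card_image[OF inj] in auto)
  then have bij: "bij_betw (\<lambda>\<delta>. compose (odom c) \<delta> \<gamma>) H H" using inj by (simp add: bij_betw_def)
  define \<phi> where "\<phi> y = (\<Sum>\<delta>\<in>H. \<delta> y)" for y
  have inv: "\<phi> (\<gamma> y) = \<phi> y" if "y \<in> odom c" for y
    using sum.reindex_bij_betw[OF bij, of "\<lambda>\<delta>. \<delta> y"] that by (simp add: \<phi>_def compose_def)
  have sm: "smooth_on (odom c) \<phi>"
    unfolding \<phi>_def using E(4) by (intro smooth_on_sum op) (simp add: H_def)
  have "(\<phi> has_derivative (\<lambda>v. \<Sum>\<delta>\<in>H. fderiv \<delta> u v)) (at u)"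
    unfolding \<phi>_def using E(4) by (intro has_derivative_sum smooth_on_has_derivative[OF _ u]) (simp add: H_def)
  \<comment> \<open>Each summand has the identity as differential at \<open>u\<close>, so dividing
    by \<open>card H\<close> gives a left inverse of the differential.\<close>
  from fderiv_eq[OF this] have "fderiv \<phi> u v = real (card H) *\<^sub>R v" for v
    by (simp add: H_def sum_constant_scaleR)
  then have "(1 / real (card H)) *\<^sub>R fderiv \<phi> u v = v" for v using card by simp
  then obtain r where r: "0 < r" "ball u r \<subseteq> odom c" "inj_on \<phi> (ball u r)"
    using locally_injective[OF op u sm bounded_linear_scaleR_right] by metis
  \<comment> \<open>Injectivity on the ball compares \<open>y\<close> with \<open>\<gamma> y\<close>
    only if both lie in it.\<close>
  let ?S = "ball u r \<inter> \<gamma> -` ball u r"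
  have "open ?S"
    by (rule continuous_open_preimage[OF continuous_on_subset[OF smooth_on_continuous[OF E(4)[OF \<gamma>]] r(2)]]) auto
  moreover have "\<gamma> y = y" if "y \<in> ?S" for y
    using inj_onD[OF r(3) inv] that r(2) by auto
  ultimately show ?thesis using r fixed(1) by (intro exI[of _ ?S]) auto
qed

section \<open>Frames and their gluing\<close>

lemma open_invertible: "open (Collect invertible :: (real^'n^'n) set)"
proof -
  have "continuous_on UNIV (\<lambda>P::real^'n^'n. det P)"
    unfolding det_def by (intro continuous_intros)
  then have "open {P::real^'n^'n. det P \<noteq> 0}"
    using open_disagreement[of UNIV det "\<lambda>_. 0"] by simp
  moreover have "Collect invertible = {P::real^'n^'n. det P \<noteq> 0}" by (auto simp: invertible_det_nz)
  ultimately show ?thesis by simp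
qed

lemma chart_frames_Times: "chart_frames c = odom c \<times> Collect invertible"
  by (auto simp: chart_frames_def)

lemma open_chart_frames:
  fixes c :: "(real^'n, 'x) orb_chart"
  assumes "open (odom c)" shows "open (chart_frames c)"
  unfolding chart_frames_Times by (intro open_Times assms open_invertible)

text \<open>The gluing is generated by zigzags of chart embeddings. What survives of a zigzag is one
  partial isometry near the base points whose differential carries the columns of one frame to those
  of the other.\<close>

definition frames_related ::
  "((real^'n, 'x) orb_chart \<Rightarrow> (real^'n) metric) \<Rightarrow> (real^'n, 'x) orb_chart \<times> 'n frame_coords \<Rightarrow>
    (real^'n, 'x) orb_chart \<times> 'n frame_coords \<Rightarrow> bool" where
  "frames_related g = (\<lambda>(c, u, P) (c', u', P'). \<exists>S \<psi> \<kappa>. chart_transition g c c' S \<psi> \<kappa> \<and> u \<in> S \<and>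
     \<psi> u = u' \<and> (\<forall>w. P' *v w = fderiv \<psi> u (P *v w)))"

lemma frames_related_sym: "frames_related g a b \<Longrightarrow> frames_related g b a"
proof -
  assume ab: "frames_related g a b"
  obtain c u P c' u' P' where [simp]: "a = (c, u, P)" "b = (c', u', P')" by (metis surj_pair)
  from ab obtain S \<psi> \<kappa> where T: "chart_transition g c c' S \<psi> \<kappa>" "u \<in> S" "\<psi> u = u'"
    "\<forall>w. P' *v w = fderiv \<psi> u (P *v w)" by (auto simp: frames_related_def)
  have "\<forall>w. P *v w = fderiv \<kappa> u' (P' *v w)"
    using chart_transition_fderiv_inverse(1)[OF T(1,2)] T(3,4) by simp
  moreover have "u' \<in> \<psi> ` S" "\<kappa> u' = u" using chart_transitionD(7)[OF T(1,2)] T(2,3) by blast+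
  ultimately have "chart_transition g c' c (\<psi> ` S) \<kappa> \<psi> \<and> u' \<in> \<psi> ` S \<and> \<kappa> u' = u \<and>
      (\<forall>w. P *v w = fderiv \<kappa> u' (P' *v w))"
    using chart_transition_sym[OF T(1)] by simp
  then show ?thesis by (auto simp: frames_related_def)
qed

lemma frames_related_trans:
  assumes "frames_related g a b" "frames_related g b d" shows "frames_related g a d"
proof -
  obtain c u P c' u' P' c'' u'' P'' where [simp]: "a = (c, u, P)" "b = (c', u', P')" "d = (c'', u'', P'')"
    by (metis surj_pair)
  from assms obtain S \<psi> \<kappa> S' \<psi>' \<kappa>' where T: "chart_transition g c c' S \<psi> \<kappa>" "u \<in> S" "\<psi> u = u'"
    "\<forall>w. P' *v w = fderiv \<psi> u (P *v w)"
    and T': "chart_transition g c' c'' S' \<psi>' \<kappa>'" "u' \<in> S'" "\<psi>' u' = u''"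
    "\<forall>w. P'' *v w = fderiv \<psi>' u' (P' *v w)" by (auto simp: frames_related_def)
  have "\<forall>w. P'' *v w = fderiv (\<lambda>y. \<psi>' (\<psi> y)) u (P *v w)"
    using fderiv_compose[OF chart_transitionD(3)[OF T(1)] chart_transitionD(3)[OF T'(1)] T(2)] T T' by simp
  then have "chart_transition g c c'' (S \<inter> \<psi> -` S') (\<lambda>y. \<psi>' (\<psi> y)) (\<lambda>y. \<kappa> (\<kappa>' y)) \<and>
      u \<in> S \<inter> \<psi> -` S' \<and> \<psi>' (\<psi> u) = u'' \<and> (\<forall>w. P'' *v w = fderiv (\<lambda>y. \<psi>' (\<psi> y)) u (P *v w))"
    using chart_transition_compose[OF T(1) T'(1)] T T' by simp
  then show ?thesis unfolding frames_related_def by (simp only: \<open>a = _\<close> \<open>d = _\<close> prod.case) blast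
qed

lemma matrix_linear_works: "linear f \<Longrightarrow> matrix f *v x = f x" for f :: "real^'a \<Rightarrow> real^'b"
  by (rule matrix_works) (simp add: linear_matrix_vector_mul_eq)

text \<open>Transitions are closed under inversion and composition, so an arbitrary zigzag collapses
  to one of them.\<close>

lemma frame_equiv_related:
  assumes X: "riemannian_orbifold X A g" and eq: "(a, b) \<in> frame_equiv A"
  shows "frames_related g a b"
proof -
  have "a \<in> Sigma A chart_frames" "(a, b) \<in> (frame_gluing A \<union> (frame_gluing A)\<inverse>)\<^sup>*"
    using eq by (auto simp: frame_equiv_def)
  from this(2) show ?thesis
  proof (induction rule: rtrancl_induct)
    case base
    obtain c u P where a: "a = (c, u, P)" by (metis surj_pair)
    then have "c \<in> A" "u \<in> odom c" using \<open>a \<in> Sigma A chart_frames\<close> by (auto simp: chart_frames_def)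
    then have "chart_transition g c c (odom c) (\<lambda>y. y) (\<lambda>y. y) \<and> u \<in> odom c \<and> u = u \<and>
        (\<forall>w. P *v w = fderiv (\<lambda>y. y) u (P *v w))"
      using chart_transition_id[OF orbifold_open_odom[OF X]] by simp
    then show ?case unfolding frames_related_def a prod.case by blast
  next
    case (step b d)
    have glue: "frames_related g p q" if pq: "(p, q) \<in> frame_gluing A" for p q
    proof -
      obtain c c' l u P where p: "p = (c, u, P)" and q: "q = (c', l u, matrix (fderiv l u) ** P)"
        and c: "c \<in> A" "c' \<in> A" and l: "chart_embedding c c' l" and u: "u \<in> odom c"
        using pq by (auto simp: frame_gluing_def chart_frames_def)
      obtain k where k: "chart_transition g c c' (odom c) l k"
        using chart_embedding_transition[OF X c l] by blast
      have "(matrix (fderiv l u) ** P) *v w = fderiv l u (P *v w)" for w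
        using matrix_linear_works[OF smooth_on_linear_fderiv[OF chart_transitionD(3)[OF k] u]]
        by (simp add: matrix_vector_mul_assoc[symmetric])
      then show ?thesis using k u unfolding frames_related_def p q prod.case by blast
    qed
    have "frames_related g b d"
      using step.hyps(2) glue frames_related_sym by blast
    then show ?case using step.IH frames_related_trans by blast
  qed
qed

lemma frame_class_self: "c \<in> A \<Longrightarrow> p \<in> chart_frames c \<Longrightarrow> (c, p) \<in> frame_class A c p"
  by (auto simp: frame_class_def frame_equiv_def)

lemma frame_class_in_linear_frames:
  "c \<in> A \<Longrightarrow> p \<in> chart_frames c \<Longrightarrow> frame_class A c p \<in> linear_frames A"
  unfolding linear_frames_def frame_class_def by (rule quotientI) auto

lemma frame_proj_class:
  assumes X: "riemannian_orbifold X A g" and c: "c \<in> A" "(u, P) \<in> chart_frames c"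
  shows "frame_proj (frame_class A c (u, P)) = omap c u"
  unfolding frame_proj_def
proof (rule the_equality)
  show "\<forall>(c', u', P') \<in> frame_class A c (u, P). omap c' u' = omap c u"
  proof (safe)
    fix c' u' P' assume "(c', u', P') \<in> frame_class A c (u, P)"
    then have "frames_related g (c, u, P) (c', u', P')"
      using frame_equiv_related[OF X] by (auto simp: frame_class_def)
    then show "omap c' u' = omap c u" using chart_transitionD(8) by (fastforce simp: frames_related_def)
  qed
  show "x = omap c u" if "\<forall>(c', u', P') \<in> frame_class A c (u, P). omap c' u' = x" for x
    using bspec[OF that frame_class_self[OF c]] by simp
qed

text \<open>The transition between the two frames is only known to be a group element on an open set
  accumulating at \<open>u\<close>. Values and differentials are continuous, so its 1-jet at
  \<open>u\<close> is still that of this group element.\<close>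

lemma frame_class_eq_group:
  assumes X: "riemannian_orbifold X A g" and c: "c \<in> A" "(u, P) \<in> chart_frames c" "(u', P') \<in> chart_frames c"
    and eq: "frame_class A c (u, P) = frame_class A c (u', P')"
  shows "\<exists>\<gamma>\<in>ogrp c. u' = \<gamma> u \<and> P' = matrix (fderiv \<gamma> u) ** P"
proof -
  note oc = orbifold_chartD[OF X c(1)]
  have "frames_related g (c, u, P) (c, u', P')"
  proof (rule frame_equiv_related[OF X])
    have "(c, u', P') \<in> frame_class A c (u, P)" using frame_class_self[OF c(1,3)] eq by simp
    then show "((c, u, P), (c, u', P')) \<in> frame_equiv A" by (simp add: frame_class_def)
  qed
  then obtain S \<psi> \<kappa> where T: "chart_transition g c c S \<psi> \<kappa>" "u \<in> S" "\<psi> u = u'"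
    "\<forall>w. P' *v w = fderiv \<psi> u (P *v w)" by (auto simp: frames_related_def)
  note T' = chart_transitionD[OF T(1)]
  obtain \<gamma> where \<gamma>: "\<gamma> \<in> ogrp c" "u \<in> closure (interior {y \<in> S. \<psi> y = \<gamma> y})"
    using lifts_differ_by_group[OF oc T'(1) T(2) smooth_on_continuous[OF T'(3)] T'(5), of "\<lambda>y. y"] T'(2,8)
    by auto
  note sm = smooth_on_subset[OF chart_group_elem(4)[OF oc \<gamma>(1)] T'(2)]
  have E: "\<psi> y = \<gamma> y" "fderiv \<psi> y = fderiv \<gamma> y" if "y \<in> interior {y \<in> S. \<psi> y = \<gamma> y}" for y
  proof -
    have "y \<in> {y \<in> S. \<psi> y = \<gamma> y}" using that interior_subset by blast
    then show "\<psi> y = \<gamma> y" by simp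
    show "fderiv \<psi> y = fderiv \<gamma> y"
    proof (rule fderiv_cong(1)[OF open_interior that])
      show "\<psi> z = \<gamma> z" if "z \<in> interior {y \<in> S. \<psi> y = \<gamma> y}" for z
        using that interior_subset[of "{y \<in> S. \<psi> y = \<gamma> y}"] by blast
      show "\<psi> differentiable at y"
        using smooth_on_differentiable[OF T'(3)] \<open>y \<in> {y \<in> S. \<psi> y = \<gamma> y}\<close> by simp
    qed
  qed
  have "\<psi> u = \<gamma> u"
    by (rule agree_on_closure[OF T'(1) smooth_on_continuous[OF T'(3)] smooth_on_continuous[OF sm] T(2) \<gamma>(2) E(1)])
  moreover have D: "fderiv \<psi> u v = fderiv \<gamma> u v" for v
    by (rule agree_on_closure[where F = "\<lambda>y. fderiv \<psi> y v" and G = "\<lambda>y. fderiv \<gamma> y v", OF T'(1)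
          smooth_on_continuous[OF smooth_on_fderiv_const[OF T'(3)]]
          smooth_on_continuous[OF smooth_on_fderiv_const[OF sm]] T(2) \<gamma>(2)])
       (simp add: E(2))
  moreover have "P' = matrix (fderiv \<gamma> u) ** P"
    unfolding matrix_eq matrix_vector_mul_assoc[symmetric]
      matrix_linear_works[OF smooth_on_linear_fderiv[OF sm T(2)]] using T(4) D by simp
  ultimately show ?thesis using \<gamma>(1) T(3) by auto
qed

text \<open>Only finitely many group elements can identify frames near \<open>p\<close>. One that
  moves \<open>p\<close> is handled by the Hausdorff property; one that fixes \<open>p\<close> has
  trivial 1-jet at the base point, because a frame spans, and is the identity nearby by
  rigidity.\<close>

lemma frame_class_locally_injective:
  fixes c :: "(real^'n, 'x) orb_chart"
  assumes X: "riemannian_orbifold X A g" and c: "c \<in> A" and p: "p \<in> chart_frames c"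
  shows "\<exists>V. open V \<and> p \<in> V \<and> V \<subseteq> chart_frames c \<and> inj_on (frame_class A c) V"
proof -
  note oc = orbifold_chartD[OF X c]
  note op = open_chart_frames[OF orbifold_open_odom[OF X c]]
  have fin: "finite (ogrp c)" using oc by (simp add: orbifold_chart_def)
  define act where "act \<gamma> q = (\<gamma> (fst q), matrix (fderiv \<gamma> (fst q)) ** snd q)" 
    for \<gamma> :: "real^'n \<Rightarrow> real^'n" and q :: "'n frame_coords"
  have "\<exists>V. open V \<and> p \<in> V \<and> V \<subseteq> chart_frames c \<and> (\<forall>q\<in>V. act \<gamma> q \<in> V \<longrightarrow> act \<gamma> q = q)" if \<gamma>: "\<gamma> \<in> ogrp c" for \<gamma>
  proof (cases "act \<gamma> p = p")
    case True
    obtain u P where uP: "p = (u, P)" "u \<in> odom c" "invertible P" using p by (auto simp: chart_frames_def)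
    note lin = smooth_on_linear_fderiv[OF chart_group_elem(4)[OF oc \<gamma>] uP(2)]
    have fixed: "\<gamma> u = u" "matrix (fderiv \<gamma> u) ** P = P" using True by (auto simp: act_def uP)
    have "fderiv \<gamma> u v = v" for v
    proof -
      obtain P' where "P ** P' = mat 1" using uP(3) by (auto simp: invertible_def)
      then have v: "P *v (P' *v v) = v" by (simp add: matrix_vector_mul_assoc)
      have "fderiv \<gamma> u (P *v (P' *v v)) = (matrix (fderiv \<gamma> u) ** P) *v (P' *v v)"
        by (simp only: matrix_linear_works[OF lin] matrix_vector_mul_assoc[symmetric])
      then show ?thesis by (simp only: fixed(2) v)
    qed
    from chart_group_rigid[OF oc \<gamma> uP(2) fixed(1) this]
    obtain S where S: "open S" "u \<in> S" "S \<subseteq> odom c" "\<forall>y\<in>S. \<gamma> y = y" by blast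
    have "act \<gamma> q = q" if "fst q \<in> S" for q
    proof -
      have "fderiv (\<lambda>y. y) (fst q) = fderiv \<gamma> (fst q)"
        by (rule fderiv_cong(1)[OF S(1) that]) (use S(4) in auto)
      then have "fderiv \<gamma> (fst q) = id" by (simp add: id_def)
      then have "matrix (fderiv \<gamma> (fst q)) = mat 1" by (simp only: matrix_id_mat_1)
      then show ?thesis using S(4) that by (simp add: act_def)
    qed
    moreover have "open (chart_frames c \<inter> (S \<times> UNIV))" by (intro open_Int open_Times op S(1)) auto
    ultimately show ?thesis using S(2) p uP(1) by (intro exI[of _ "chart_frames c \<inter> (S \<times> UNIV)"]) auto
  next
    case False
    have cont: "continuous_on (chart_frames c) (\<lambda>q. fderiv \<gamma> (fst q) v)" for v
      by (rule continuous_on_compose2[OF smooth_on_continuous[OF smooth_on_fderiv_const[OF chart_group_elem(4)[OF oc \<gamma>]]]])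
         (auto simp: chart_frames_def intro: continuous_intros)
    have cont1: "continuous_on (chart_frames c) (\<lambda>q. \<gamma> (fst q))"
      by (rule continuous_on_compose2[OF smooth_on_continuous[OF chart_group_elem(4)[OF oc \<gamma>]]])
         (auto simp: chart_frames_def intro: continuous_intros)
    have "continuous_on (chart_frames c) (act \<gamma>)"
      unfolding act_def matrix_def matrix_matrix_mult_def
      by (intro continuous_on_Pair cont1 continuous_on_vec_lambda)
         (simp, intro continuous_on_sum continuous_on_mult continuous_on_component cont continuous_on_snd continuous_on_id)
    obtain V W where VW: "open V" "open W" "act \<gamma> p \<in> V" "p \<in> W" "V \<inter> W = {}"
      using hausdorff[OF False] by blast
    have "open (chart_frames c \<inter> act \<gamma> -` V)"
      by (rule continuous_open_preimage[OF \<open>continuous_on (chart_frames c) (act \<gamma>)\<close> op VW(1)])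
    then show ?thesis
      using VW p by (intro exI[of _ "(chart_frames c \<inter> act \<gamma> -` V) \<inter> W"]) auto
  qed
  then have "\<forall>\<gamma>\<in>ogrp c. \<exists>V. open V \<and> p \<in> V \<and> V \<subseteq> chart_frames c \<and> (\<forall>q\<in>V. act \<gamma> q \<in> V \<longrightarrow> act \<gamma> q = q)"
    by blast
  from bchoice[OF this] obtain V where "\<forall>\<gamma>\<in>ogrp c. open (V \<gamma>) \<and> p \<in> V \<gamma> \<and> V \<gamma> \<subseteq> chart_frames c \<and>
      (\<forall>q\<in>V \<gamma>. act \<gamma> q \<in> V \<gamma> \<longrightarrow> act \<gamma> q = q)" by (rule exE)
  then have V: "open (V \<gamma>)" "p \<in> V \<gamma>" "\<And>q. q \<in> V \<gamma> \<Longrightarrow> act \<gamma> q \<in> V \<gamma> \<Longrightarrow> act \<gamma> q = q" if "\<gamma> \<in> ogrp c" for \<gamma>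
    using that by blast+
  \<comment> \<open>The separation property passes to smaller sets, so a finite intersection serves
    all group elements.\<close>
  let ?V = "chart_frames c \<inter> (\<Inter>\<gamma>\<in>ogrp c. V \<gamma>)"
  have "inj_on (frame_class A c) ?V"
  proof (rule inj_onI)
    fix q q' assume q: "q \<in> ?V" "q' \<in> ?V" and eq: "frame_class A c q = frame_class A c q'"
    have "(fst q, snd q) \<in> chart_frames c" "(fst q', snd q') \<in> chart_frames c" using q by simp_all
    from frame_class_eq_group[OF X c this] eq
    obtain \<gamma> where \<gamma>: "\<gamma> \<in> ogrp c" "fst q' = \<gamma> (fst q)" "snd q' = matrix (fderiv \<gamma> (fst q)) ** snd q"
      by auto
    then have "q' = act \<gamma> q" by (simp add: act_def prod_eq_iff)
    then show "q = q'" using V(3)[OF \<gamma>(1), of q] q \<gamma>(1) by auto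
  qed
  moreover have "open ?V" using V(1) by (intro open_Int open_INT op fin) simp
  ultimately show ?thesis using p V(2) by (intro exI[of _ ?V]) simp
qed

section \<open>Geometry of the frame bundle\<close>

lemma smooth_on_vec_nth:
  fixes f :: "'p::real_normed_vector \<Rightarrow> 'b::euclidean_space^'n"
  shows "open S \<Longrightarrow> smooth_on S f \<Longrightarrow> smooth_on S (\<lambda>x. f x $ i)"
  by (rule smooth_on_compose[OF _ open_UNIV]) (auto intro: smooth_on_linear bounded_linear_vec_nth)

lemma smooth_on_vecI:
  fixes f :: "'p::real_normed_vector \<Rightarrow> 'b::euclidean_space^'n"
  assumes "open S" "\<And>i. smooth_on S (\<lambda>x. f x $ i)"
  shows "smooth_on S f"
proof (rule smooth_on_cong[OF assms(1)])
  have "smooth_on S (\<lambda>x. f x \<bullet> b)" if b: "b \<in> Basis" for b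
  proof -
    obtain i u where "b = axis i u" using b by (auto simp: Basis_vec_def)
    then show ?thesis by (simp add: inner_axis smooth_on_inner assms smooth_on_const)
  qed
  then show "smooth_on S (\<lambda>x. \<Sum>b\<in>Basis. (f x \<bullet> b) *\<^sub>R b)"
    by (intro smooth_on_sum smooth_on_scaleR smooth_on_const assms(1))
qed (simp add: euclidean_representation)

lemma smooth_on_matrix_mult:
  fixes P Q :: "'p::real_normed_vector \<Rightarrow> real^'n^'n"
  assumes "open S" "smooth_on S P" "smooth_on S Q"
  shows "smooth_on S (\<lambda>x. P x ** Q x)"
proof (intro smooth_on_vecI assms(1))
  fix i j
  show "smooth_on S (\<lambda>x. (P x ** Q x) $ i $ j)"
    unfolding matrix_matrix_mult_def
    by (simp, intro smooth_on_sum smooth_on_mult smooth_on_vec_nth assms)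
qed

lemma smooth_on_matrix:
  fixes L :: "'p::real_normed_vector \<Rightarrow> real^'n \<Rightarrow> real^'n"
  assumes "open S" "\<And>v. smooth_on S (\<lambda>x. L x v)"
  shows "smooth_on S (\<lambda>x. matrix (L x))"
proof (intro smooth_on_vecI assms(1))
  fix i j
  show "smooth_on S (\<lambda>x. matrix (L x) $ i $ j)"
    unfolding matrix_def by (simp, intro smooth_on_vec_nth assms)
qed

lemma matrix_inv_mult:
  assumes "invertible (P :: real^'n^'n)"
  shows "P ** matrix_inv P = mat 1" "matrix_inv P ** P = mat 1"
  using someI_ex[OF assms[unfolded invertible_def]] by (auto simp: matrix_inv_def)

text \<open>Applied to a fixed vector, the inverse solves a linear system with smooth coefficients;
  the columns are then assembled.\<close>

lemma smooth_on_matrix_inv: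
  fixes P :: "'p::real_normed_vector \<Rightarrow> real^'n^'n"
  assumes "open S" "smooth_on S P" "\<And>x. x \<in> S \<Longrightarrow> invertible (P x)"
  shows "smooth_on S (\<lambda>x. matrix_inv (P x))"
proof -
  have "smooth_on S (\<lambda>x. matrix_inv (P x) *v w)" for w
  proof (rule smooth_on_linear_inverse[where L = "\<lambda>x v. P x *v v" and w = w, OF assms(1)])
    show "linear ((*v) (P x))" for x by simp
    show "inj ((*v) (P x))" if "x \<in> S" for x
      using matrix_inv_mult(2)[OF assms(3)[OF that]] matrix_left_invertible_injective by blast
    show "smooth_on S (\<lambda>x. P x *v v)" for v
      unfolding matrix_vector_mult_def
      by (rule smooth_on_vecI[OF assms(1)])
         (simp, intro smooth_on_sum smooth_on_mult smooth_on_vec_nth smooth_on_const assms)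
    show "P x *v (matrix_inv (P x) *v w) = w" if "x \<in> S" for x
      by (simp add: matrix_vector_mul_assoc matrix_inv_mult[OF assms(3)[OF that]])
  qed
  from smooth_on_matrix[where L = "\<lambda>x v. matrix_inv (P x) *v v", OF assms(1) this]
  show ?thesis by simp
qed

text \<open>The velocity of the frame \<open>p\<close> under parallel transport in direction
  \<open>v\<close>: the covariant derivatives of its columns vanish.\<close>

definition frame_lift :: "(real^'n) metric \<Rightarrow> 'n frame_coords \<Rightarrow> real^'n \<Rightarrow> 'n frame_coords" where
  "frame_lift g p v = (v, - (matrix (christoffel g (fst p) v) ** snd p))"

lemma matrix_matrix_mult_add_rdistrib: "(A + B) ** C = A ** C + B ** C" for A B :: "real^'n^'m"
  by (vector matrix_matrix_mult_def sum.distrib[symmetric] field_simps)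

lemma scaleR_matrix_mult: "(r *\<^sub>R A) ** B = r *\<^sub>R (A ** B)"
  and matrix_mult_scaleR: "A ** (r *\<^sub>R B) = r *\<^sub>R (A ** B)" for A :: "real^'n^'m" and B :: "real^'k^'n"
  by (simp_all add: matrix_matrix_mult_def vec_eq_iff sum_distrib_left mult.assoc mult.left_commute)

text \<open>The set \<open>frames\<close> is a parameter tied by an equation, so that
  interpretations speak of \<open>chart_frames c\<close> directly.\<close>

locale frame_geometry =
  fixes U :: "(real^'n) set" and g :: "(real^'n) metric" and frames :: "'n frame_coords set"
  assumes open_base: "open U" and metric: "riemannian_metric_on U g"
    and frames_def: "frames = U \<times> Collect invertible"
begin

lemma diff_metric: "differentiable_metric_on U g"
  by (rule riemannian_imp_differentiable_metric[OF open_base metric])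

lemma framesD: "p \<in> frames \<Longrightarrow> fst p \<in> U" "p \<in> frames \<Longrightarrow> invertible (snd p)"
  by (auto simp: frames_def)

lemma christoffel_matrix_linear:
  assumes "u \<in> U" shows "linear (\<lambda>v. matrix (christoffel g u v))"
proof (rule linearI)
  note bil = christoffel_bilinear[OF diff_metric assms]
  show "matrix (christoffel g u (v + w)) = matrix (christoffel g u v) + matrix (christoffel g u w)" for v w
    by (simp add: matrix_def vec_eq_iff bilinear_ladd[OF bil])
  show "matrix (christoffel g u (r *\<^sub>R v)) = r *\<^sub>R matrix (christoffel g u v)" for r v
    by (simp add: matrix_def vec_eq_iff bilinear_lmul[OF bil])
qed

lemma frame_lift_linear:
  assumes "p \<in> frames" shows "linear (frame_lift g p)"
proof -
  note lin = christoffel_matrix_linear[OF framesD(1)[OF assms]]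
  show ?thesis
    by (intro linearI)
       (simp_all add: frame_lift_def linear_add[OF lin] linear_cmul[OF lin] matrix_matrix_mult_add_rdistrib scaleR_matrix_mult)
qed

lemma connection_form_linear:
  assumes "p \<in> frames" shows "linear (connection_form g p)"
proof -
  note lin = christoffel_matrix_linear[OF framesD(1)[OF assms]]
  show ?thesis
    by (intro linearI)
       (simp_all add: connection_form_def case_prod_beta linear_add[OF lin] linear_cmul[OF lin]
         matrix_matrix_mult_add_rdistrib matrix_add_ldistrib scaleR_matrix_mult matrix_mult_scaleR scaleR_add_right[symmetric])
qed

text \<open>The frame matrix is invertible and can be cancelled; the kernel of the connection form
  thus consists of the lifts.\<close>

lemma connection_form_eq_0:
  assumes "p \<in> frames"
  shows "connection_form g p Z = 0 \<longleftrightarrow> Z = frame_lift g p (fst Z)"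
proof -
  obtain u P v Q where [simp]: "p = (u, P)" "Z = (v, Q)" by (metis surj_pair)
  have inv: "P ** matrix_inv P = mat 1" using framesD(2)[OF assms] by (simp add: matrix_inv_mult)
  have "connection_form g p Z = 0 \<longleftrightarrow> Q + matrix (christoffel g u v) ** P = 0"
  proof
    assume "connection_form g p Z = 0"
    then have "P ** (matrix_inv P ** (Q + matrix (christoffel g u v) ** P)) = P ** 0"
      by (simp add: connection_form_def)
    then show "Q + matrix (christoffel g u v) ** P = 0" by (simp add: matrix_mul_assoc inv)
  qed (simp add: connection_form_def)
  then show ?thesis by (simp add: frame_lift_def eq_neg_iff_add_eq_0)
qed

text \<open>The argument is the fundamental vertical vector generated by \<open>\<Omega>\<close>.
  Every value of the form is thereby attained on a vertical test vector.\<close>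

lemma connection_form_vertical:
  assumes "p \<in> frames"
  shows "connection_form g p (0, snd p ** \<Omega>) = \<Omega>"
proof -
  have "matrix (christoffel g (fst p) 0) = 0"
    by (rule linear_0[OF christoffel_matrix_linear[OF framesD(1)[OF assms]]])
  then show ?thesis
    using matrix_inv_mult(2)[OF framesD(2)[OF assms]]
    by (simp add: connection_form_def matrix_mul_assoc case_prod_beta)
qed

lemma frame_metric_inner: "frame_metric g p Z Z' = g (fst p) (fst Z) (fst Z') + connection_form g p Z \<bullet> connection_form g p Z'"
  by (simp add: frame_metric_def inner_vec_def)

lemma frame_lift_0: "p \<in> frames \<Longrightarrow> connection_form g p (frame_lift g p v) = 0"
  by (simp add: connection_form_eq_0 frame_lift_def)

lemma fst_frame_lift [simp]: "fst (frame_lift g p v) = v"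
  by (simp add: frame_lift_def)

text \<open>The connection form vanishes on lifts, so only the base metric remains: lifting is
  isometric, and the projection is a Riemannian submersion.\<close>

lemma frame_metric_lift:
  assumes "p \<in> frames"
  shows "frame_metric g p (frame_lift g p v) Z = g (fst p) v (fst Z)"
    "frame_metric g p Z (frame_lift g p v) = g (fst p) (fst Z) v"
  by (simp_all add: frame_metric_inner frame_lift_0[OF assms])

lemma frame_metric_inner_form:
  assumes "p \<in> frames" shows "inner_form (frame_metric g p)"
proof -
  note gi = riemannian_metric_inner_form[OF metric framesD(1)[OF assms]]
  note lin = connection_form_linear[OF assms]
  note bil = inner_formD(1)[OF gi]
  have "0 < frame_metric g p Z Z" if "Z \<noteq> 0" for Z
  proof (cases "fst Z = 0")
    case True
    \<comment> \<open>A vector over 0 with vanishing connection form would be the lift of 0, which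
      is 0.\<close>
    then have "Z \<noteq> frame_lift g p (fst Z)"
      using that linear_0[OF frame_lift_linear[OF assms]] by simp
    then have "0 < connection_form g p Z \<bullet> connection_form g p Z"
      using connection_form_eq_0[OF assms] by simp
    then show ?thesis by (simp add: frame_metric_inner True bilinear_lzero[OF bil])
  next
    case False
    then show ?thesis
      using inner_formD(3)[OF gi, of "fst Z"] by (simp add: frame_metric_inner add_pos_nonneg)
  qed
  moreover have "bilinear (frame_metric g p)"
    unfolding bilinear_def frame_metric_inner
    by (intro conjI allI linearI; simp add: linear_add[OF lin] linear_cmul[OF lin] inner_add_left inner_add_right
        bilinear_ladd[OF bil] bilinear_radd[OF bil] bilinear_lmul[OF bil] bilinear_rmul[OF bil] algebra_simps)
  ultimately show ?thesis
    using inner_formD(2)[OF gi] unfolding inner_form_def frame_metric_inner by (simp add: inner_commute)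
qed

lemma open_frames: "open frames"
  unfolding frames_def by (intro open_Times open_base open_invertible)

lemma christoffel_matrix_smooth:
  assumes "open N" "N \<subseteq> frames" "smooth_on N V"
  shows "smooth_on N (\<lambda>q. matrix (christoffel g (fst q) (V q)))"
proof (rule smooth_on_matrix[OF assms(1)])
  show "smooth_on N (\<lambda>q. christoffel g (fst q) (V q) w)" for w
    by (rule christoffel_smooth_compose[OF assms(1) open_base metric _ smooth_on_fst[OF assms(1) smooth_on_id] assms(3) smooth_on_const])
       (use assms(2) framesD(1) in auto)
qed

lemma frame_lift_smooth:
  assumes "open N" "N \<subseteq> frames" "smooth_on N V"
  shows "smooth_on N (\<lambda>q. frame_lift g q (V q))"
proof -
  have "smooth_on N (\<lambda>q. (V q, 0 - matrix (christoffel g (fst q) (V q)) ** snd q))"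
    by (intro smooth_on_Pair smooth_on_diff smooth_on_const smooth_on_matrix_mult smooth_on_snd smooth_on_id
        christoffel_matrix_smooth assms)
  then show ?thesis by (simp add: frame_lift_def)
qed

lemma frame_metric_differentiable: "differentiable_metric_on frames (frame_metric g)"
proof -
  have "smooth_on frames (\<lambda>q. connection_form g q Z)" for Z
    unfolding connection_form_def case_prod_beta
    by (intro smooth_on_matrix_mult smooth_on_matrix_inv smooth_on_add smooth_on_const smooth_on_snd smooth_on_id
        christoffel_matrix_smooth open_frames subset_refl framesD(2))
  moreover have "smooth_on frames (\<lambda>q. g (fst q) v w)" for v w
    by (rule smooth_on_compose[OF open_frames open_base _ smooth_on_fst[OF open_frames smooth_on_id] riemannian_metric_smooth[OF metric]])
       (use framesD(1) in auto)
  ultimately have "smooth_on frames (\<lambda>q. frame_metric g q Z Z')" for Z Z'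
    unfolding frame_metric_inner by (intro smooth_on_add smooth_on_inner open_frames)
  then show ?thesis
    unfolding differentiable_metric_on_def
    using open_frames frame_metric_inner_form smooth_on_differentiable by blast
qed

text \<open>
  O'Neill's argument: with \<open>H\<close> the horizontal lift of a constant field, the product rule for
  \<open>m(E, H)\<close> along \<open>E\<close> and for \<open>m(E, E)\<close> along \<open>H\<close> determines \<open>m(\<nabla>\<^sub>E E, H)\<close>.
\<close>

lemma frame_levi_civita:
  assumes B: "open B1" "open B2" "B1 \<times> B2 \<subseteq> frames" and p: "p \<in> B1 \<times> B2"
    and E: "smooth_on (B1 \<times> B2) E" "\<And>q. q \<in> B1 \<times> B2 \<Longrightarrow> E q = frame_lift g q (e (fst q))"
    and e: "smooth_on B1 e"
  shows "fst (levi_civita (frame_metric g) E E p) = levi_civita g e e (fst p)"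
proof -
  let ?m = "frame_metric g" and ?u = "fst p"
  let ?N = "B1 \<times> B2"
  have N: "open ?N" using B by (simp add: open_Times)
  have pf: "p \<in> frames" and u: "?u \<in> U" "?u \<in> B1" using p B framesD(1) by auto
  note m = frame_metric_differentiable
  note gi = metric_at(2)[OF diff_metric u(1)]
  note g_add = bilinear_ladd[OF inner_formD(1)[OF gi]] bilinear_radd[OF inner_formD(1)[OF gi]]
  note m_add = bilinear_ladd[OF inner_formD(1)[OF metric_at(2)[OF m pf]]] bilinear_radd[OF inner_formD(1)[OF metric_at(2)[OF m pf]]]
  let ?e' = "fderiv e ?u" and ?E' = "fderiv E p" and ?C = "christoffel ?m p" and ?G = "christoffel g ?u"
  have e': "(e has_derivative ?e') (at ?u)" by (rule smooth_on_has_derivative[OF e u(2)])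
  have E': "(E has_derivative ?E') (at p)" by (rule smooth_on_has_derivative[OF E(1) p])
  have fstE': "fst (?E' Z) = ?e' (fst Z)" for Z
  proof -
    have "((\<lambda>q. e (fst q)) has_derivative (\<lambda>Z. ?e' (fst Z))) (at p)"
      by (rule has_derivative_compose[OF has_derivative_fst[OF has_derivative_ident] e'])
    then have "((\<lambda>q. fst (E q)) has_derivative (\<lambda>Z. ?e' (fst Z))) (at p)"
      by (rule has_derivative_transform_within_open[OF _ N p]) (simp add: E(2))
    from has_derivative_unique[OF this has_derivative_fst[OF E']] show ?thesis by metis
  qed
  have Ep: "E p = frame_lift g p (e ?u)" by (rule E(2)[OF p])
  have "g ?u (fst (levi_civita ?m E E p)) w = g ?u (levi_civita g e e ?u) w" for w
  proof -
    define H where "H q = frame_lift g q w" for q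
    have "smooth_on frames H"
      unfolding H_def by (rule frame_lift_smooth[OF open_frames subset_refl smooth_on_const])
    then have H': "(H has_derivative fderiv H p) (at p)" by (rule smooth_on_has_derivative[OF _ pf])
    \<comment> \<open>\<open>H\<close> projects to the constant \<open>w\<close>, so its derivative
      is vertical and orthogonal to \<open>E p\<close>.\<close>
    have fstH': "fst (fderiv H p Z) = 0" for Z
    proof -
      have "((\<lambda>q. fst (H q)) has_derivative (\<lambda>Z. 0)) (at p)" by (simp add: H_def)
      from has_derivative_unique[OF this has_derivative_fst[OF H']] show ?thesis by metis
    qed
    have Hp: "H p = frame_lift g p w" by (simp add: H_def)
    have base: "((\<lambda>q. g (fst q) (V (fst q)) (W (fst q))) has_derivative
        (\<lambda>Z. g ?u (V' (fst Z) + ?G (fst Z) (V ?u)) (W ?u) + g ?u (V ?u) (W' (fst Z) + ?G (fst Z) (W ?u)))) (at p)"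
      if "(V has_derivative V') (at ?u)" "(W has_derivative W') (at ?u)" for V V' W W'
      by (rule has_derivative_compose[OF has_derivative_fst[OF has_derivative_ident] metric_product_rule[OF diff_metric u(1) that]])
    have "((\<lambda>q. ?m q (E q) (H q)) has_derivative
        (\<lambda>Z. g ?u (?e' (fst Z) + ?G (fst Z) (e ?u)) w + g ?u (e ?u) (0 + ?G (fst Z) w))) (at p)"
      by (rule has_derivative_transform_within_open[OF base[OF e' has_derivative_const] N p])
         (use B(3) in \<open>auto simp: E(2) H_def frame_metric_lift\<close>)
    from fun_cong[OF has_derivative_unique[OF metric_product_rule[OF m pf E' H'] this]]
    have 1: "?m p (?E' Z + ?C Z (E p)) (H p) + ?m p (E p) (fderiv H p Z + ?C Z (H p)) =
        g ?u (?e' (fst Z) + ?G (fst Z) (e ?u)) w + g ?u (e ?u) (?G (fst Z) w)" for Z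
      by simp
    have "((\<lambda>q. ?m q (E q) (E q)) has_derivative
        (\<lambda>Z. g ?u (?e' (fst Z) + ?G (fst Z) (e ?u)) (e ?u) + g ?u (e ?u) (?e' (fst Z) + ?G (fst Z) (e ?u)))) (at p)"
      by (rule has_derivative_transform_within_open[OF base[OF e' e'] N p])
         (use B(3) in \<open>auto simp: E(2) frame_metric_lift\<close>)
    from fun_cong[OF has_derivative_unique[OF metric_product_rule[OF m pf E' E'] this]]
    have 2: "?m p (?E' Z + ?C Z (E p)) (E p) + ?m p (E p) (?E' Z + ?C Z (E p)) =
        g ?u (?e' (fst Z) + ?G (fst Z) (e ?u)) (e ?u) + g ?u (e ?u) (?e' (fst Z) + ?G (fst Z) (e ?u))" for Z
      by simp
    \<comment> \<open>The second identity is taken in direction \<open>H p\<close>; vanishing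
      torsion upstairs and downstairs exchanges the arguments. This is the cross term that must
      cancel in the first identity.\<close>
    have "g ?u (e ?u) (fst (?C (E p) (H p))) = g ?u (e ?u) (?G (e ?u) w)"
      using 2[of "H p"] fstE'[of "H p"] inner_formD(2)[OF gi, of _ "e ?u"]
        christoffel_sym[OF m pf, of "H p" "E p"] christoffel_sym[OF diff_metric u(1), of w "e ?u"]
      by (simp add: Ep Hp frame_metric_lift[OF pf] g_add)
    then show ?thesis
      using 1[of "E p"] fstE' fstH'
      by (simp add: Ep Hp frame_metric_lift[OF pf] levi_civita_def g_add bilinear_rzero[OF inner_formD(1)[OF gi]])
  qed
  then show ?thesis by (rule inner_form_eqI[OF gi])
qed

end

section \<open>Transverse tension of maps of frame bundles\<close>

lemma fderiv_fst: "fderiv fst x = fst"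
  by (rule fderiv_eq) (rule bounded_linear_imp_has_derivative[OF bounded_linear_fst])

section \<open>Horizontal and vertical vectors of the fibre foliation\<close>

context frame_geometry
begin

context
  fixes c :: "('n frame_coords, real^'n, 'm) fol_chart"
  assumes fsub: "fsub c = fst" and fmet: "fmet c = frame_metric g"
begin

lemma vertical_iff: "Z \<in> vertical c p \<longleftrightarrow> fst Z = 0"
  by (simp add: vertical_def fsub fderiv_fst)

lemma horizontal_iff:
  assumes "p \<in> frames" shows "H \<in> horizontal c p \<longleftrightarrow> H = frame_lift g p (fst H)"
proof
  assume "H \<in> horizontal c p"
  \<comment> \<open>The test vector is vertical with the same connection form value as
    \<open>H\<close>, so orthogonality forces that value to have norm zero.\<close>
  then have "frame_metric g p H (0, snd p ** connection_form g p H) = 0"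
    by (simp add: horizontal_def vertical_iff fmet)
  then have "connection_form g p H \<bullet> connection_form g p H = 0"
    using bilinear_rzero[OF riemannian_metric_bilinear[OF metric framesD(1)[OF assms]]]
    by (simp add: frame_metric_inner connection_form_vertical[OF assms])
  then show "H = frame_lift g p (fst H)" using connection_form_eq_0[OF assms] by simp
next
  assume H: "H = frame_lift g p (fst H)"
  have "frame_metric g p (frame_lift g p (fst H)) Z = 0" if "fst Z = 0" for Z
    by (simp add: frame_metric_lift[OF assms] that
        bilinear_rzero[OF riemannian_metric_bilinear[OF metric framesD(1)[OF assms]]])
  then show "H \<in> horizontal c p" using H by (simp add: horizontal_def vertical_iff fmet)
qed

lemma horizontal_part_eq:
  assumes "p \<in> frames" shows "horizontal_part c p Z = frame_lift g p (fst Z)"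
  unfolding horizontal_part_def
  by (rule the_equality) (auto simp: horizontal_iff[OF assms] vertical_iff)

lemma horizontal_lift_eq:
  assumes "p \<in> frames" shows "horizontal_lift c p v = frame_lift g p v"
  unfolding horizontal_lift_def
  by (rule the_equality) (auto simp: horizontal_iff[OF assms] fsub fderiv_fst)

text \<open>Lifting is isometric at every frame of a fibre, so the described value is unique. Over
  points outside the projected chart the condition is vacuous and the value unspecified.\<close>

lemma transverse_metric_eq:
  assumes "fdom c \<subseteq> frames" "b \<in> fst ` fdom c"
  shows "transverse_metric c b = g b"
proof (intro ext)
  fix v w
  have "fmet c q (horizontal_lift c q v) (horizontal_lift c q w) = g (fst q) v w" if "q \<in> fdom c" for q
    using assms(1) that by (auto simp: fmet horizontal_lift_eq frame_metric_lift)
  then show "transverse_metric c b v w = g b v w"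
    unfolding transverse_metric_def using assms(2) by (intro the_equality) (auto simp: fsub)
qed

end

end

text \<open>All data descend to the base: the frame fields are lifts of fields \<open>e a\<close>,
  and \<open>G\<close> projects to \<open>\<phi>\<close>. Derivatives of \<open>e a\<close> occur in
  both parts of the transverse tension and cancel, leaving the second fundamental form of
  \<open>\<phi>\<close> on an orthonormal basis.\<close>

lemma transverse_tension_eq:
  fixes c1 :: "('n frame_coords, real^'n, 'm1) fol_chart" and c2 :: "('m frame_coords, real^'m, 'm2) fol_chart"
  assumes G1: "frame_geometry U g frames1" and G2: "frame_geometry U' h frames2"
    and c1: "fsub c1 = fst" "fmet c1 = frame_metric g"
    and c2: "fsub c2 = fst" "fmet c2 = frame_metric h" "open (fdom c2)" "fdom c2 \<subseteq> frames2"
    and N: "N \<subseteq> frames1" "smooth_on N G" "G ` N \<subseteq> fdom c2"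
    and E: "foliated_frame c1 N E"
    and B: "open B1" "open B2" "B1 \<times> B2 \<subseteq> N" "p \<in> B1 \<times> B2"
    and \<phi>: "smooth_on B1 \<phi>" "\<And>q. q \<in> B1 \<times> B2 \<Longrightarrow> fst (G q) = \<phi> (fst q)"
  shows "transverse_tension c1 c2 G E p = frame_lift h (G p) (tension_field g h \<phi> (fst p))"
proof -
  interpret G1: frame_geometry U g frames1 by (rule G1)
  interpret G2: frame_geometry U' h frames2 by (rule G2)
  let ?u = "fst p" and ?B = "B1 \<times> B2"
  have opB: "open ?B" using B by (simp add: open_Times)
  have pN: "p \<in> N" using B(3,4) by blast
  then have p1: "p \<in> frames1" using N(1) by blast
  have u: "?u \<in> B1" "?u \<in> U" and q: "snd p \<in> B2"
    using B(4) G1.framesD(1)[OF p1] by auto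
  have Gq: "G q \<in> fdom c2" "G q \<in> frames2" if "q \<in> ?B" for q using that B N c2 by auto
  \<comment> \<open>Freezing the matrix coordinate at that of \<open>p\<close> loses nothing: the
    projection of a foliated field depends on the base point only.\<close>
  define e where "e a v = fst (E a (v, snd p))" for a v
  have e: "smooth_on B1 (e a)" if a: "a \<in> Basis" for a
  proof -
    have Ea: "smooth_on ?B (E a)" using E a B(3) by (auto simp: foliated_frame_def intro: smooth_on_subset)
    have "smooth_on B1 (\<lambda>v. E a (v, snd p))"
      by (rule smooth_on_compose[OF B(1) opB _ smooth_on_Pair[OF B(1) smooth_on_id smooth_on_const] Ea]) (use q in auto)
    then show ?thesis unfolding e_def by (rule smooth_on_fst[OF B(1)])
  qed
  have Ee: "E a q' = frame_lift g q' (e a (fst q'))" if a: "a \<in> Basis" and q': "q' \<in> ?B" for a q'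
  proof -
    obtain e' where e': "\<And>q. q \<in> N \<Longrightarrow> fst (E a q) = e' (fst q)"
      using E a by (auto simp: foliated_frame_def c1 fderiv_fst)
    have "(fst q', snd p) \<in> N" "q' \<in> N" using q' q B(3) by auto
    then have "fst (E a q') = e a (fst q')" using e' by (simp add: e_def)
    moreover have "E a q' \<in> horizontal c1 q'" "q' \<in> frames1"
      using E a \<open>q' \<in> N\<close> N(1) by (auto simp: foliated_frame_def)
    ultimately show ?thesis using G1.horizontal_iff[OF c1] by metis
  qed
  have on: "orthonormal_family (g ?u) (\<lambda>a. e a ?u)"
    unfolding orthonormal_family_def
  proof (intro ballI)
    fix a b :: "real^'n" assume ab: "a \<in> Basis" "b \<in> Basis"
    then have "frame_metric g p (E a p) (E b p) = (if a = b then 1 else 0)"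
      using E pN by (simp add: foliated_frame_def orthonormal_family_def c1)
    then show "g ?u (e a ?u) (e b ?u) = (if a = b then 1 else 0)"
      by (simp add: Ee[OF ab(1) B(4)] Ee[OF ab(2) B(4)] G1.frame_metric_lift[OF p1])
  qed
  have op': "open (fst ` fdom c2)" by (rule open_image_fst[OF c2(3)])
  have \<phi>u: "\<phi> ?u \<in> fst ` fdom c2" using \<phi>(2)[OF B(4)] Gq(1)[OF B(4)] by force
  have sub: "fst ` fdom c2 \<subseteq> U'" using c2(4) G2.framesD(1) by auto
  have h': "differentiable_metric_on (fst ` fdom c2) h"
    by (rule riemannian_imp_differentiable_metric[OF op' riemannian_metric_on_subset[OF G2.metric sub]])
  \<comment> \<open>The transverse metric is known to equal \<open>h\<close> only over the projected
    chart. That set is open, and Christoffel maps depend on germs only.\<close>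
  have chr: "christoffel (transverse_metric c2) (\<phi> ?u) = christoffel h (\<phi> ?u)"
    using christoffel_cong[OF h' \<phi>u, of "transverse_metric c2"] G2.transverse_metric_eq[OF c2(1,2,4)] by simp
  have DG: "((\<lambda>y. fst (G y)) has_derivative (\<lambda>Z. fderiv \<phi> (fst y) (fst Z))) (at y)" if y: "y \<in> ?B" for y
  proof -
    have "fst y \<in> B1" using y by auto
    have "((\<lambda>y. \<phi> (fst y)) has_derivative (\<lambda>Z. fderiv \<phi> (fst y) (fst Z))) (at y)"
      by (rule has_derivative_compose[OF has_derivative_fst[OF has_derivative_ident]
            smooth_on_has_derivative[OF \<phi>(1) \<open>fst y \<in> B1\<close>]])
    then show ?thesis
      by (rule has_derivative_transform_within_open[OF _ opB y]) (simp add: \<phi>(2))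
  qed
  have fstDG: "fst (fderiv G y Z) = fderiv \<phi> (fst y) (fst Z)" if y: "y \<in> ?B" for y Z
  proof -
    have "y \<in> N" using y B(3) by blast
    from has_derivative_unique[OF DG[OF y] has_derivative_fst[OF smooth_on_has_derivative[OF N(2) this]]]
    show ?thesis by metis
  qed
  note linG = G2.frame_lift_linear[OF Gq(2)[OF B(4)]]
  have lin\<phi>: "linear (fderiv \<phi> v)" if "v \<in> B1" for v by (rule smooth_on_linear_fderiv[OF \<phi>(1) that])
  have "transverse_pullback_derivative c2 G (\<lambda>y. horizontal_part c2 (G y) (fderiv G y (E a y))) p (E a p)
      - horizontal_part c2 (G p) (fderiv G p (transverse_derivative c1 (E a) (E a) p))
      = frame_lift h (G p) (derivative_of_differential g h \<phi> ?u (e a ?u) (e a ?u))" if a: "a \<in> Basis" for a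
  proof -
    let ?e' = "fderiv (e a) ?u"
    let ?\<sigma> = "\<lambda>y. fderiv fst (G y) (horizontal_part c2 (G y) (fderiv G y (E a y)))"
    have e': "(e a has_derivative ?e') (at ?u)" by (rule smooth_on_has_derivative[OF e[OF a] u(1)])
    have \<sigma>: "?\<sigma> y = fderiv \<phi> (fst y) (e a (fst y))" if y: "y \<in> ?B" for y
      by (simp add: fderiv_fst G2.horizontal_part_eq[OF c2(1,2) Gq(2)[OF y]] fstDG[OF y] Ee[OF a y])
    have "((\<lambda>v. fderiv \<phi> v (e a v)) has_derivative
        (\<lambda>w. fderiv (\<lambda>v. fderiv \<phi> v (e a ?u)) ?u w + fderiv \<phi> ?u (?e' w))) (at ?u)"
      by (rule has_derivative_linear_family[of B1 ?u "fderiv \<phi>", OF B(1) u(1) lin\<phi> _ e'])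
         (auto intro: smooth_on_differentiable[OF smooth_on_fderiv_const[OF \<phi>(1)] u(1)])
    from has_derivative_compose[OF has_derivative_fst[OF has_derivative_ident] this]
    have "((\<lambda>y. fderiv \<phi> (fst y) (e a (fst y))) has_derivative
        (\<lambda>Z. fderiv (\<lambda>v. fderiv \<phi> v (e a ?u)) ?u (fst Z) + fderiv \<phi> ?u (?e' (fst Z)))) (at p)" .
    then have "(?\<sigma> has_derivative
        (\<lambda>Z. fderiv (\<lambda>v. fderiv \<phi> v (e a ?u)) ?u (fst Z) + fderiv \<phi> ?u (?e' (fst Z)))) (at p)"
      by (rule has_derivative_transform_within_open[OF _ opB B(4)]) (simp only: \<sigma>)
    note D\<sigma> = fderiv_eq[OF this]
    have 1: "transverse_pullback_derivative c2 G (\<lambda>y. horizontal_part c2 (G y) (fderiv G y (E a y))) p (E a p)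
      = frame_lift h (G p) (fderiv (\<lambda>v. fderiv \<phi> v (e a ?u)) ?u (e a ?u) + fderiv \<phi> ?u (?e' (e a ?u))
        + christoffel h (\<phi> ?u) (fderiv \<phi> ?u (e a ?u)) (fderiv \<phi> ?u (e a ?u)))"
      unfolding transverse_pullback_derivative_def pullback_derivative_def c2(1) D\<sigma> \<sigma>[OF B(4)]
        fderiv_eq[OF DG[OF B(4)]] G2.horizontal_lift_eq[OF c2(1,2) Gq(2)[OF B(4)]] \<phi>(2)[OF B(4)] chr
      by (simp add: Ee[OF a B(4)])
    have 2: "horizontal_part c2 (G p) (fderiv G p (transverse_derivative c1 (E a) (E a) p))
      = frame_lift h (G p) (fderiv \<phi> ?u (levi_civita g (e a) (e a) ?u))"
      unfolding transverse_derivative_def G1.horizontal_part_eq[OF c1 p1] c1(2)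
        G2.horizontal_part_eq[OF c2(1,2) Gq(2)[OF B(4)]] fstDG[OF B(4)] G1.fst_frame_lift
    proof (subst G1.frame_levi_civita[OF B(1,2) _ B(4) _ Ee[OF a] e[OF a]])
      show "?B \<subseteq> frames1" using B(3) N(1) by blast
      show "smooth_on ?B (E a)" using E a B(3) by (auto simp: foliated_frame_def intro: smooth_on_subset)
    qed auto
    show ?thesis
      unfolding 1 2 linear_diff[OF linG, symmetric]
      by (simp add: derivative_of_differential_eq levi_civita_def linear_add[OF lin\<phi>[OF u(1)]] add_diff_eq)
  qed
  then have "transverse_tension c1 c2 G E p =
      (\<Sum>a\<in>Basis. frame_lift h (G p) (derivative_of_differential g h \<phi> ?u (e a ?u) (e a ?u)))"
    by (simp add: transverse_tension_def)
  also have "\<dots> = frame_lift h (G p) (tension_field g h \<phi> ?u)"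
  proof -
    have gB: "differentiable_metric_on (U \<inter> B1) g"
      by (rule riemannian_imp_differentiable_metric)
         (auto intro: open_Int G1.open_base B(1) riemannian_metric_on_subset[OF G1.metric])
    show ?thesis
      using tension_field_eq[OF gB h' _ \<phi>u smooth_on_subset[OF \<phi>(1)] on] u
      by (simp add: linear_sum[OF linG])
  qed
  finally show ?thesis .
qed

section \<open>Harmonicity\<close>

text \<open>
  Both maps are lifts of the same map \<open>b\<close>, so locally they differ by isometries, on a set
  accumulating at \<open>u\<close>.
\<close>

lemma tension_field_lift_vanishes:
  fixes L :: "'a::euclidean_space \<Rightarrow> 'b::euclidean_space"
  assumes X: "riemannian_orbifold X A g" "c \<in> A" "s \<in> A" and Y: "riemannian_orbifold Y B h" "d \<in> B" "t \<in> B"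
    and \<phi>: "open T" "T \<subseteq> odom c" "smooth_on T \<phi>" "\<phi> ` T \<subseteq> odom d"
    and L: "open S0" "S0 \<subseteq> odom s" "smooth_on S0 L" "L ` S0 \<subseteq> odom t"
    and b: "\<And>v. v \<in> T \<Longrightarrow> omap d (\<phi> v) = b (omap c v)" "\<And>v. v \<in> S0 \<Longrightarrow> omap t (L v) = b (omap s v)"
    and u: "u \<in> T" "u' \<in> S0" "omap c u = omap s u'"
    and zero: "\<And>v. v \<in> S0 \<Longrightarrow> tension_field (g s) (h t) L v = 0"
  shows "tension_field (g c) (h d) \<phi> u = 0"
proof -
  have "u \<in> odom c" "u' \<in> odom s" using u \<phi> L by auto
  then obtain S1 \<psi> \<kappa> where T1: "chart_transition g c s S1 \<psi> \<kappa>" "u \<in> S1" "\<psi> u = u'"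
    using chart_transition_between[OF X(1-3)] u(3) by blast
  have "L u' \<in> odom t" "\<phi> u \<in> odom d" "omap t (L u') = omap d (\<phi> u)" using u \<phi> L b by auto
  then obtain S2 \<psi>2 \<kappa>2 where T2: "chart_transition h t d S2 \<psi>2 \<kappa>2" "L u' \<in> S2" "\<psi>2 (L u') = \<phi> u"
    using chart_transition_between[OF Y(1,3,2)] by blast
  note T1' = chart_transitionD[OF T1(1)] and T2' = chart_transitionD[OF T2(1)]
  define O1 where "O1 = S0 \<inter> L -` S2"
  have O1: "open O1" "O1 \<subseteq> S0" "O1 \<subseteq> odom s" "L ` O1 \<subseteq> S2"
    using continuous_open_preimage[OF smooth_on_continuous[OF L(3)] L(1) T2'(1)] L(2) by (auto simp: O1_def)
  define W where "W = T \<inter> (S1 \<inter> \<psi> -` O1)"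
  have W: "open W" "W \<subseteq> T" "W \<subseteq> S1" "\<psi> ` W \<subseteq> O1" "W \<subseteq> odom c" "u \<in> W"
    using continuous_open_preimage[OF smooth_on_continuous[OF T1'(3)] T1'(1) O1(1)] \<phi>(1,2) u T1 T2
    by (auto simp: W_def O1_def)
  have LW: "smooth_on O1 L" "smooth_on W \<psi>"
    using smooth_on_subset[OF L(3) O1(2)] smooth_on_subset[OF T1'(3) W(3)] by auto
  \<comment> \<open>\<open>L\<close> transported to the charts \<open>c\<close> and \<open>d\<close>
    by isometric changes on both sides; it covers the same map as \<open>\<phi>\<close>.\<close>
  define \<phi>' where "\<phi>' v = \<psi>2 (L (\<psi> v))" for v
  have L\<psi>: "smooth_on W (\<lambda>v. L (\<psi> v))" by (rule smooth_on_compose[OF W(1) O1(1) W(4) LW(2,1)])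
  have L\<psi>S2: "(\<lambda>v. L (\<psi> v)) ` W \<subseteq> S2" using W(4) O1(4) by auto
  have \<phi>'W: "smooth_on W \<phi>'" unfolding \<phi>'_def by (rule smooth_on_compose[OF W(1) T2'(1) L\<psi>S2 L\<psi> T2'(3)])
  have \<phi>'d: "\<phi>' ` W \<subseteq> odom d" using L\<psi>S2 T2'(5) by (auto simp: \<phi>'_def)
  have gm: "differentiable_metric_on S (g a)" if "open S" "S \<subseteq> odom a" "a \<in> A" for S a
    using that by (intro riemannian_imp_differentiable_metric riemannian_metric_on_subset[OF orbifold_metricD[OF X(1)]])
  have hm: "differentiable_metric_on S (h a)" if "open S" "S \<subseteq> odom a" "a \<in> B" for S a
    using that by (intro riemannian_imp_differentiable_metric riemannian_metric_on_subset[OF orbifold_metricD[OF Y(1)]])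
  note md = hm[OF orbifold_open_odom[OF Y(1,2)] subset_refl Y(2)]
  have iso: "isometric_on W (g c) (g s) \<psi>" using T1'(9) W(3) by (auto simp: isometric_on_def)
  have zero': "tension_field (g c) (h d) \<phi>' v = 0" if v: "v \<in> W" for v
  proof -
    have "tension_field (g c) (h d) \<phi>' v = fderiv \<psi>2 (L (\<psi> v)) (tension_field (g c) (h t) (\<lambda>v. L (\<psi> v)) v)"
      unfolding \<phi>'_def
      by (rule tension_field_isometry_compose[OF gm[OF W(1,5) X(2)] hm[OF T2'(1,2) Y(3)] md L\<psi> L\<psi>S2 T2'(3,5,9) v])
    also have "tension_field (g c) (h t) (\<lambda>v. L (\<psi> v)) v = tension_field (g s) (h t) L (\<psi> v)"
      by (rule tension_field_compose_isometry[OF gm[OF W(1,5) X(2)] gm[OF O1(1,3) X(3)] hm[OF T2'(1,2) Y(3)] LW(2) W(4) iso LW(1) O1(4) v])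
    also have "\<dots> = 0" using zero W(4) O1(2) v by blast
    finally show ?thesis
      using linear_0[OF smooth_on_linear_fderiv[OF T2'(3)]] L\<psi>S2 v by auto
  qed
  note \<phi>W = smooth_on_subset[OF \<phi>(3) W(2)]
  have \<phi>d: "\<phi> ` W \<subseteq> odom d" using \<phi>(4) W(2) by blast
  have eq: "omap d (\<phi> y) = omap d (\<phi>' y)" if y: "y \<in> W" for y
  proof -
    have "\<psi> y \<in> O1" "y \<in> S1" "y \<in> T" using y W(2-4) by blast+
    moreover from this(1) have "\<psi> y \<in> S0" "L (\<psi> y) \<in> S2" using O1(2,4) by blast+
    ultimately
    show ?thesis using b T1'(8) T2'(8) by (simp add: \<phi>'_def)
  qed
  obtain \<gamma> where \<gamma>: "\<gamma> \<in> ogrp d" "u \<in> closure (interior {y \<in> W. \<phi> y = \<gamma> (\<phi>' y)})"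
    using lifts_differ_by_group[OF orbifold_chartD[OF Y(1,2)] W(1,6) smooth_on_continuous[OF \<phi>W] \<phi>d
        smooth_on_continuous[OF \<phi>'W] \<phi>'d eq] by blast
  obtain \<delta> where "chart_transition h d d (odom d) \<gamma> \<delta>" using group_elem_transition[OF Y(1,2) \<gamma>(1)] by blast
  note \<gamma>' = chart_transitionD[OF this]
  have "tension_field (g c) (h d) \<phi> y = 0" if y: "y \<in> interior {y \<in> W. \<phi> y = \<gamma> (\<phi>' y)}" for y
  proof -
    have sub: "interior {y \<in> W. \<phi> y = \<gamma> (\<phi>' y)} \<subseteq> {y \<in> W. \<phi> y = \<gamma> (\<phi>' y)}" by (rule interior_subset)
    then have yW: "y \<in> W" and subW: "interior {y \<in> W. \<phi> y = \<gamma> (\<phi>' y)} \<subseteq> W" using y by auto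
    have "tension_field (g c) (h d) \<phi> y = tension_field (g c) (h d) (\<lambda>v. \<gamma> (\<phi>' v)) y"
      by (rule tension_field_cong[OF open_interior y _ smooth_on_subset[OF \<phi>W subW]]) (use sub in auto)
    also have "\<dots> = fderiv \<gamma> (\<phi>' y) (tension_field (g c) (h d) \<phi>' y)"
      by (rule tension_field_isometry_compose[OF gm[OF W(1,5) X(2)] md md \<phi>'W \<phi>'d \<gamma>'(3,5,9) yW])
    also have "\<dots> = 0"
      using zero'[OF yW] linear_0[OF smooth_on_linear_fderiv[OF \<gamma>'(3)]] \<phi>'d yW by auto
    finally show ?thesis .
  qed
  \<comment> \<open>Vanishing on the open coincidence set reaches \<open>u\<close> by
    continuity.\<close>
  moreover have "smooth_on W (tension_field (g c) (h d) \<phi>)"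
    by (rule smooth_on_tension_field[OF W(1) orbifold_open_odom[OF Y(1,2)]
          riemannian_metric_on_subset[OF orbifold_metricD[OF X(1,2)] W(5)] orbifold_metricD[OF Y(1,2)] \<phi>W \<phi>d])
  ultimately show ?thesis
    using agree_on_closure[OF W(1) smooth_on_continuous, of "tension_field (g c) (h d) \<phi>" "\<lambda>_. 0" u
        "interior {y \<in> W. \<phi> y = \<gamma> (\<phi>' y)}"] W(6) \<gamma>(2) continuous_on_const by blast
qed

section \<open>The two implications\<close>

lemma frame_geometry_chart:
  assumes "riemannian_orbifold X A g" "c \<in> A"
  shows "frame_geometry (odom c) (g c) (chart_frames c)"
  using orbifold_open_odom[OF assms] orbifold_metricD[OF assms]
  by (simp add: frame_geometry_def chart_frames_Times)

lemma open_box_around: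
  fixes p :: "'a::euclidean_space \<times> 'b::euclidean_space"
  assumes "open N" "p \<in> N"
  obtains B1 B2 where "open B1" "open B2" "connected B2" "p \<in> B1 \<times> B2" "B1 \<times> B2 \<subseteq> N"
proof -
  obtain B1 C where BC: "open B1" "open C" "p \<in> B1 \<times> C" "B1 \<times> C \<subseteq> N"
    using open_prod_elim[OF assms] by blast
  have "snd p \<in> C" using BC(3) by (simp add: mem_Times_iff)
  \<comment> \<open>A ball in the matrix factor makes the fibre slices of the box connected.\<close>
  then obtain r where r: "0 < r" "ball (snd p) r \<subseteq> C" by (rule openE[OF BC(2)])
  show thesis
  proof (rule that[OF BC(1) open_ball connected_ball])
    show "p \<in> B1 \<times> ball (snd p) r" using BC(3) r(1) by (simp add: mem_Times_iff)
    show "B1 \<times> ball (snd p) r \<subseteq> N" using BC(4) r(2) by blast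
  qed
qed

text \<open>The fibres of a chart map are finite, so the base point of a covering map of frames cannot
  move continuously with the frame.\<close>

lemma frame_map_base_locally_constant:
  fixes G :: "(real^'n) \<times> (real^'n^'n) \<Rightarrow> (real^'m) \<times> (real^'m^'m)" and d :: "(real^'m, 'y) orb_chart"
  assumes d: "orbifold_chart Y d" and B: "connected B2" "v \<in> B1" "Q \<in> B2" "Q' \<in> B2" "B1 \<times> B2 \<subseteq> N"
    and G: "continuous_on N G" "\<And>q. q \<in> N \<Longrightarrow> fst (G q) \<in> odom d"
    and cover: "\<And>q. q \<in> N \<Longrightarrow> omap d (fst (G q)) = b (fst q)"
  shows "fst (G (v, Q)) = fst (G (v, Q'))"
proof -
  let ?F = "\<lambda>Q. fst (G (v, Q))"
  have mem: "(v, R) \<in> N" if "R \<in> B2" for R using B that by auto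
  have "continuous_on B2 (\<lambda>Q. (v, Q))" by (intro continuous_on_Pair continuous_on_const continuous_on_id)
  from continuous_on_compose2[OF G(1) this] have "continuous_on B2 (\<lambda>Q. G (v, Q))" using mem by blast
  then have "continuous_on B2 ?F" by (rule continuous_on_fst)
  then have "connected (?F ` B2)" by (rule connected_continuous_image[OF _ B(1)])
  \<comment> \<open>The covered map sees the first coordinate only, so the slice is sent into a
    single orbit.\<close>
  moreover have "?F ` B2 \<subseteq> (\<lambda>\<gamma>. \<gamma> (?F Q)) ` ogrp d"
  proof
    fix z assume "z \<in> ?F ` B2"
    then obtain R where R: "R \<in> B2" "z = ?F R" by blast
    then have "omap d (?F Q) = omap d z" using cover[OF mem[OF R(1)]] cover[OF mem[OF B(3)]] by simp
    moreover have "z \<in> odom d" using G(2)[OF mem[OF R(1)]] R(2) by simp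
    ultimately obtain \<gamma> where "\<gamma> \<in> ogrp d" "z = \<gamma> (?F Q)"
      using orbifold_chart_orbit[OF d G(2)[OF mem[OF B(3)]]] by blast
    then show "z \<in> (\<lambda>\<gamma>. \<gamma> (?F Q)) ` ogrp d" by blast
  qed
  moreover have "finite (ogrp d)" using d by (simp add: orbifold_chart_def)
  ultimately have "?F ` B2 = {} \<or> (\<exists>a. ?F ` B2 = {a})"
    using connected_finite_iff_sing[of "?F ` B2"] finite_subset[OF _ finite_imageI] by metis
  then obtain a where "?F ` B2 = {a}" using B(3) by blast
  then show ?thesis using imageI[OF B(3), of ?F] imageI[OF B(4), of ?F] by simp
qed

text \<open>A coordinate expression projects to a map \<open>\<phi>\<close> of charts covering
  \<open>base f\<close>, whose tension is compared with that of the chosen lift of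
  \<open>f\<close>.\<close>

lemma transversely_harmonic_if_harmonic:
  fixes A :: "(real^'n, 'x) orb_chart set" and B :: "(real^'m, 'y) orb_chart set"
  assumes X: "riemannian_orbifold X A g" and Y: "riemannian_orbifold Y B h"
    and f: "smooth_complete_map X A Y B f" and Lf: "induced_frame_map X A g Y B h f Lf"
    and harm: "harmonic_map X g h f"
  shows "transversely_harmonic (frame_bundle X A g) (frame_bundle Y B h) Lf"
  unfolding transversely_harmonic_def
proof (intro ballI allI impI)
  fix c1 c2 N G E p
  assume c1: "c1 \<in> fcharts (frame_bundle X A g)" and c2: "c2 \<in> fcharts (frame_bundle Y B h)"
    and ex: "coordinate_expression Lf c1 c2 N G \<and> foliated_frame c1 N E" and p: "p \<in> N"
  obtain c V where c1_eq: "c1 = \<lparr>fdom = V, fpar = frame_class A c, fsub = fst, fmet = frame_metric (g c)\<rparr>"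
    and c: "c \<in> A" "V \<subseteq> chart_frames c"
    using c1 by (auto simp: frame_bundle_def frame_charts_def)
  obtain d W where c2_eq: "c2 = \<lparr>fdom = W, fpar = frame_class B d, fsub = fst, fmet = frame_metric (h d)\<rparr>"
    and d: "d \<in> B" "open W" "W \<subseteq> chart_frames d"
    using c2 by (auto simp: frame_bundle_def frame_charts_def)
  have N: "open N" "N \<subseteq> chart_frames c" "smooth_on N G" "G ` N \<subseteq> W"
    and rep: "\<And>q. q \<in> N \<Longrightarrow> frame_class B d (G q) = Lf (frame_class A c q)"
    using ex c(2) by (auto simp: coordinate_expression_def c1_eq c2_eq)
  have Gd: "G q \<in> chart_frames d" if "q \<in> N" for q using N(4) d(3) that by blast
  have Gfst: "fst (G q) \<in> odom d" if "q \<in> N" for q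
    using Gd[OF that] by (simp add: chart_frames_Times mem_Times_iff)
  have cover: "omap d (fst (G q)) = base f (omap c (fst q))" if q: "q \<in> N" for q
  proof -
    have "frame_proj (Lf (frame_class A c q)) = base f (frame_proj (frame_class A c q))"
    proof -
      have "frame_class A c q \<in> linear_frames A"
        using N(2) q by (intro frame_class_in_linear_frames c(1)) blast
      then show ?thesis using Lf by (simp add: induced_frame_map_def)
    qed
    then show ?thesis
      using frame_proj_class[OF Y d(1), of "fst (G q)" "snd (G q)"] Gd[OF q]
        frame_proj_class[OF X c(1), of "fst q" "snd q"] q N(2) rep[OF q] by auto
  qed
  obtain B1 B2 where box: "open B1" "open B2" "connected B2" "p \<in> B1 \<times> B2" "B1 \<times> B2 \<subseteq> N"
    using open_box_around[OF N(1) p] by blast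
  \<comment> \<open>With the matrix coordinate frozen, smoothness is inherited from
    \<open>G\<close>; connected slices then make the choice of matrix irrelevant.\<close>
  define \<phi> where "\<phi> v = fst (G (v, snd p))" for v
  have in_N: "(v, snd p) \<in> N" if "v \<in> B1" for v using box that by auto
  have \<phi>: "smooth_on B1 \<phi>"
    unfolding \<phi>_def
    by (rule smooth_on_fst[OF box(1) smooth_on_compose[OF box(1) N(1) _ smooth_on_Pair[OF box(1) smooth_on_id smooth_on_const] N(3)]])
       (use in_N in auto)
  have G\<phi>: "fst (G q) = \<phi> (fst q)" if q: "q \<in> B1 \<times> B2" for q
  proof -
    have "fst (G (fst q, snd q)) = fst (G (fst q, snd p))"
      by (rule frame_map_base_locally_constant[where b = "\<lambda>u. base f (omap c u)",
            OF orbifold_chartD[OF Y d(1)] box(3) _ _ _ box(5) smooth_on_continuous[OF N(3)] Gfst cover])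
         (use q box(4) in auto)
    then show ?thesis by (simp add: \<phi>_def)
  qed
  have B1: "B1 \<subseteq> odom c" using in_N N(2) by (auto simp: chart_frames_def)
  have \<phi>d: "\<phi> ` B1 \<subseteq> odom d" using Gfst[OF in_N] by (auto simp: \<phi>_def)
  have u: "fst p \<in> B1" using box(4) by auto
  \<comment> \<open>The lift is taken at the base point of \<open>p\<close> itself, so that
    \<open>fst p\<close> corresponds to the centre 0, near which harmonicity gives
    information.\<close>
  define x where "x = omap c (fst p)"
  have x: "x \<in> topspace X"
    using u B1 X c(1) by (auto simp: x_def riemannian_orbifold_def orbifold_def orbifold_atlas_def)
  let ?s = "src f x" and ?t = "tgt f x"
  have st: "?s \<in> A" "?t \<in> B" "0 \<in> odom ?s" "omap ?s 0 = x"
    and l: "smooth_on (odom ?s) (lift f x)" "lift f x ` odom ?s \<subseteq> odom ?t"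
      "\<And>u. u \<in> odom ?s \<Longrightarrow> omap ?t (lift f x u) = base f (omap ?s u)"
    using f x by (auto simp: smooth_complete_map_def chart_centered_at_def)
  obtain S where S: "open S" "0 \<in> S" "\<forall>v\<in>S. tension_field (g ?s) (h ?t) (lift f x) v = 0"
    using harm x by (auto simp: harmonic_map_def eventually_nhds)
  have "tension_field (g c) (h d) \<phi> (fst p) = 0"
  proof (rule tension_field_lift_vanishes[OF X c(1) st(1) Y d(1) st(2) box(1) B1 \<phi> \<phi>d _ Int_lower1])
    show "open (odom ?s \<inter> S)" by (intro open_Int S(1) orbifold_open_odom[OF X st(1)])
    show "smooth_on (odom ?s \<inter> S) (lift f x)" by (rule smooth_on_subset[OF l(1)]) blast
    show "lift f x ` (odom ?s \<inter> S) \<subseteq> odom ?t" using l(2) by blast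
    show "omap d (\<phi> v) = base f (omap c v)" if "v \<in> B1" for v
      using cover[OF in_N[OF that]] by (simp add: \<phi>_def)
    show "omap ?t (lift f x v) = base f (omap ?s v)" if "v \<in> odom ?s \<inter> S" for v using l(3) that by blast
    show "fst p \<in> B1" by (rule u)
    show "0 \<in> odom ?s \<inter> S" using st(3) S(2) by blast
    show "omap c (fst p) = omap ?s 0" using st(4) by (simp add: x_def)
    show "tension_field (g ?s) (h ?t) (lift f x) v = 0" if "v \<in> odom ?s \<inter> S" for v using S(3) that by blast
  qed
  moreover have "transverse_tension c1 c2 G E p = frame_lift (h d) (G p) (tension_field (g c) (h d) \<phi> (fst p))"
    by (rule transverse_tension_eq[OF frame_geometry_chart[OF X c(1)] frame_geometry_chart[OF Y d(1)] _ _ _ _ _ _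
          N(2,3) _ _ box(1,2,5,4) \<phi> G\<phi>])
       (use d N(4) ex in \<open>auto simp: c1_eq c2_eq\<close>)
  ultimately show "transverse_tension c1 c2 G E p = 0"
    using linear_0[OF frame_geometry.frame_lift_linear[OF frame_geometry_chart[OF Y d(1)] Gd[OF p]]] by simp
qed

text \<open>By the definition of an induced map, the lift of \<open>f\<close> is itself the
  projection of a representative \<open>G\<close>. Evaluated on horizontal lifts of an orthonormal
  base frame, transverse harmonicity becomes vanishing tension of the lift.\<close>

lemma harmonic_if_transversely_harmonic:
  fixes A :: "(real^'n, 'x) orb_chart set" and B :: "(real^'m, 'y) orb_chart set"
  assumes X: "riemannian_orbifold X A g" and Y: "riemannian_orbifold Y B h"
    and f: "smooth_complete_map X A Y B f" and Lf: "induced_frame_map X A g Y B h f Lf"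
    and harm: "transversely_harmonic (frame_bundle X A g) (frame_bundle Y B h) Lf"
  shows "harmonic_map X g h f"
  unfolding harmonic_map_def
proof
  fix x assume x: "x \<in> topspace X"
  let ?s = "src f x" and ?t = "tgt f x"
  have st: "?s \<in> A" "?t \<in> B" "0 \<in> odom ?s" and l: "smooth_on (odom ?s) (lift f x)"
    using f x by (auto simp: smooth_complete_map_def chart_centered_at_def)
  \<comment> \<open>Any frame over the centre would serve; the identity matrix is one.\<close>
  have "invertible (mat 1 :: real^'n^'n)" by (simp add: invertible_det_nz)
  with Lf x have "\<exists>N G. open N \<and> (0, mat 1) \<in> N \<and> N \<subseteq> chart_frames ?s \<and> smooth_on N G \<and>
      G ` N \<subseteq> chart_frames ?t \<and> (\<forall>p\<in>N. frame_class B ?t (G p) = Lf (frame_class A ?s p)) \<and>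
      (\<forall>p\<in>N. fst (G p) = lift f x (fst p))"
    unfolding induced_frame_map_def by (elim conjE) (drule (1) bspec, drule spec, drule (1) mp)
  then obtain N G where N: "open N" "(0, mat 1) \<in> N" "N \<subseteq> chart_frames ?s" "smooth_on N G" "G ` N \<subseteq> chart_frames ?t"
    and rep: "\<forall>p\<in>N. frame_class B ?t (G p) = Lf (frame_class A ?s p)" and base: "\<forall>p\<in>N. fst (G p) = lift f x (fst p)"
    by (elim exE conjE)
  \<comment> \<open>Charts of the frame bundles must be injective under gluing, so the
    representative is restricted to such sets on both sides.\<close>
  obtain V where V: "open V" "(0, mat 1) \<in> V" "V \<subseteq> chart_frames ?s" "inj_on (frame_class A ?s) V"
    using frame_class_locally_injective[OF X st(1)] N(2,3) by blast
  obtain W where W: "open W" "G (0, mat 1) \<in> W" "W \<subseteq> chart_frames ?t" "inj_on (frame_class B ?t) W"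
    using frame_class_locally_injective[OF Y st(2)] N(2,5) by blast
  have "open ((N \<inter> G -` W) \<inter> V)"
    by (intro open_Int V(1) continuous_open_preimage[OF smooth_on_continuous[OF N(4)] N(1) W(1)])
  moreover have "(0, mat 1) \<in> (N \<inter> G -` W) \<inter> V" using N(2) V(2) W(2) by simp
  ultimately obtain B1 B2 where box: "open B1" "open B2" "connected B2" "(0, mat 1) \<in> B1 \<times> B2"
    "B1 \<times> B2 \<subseteq> (N \<inter> G -` W) \<inter> V"
    by (rule open_box_around)
  let ?B = "B1 \<times> B2"
  have B: "open ?B" "?B \<subseteq> N" "?B \<subseteq> V" "G ` ?B \<subseteq> W" "?B \<subseteq> chart_frames ?s"
    using box N(3) by (auto simp: open_Times)
  have B1: "B1 \<subseteq> odom ?s" using B(5) box(4) by (auto simp: chart_frames_def)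
  interpret G1: frame_geometry "odom ?s" "g ?s" "chart_frames ?s" by (rule frame_geometry_chart[OF X st(1)])
  note gB1 = riemannian_metric_on_subset[OF G1.metric B1]
  obtain e :: "real^'n \<Rightarrow> real^'n \<Rightarrow> real^'n" where e: "\<And>b. b \<in> Basis \<Longrightarrow> smooth_on B1 (e b)"
    and on: "\<And>v. v \<in> B1 \<Longrightarrow> orthonormal_family (g ?s v) (\<lambda>b. e b v)"
    by (rule smooth_orthonormal_frame[of B1 "g ?s", OF box(1) riemannian_metric_inner_form[OF gB1]
          riemannian_metric_smooth[OF gB1]]) (assumption, rule that)
  define E where "E a q = frame_lift (g ?s) q (e a (fst q))" for a q
  define c1 :: "('n frame_coords, real^'n, ('n, 'x) orb_frame) fol_chart"
    where "c1 = \<lparr>fdom = V, fpar = frame_class A ?s, fsub = fst, fmet = frame_metric (g ?s)\<rparr>"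
  define c2 :: "('m frame_coords, real^'m, ('m, 'y) orb_frame) fol_chart"
    where "c2 = \<lparr>fdom = W, fpar = frame_class B ?t, fsub = fst, fmet = frame_metric (h ?t)\<rparr>"
  have c1: "fsub c1 = fst" "fmet c1 = frame_metric (g ?s)" and c2: "fsub c2 = fst" "fmet c2 = frame_metric (h ?t)" "fdom c2 = W"
    by (simp_all add: c1_def c2_def)
  have charts: "c1 \<in> fcharts (frame_bundle X A g)" "c2 \<in> fcharts (frame_bundle Y B h)"
    using V W st by (auto simp: frame_bundle_def frame_charts_def c1_def c2_def)
  have expr: "coordinate_expression Lf c1 c2 ?B G"
    using B rep smooth_on_subset[OF N(4) B(2)] by (auto simp: coordinate_expression_def c1_def c2_def)
  have frame: "foliated_frame c1 ?B E"
    unfolding foliated_frame_def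
  proof (intro conjI ballI)
    show "smooth_on ?B (E a)" if a: "a \<in> Basis" for a
      unfolding E_def
      by (intro G1.frame_lift_smooth B smooth_on_compose[OF B(1) box(1) _ smooth_on_fst[OF B(1) smooth_on_id] e[OF a]]) auto
    show "E a q \<in> horizontal c1 q" if "q \<in> ?B" for a q
    proof -
      have "q \<in> chart_frames ?s" using that B(5) by blast
      then show ?thesis by (simp add: G1.horizontal_iff[OF c1] E_def)
    qed
    show "\<exists>e. \<forall>q\<in>?B. fderiv (fsub c1) q (E a q) = e (fsub c1 q)" for a
      by (intro exI[of _ "e a"]) (simp add: c1 fderiv_fst E_def)
    show "orthonormal_family (fmet c1 q) (\<lambda>a. E a q)" if "q \<in> ?B" for q
    proof -
      have "q \<in> chart_frames ?s" "fst q \<in> B1" using that B(5) by auto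
      then show ?thesis
        using on[of "fst q"] by (simp add: c1 E_def orthonormal_family_def G1.frame_metric_lift)
    qed
  qed
  have "tension_field (g ?s) (h ?t) (lift f x) v = 0" if v: "v \<in> B1" for v
  proof -
    \<comment> \<open>The box contains the identity frame over every \<open>v\<close> in
      \<open>B1\<close>.\<close>
    let ?q = "(v, mat 1) :: 'n frame_coords"
    have q: "?q \<in> ?B" using v box(4) by auto
    then have "transverse_tension c1 c2 G E ?q = 0"
      by (rule harm[unfolded transversely_harmonic_def, rule_format, OF charts conjI[OF expr frame]])
    moreover have "transverse_tension c1 c2 G E ?q = frame_lift (h ?t) (G ?q) (tension_field (g ?s) (h ?t) (lift f x) (fst ?q))"
      by (rule transverse_tension_eq[OF frame_geometry_chart[OF X st(1)] frame_geometry_chart[OF Y st(2)] c1 c2(1,2) _ _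
            B(5) smooth_on_subset[OF N(4) B(2)] _ frame box(1,2) subset_refl q smooth_on_subset[OF l B1]])
         (use W B base in \<open>auto simp: c2\<close>)
    \<comment> \<open>The first component of a horizontal lift is the vector lifted, so a zero lift
      comes from a zero vector.\<close>
    ultimately show ?thesis by (simp add: frame_lift_def zero_prod_def)
  qed
  then show "\<forall>\<^sub>F u in nhds 0. tension_field (g ?s) (h ?t) (lift f x) u = 0"
    using box(1,4) by (auto simp: eventually_nhds)
qed

theorem theorem6:
  fixes X :: "'x topology" and A :: "(real^'n, 'x) orb_chart set"
    and g :: "(real^'n, 'x) orb_chart \<Rightarrow> (real^'n) metric"
    and Y :: "'y topology" and B :: "(real^'m, 'y) orb_chart set"
    and h :: "(real^'m, 'y) orb_chart \<Rightarrow> (real^'m) metric"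
    and f :: "(real^'n, 'x, real^'m, 'y) complete_map"
    and Lf :: "('n, 'x) orb_frame \<Rightarrow> ('m, 'y) orb_frame"
  assumes "riemannian_orbifold X A g"
    and "riemannian_orbifold Y B h"
    and "complete_embedding X A Y B f"
    and "induced_frame_map X A g Y B h f Lf"
  shows "harmonic_map X g h f \<longleftrightarrow>
    transversely_harmonic (frame_bundle X A g) (frame_bundle Y B h) Lf"
  using assms transversely_harmonic_if_harmonic harmonic_if_transversely_harmonic
  unfolding complete_embedding_def by metis

end
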